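(* Let $f_i\in\mathbb{Z}[x_i]\setminus\mathbb{Z}$, $i=1,\dots,n$, let $g\in\mathbb{Z}[x_1,\dots,x_n]$ be nonzero, and let $\boldsymbol{\alpha}=(\alpha_1,\dots,\alpha_n)\in\mathbb{N}^n$. Set $\boldsymbol{d}=(d_1,\dots,d_n)\in\mathbb{N}^n$ with $d_i=\deg(f_i)$ and $e=\deg(g)$, and let $f_{i,d_i}$ be the leading coefficient of $f_i$, $i=1,\dots,n$. Then $$\Big(\prod_{i=1}^n f_{i,d_i}^{\,e+n-\langle\boldsymbol{\alpha}+\mathbf{1},\boldsymbol{d}-\epsilon_i\rangle}\Big)\cdot\mathrm{Res}_{\mathbb{A}^n_{\mathbb{C}}}\begin{bmatrix}g\,\mathrm{d}x_1\wedge\dots\wedge\mathrm{d}x_n\\ f_1^{\alpha_1+1},\dots,f_n^{\alpha_n+1}\end{bmatrix}\in\mathbb{Z}$$ and $$\log\bigg|\Big(\prod_{i=1}^n f_{i,d_i}^{\,e+n-\langle\boldsymbol{\alpha}+\mathbf{1},\boldsymbol{d}-\epsilon_i\rangle}\Big)\cdot\mathrm{Res}_{\mathbb{A}^n_{\mathbb{C}}}\begin{bmatrix}g\,\mathrm{d}x_1\wedge\dots\wedge\mathrm{d}x_n\\ f_1^{\alpha_1+1},\dots,f_n^{\alpha_n+1}\end{bmatrix}\bigg|\le\mathrm{h}_1(g)+(e+n-\langle\boldsymbol{\alpha}+\mathbf{1},\boldsymbol{d}\rangle)\sum_{i=1}^n\mathrm{h}(f_i)+(e-|\boldsymbol{d}|+n)\log(2).$$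 If $e<\langle\boldsymbol{\alpha}+\mathbf{1},\boldsymbol{d}\rangle-n$, then $\mathrm{Res}_{\mathbb{A}^n_{\mathbb{C}}}\begin{bmatrix}g\,\mathrm{d}x_1\wedge\dots\wedge\mathrm{d}x_n\\ f_1^{\alpha_1+1},\dots,f_n^{\alpha_n+1}\end{bmatrix}=0$.
   Context: $\mathbb{N}=\{0,1,2,\dots\}$, $\log 0=-\infty$, $\langle\cdot,\cdot\rangle$ is the standard scalar product, $|\boldsymbol{d}|=\sum_i d_i$, $\mathbf{1}=(1,\dots,1)$, and $\epsilon_i$ is the $i$-th standard basis vector of $\mathbb{R}^n$. For a nonzero polynomial with integer coefficients, $\mathrm{h}$ is the logarithm of the maximum, and $\mathrm{h}_1$ the logarithm of the sum, of the absolute values of its coefficients. Residues. The residue is $\frac{1}{(2\pi i)^n}\int_{\Gamma_{\boldsymbol{\varepsilon}}}\frac{g\,\mathrm{d}x_1\wedge\dots\wedge\mathrm{d}x_n}{f_1^{\alpha_1+1}\cdots f_n^{\alpha_n+1}}$, where $\Gamma_{\boldsymbol{\varepsilon}}=\{\boldsymbol{x}\in B_R:|f_i(x_i)|=\varepsilon_i,\ i=1,\dots,n\}$, with $B_R\subset\mathbb{C}^n$ an open ball centred at $0$ containing the finite set of common zeros of the $f_i$, $\varepsilon_i>0$ sufficiently small, and orientation (outside the zero set of the Jacobian) such that $\mathrm{d}\arg(f_1)\wedge\dots\wedge\mathrm{d}\arg(f_n)$ is positive. *)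

theory Defs
  imports
    "HOL-Analysis.Analysis"
    "HOL-Computational_Algebra.Polynomial"
    "HOL-Library.Poly_Mapping"
begin

text \<open>
  The coordinates of n-space are indexed by a finite type \<open>'n\<close>, so \<open>n = CARD('n)\<close>.
  An element of \<open>\<int>[x\<^sub>1, \<dots>, x\<^sub>n]\<close> maps an exponent vector to its coefficient. A polynomial
  \<open>f\<^sub>i \<in> \<int>[x\<^sub>i]\<close> is an element of \<^typ>\<open>int poly\<close> that is evaluated at the \<open>i\<close>-th coordinate.
\<close>

type_synonym 'n mpoly = "('n \<Rightarrow>\<^sub>0 nat) \<Rightarrow>\<^sub>0 int"

definition mpoly_eval :: "('n::finite) mpoly \<Rightarrow> complex ^ 'n \<Rightarrow> complex" where
  "mpoly_eval g x =
    (\<Sum>m\<in>Poly_Mapping.keys g.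
      of_int (Poly_Mapping.lookup g m) * (\<Prod>i\<in>UNIV. (x $ i) ^ Poly_Mapping.lookup m i))"

text \<open>Total degree; only meaningful for nonzero polynomials.\<close>

definition mpoly_degree :: "('n::finite) mpoly \<Rightarrow> nat" where
  "mpoly_degree g = Max ((\<lambda>m. \<Sum>i\<in>UNIV. Poly_Mapping.lookup m i) ` Poly_Mapping.keys g)"

definition cpoly :: "int poly \<Rightarrow> complex \<Rightarrow> complex" where
  "cpoly p z = poly (map_poly of_int p) z"

text \<open>Both heights are only meaningful for nonzero polynomials.\<close>

definition height :: "int poly \<Rightarrow> real" where
  "height p = ln (of_int (Max (abs ` set (coeffs p))))"

definition height1 :: "('n::finite) mpoly \<Rightarrow> real" where
  "height1 g = ln (of_int (\<Sum>m\<in>Poly_Mapping.keys g. \<bar>Poly_Mapping.lookup g m\<bar>))"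

text \<open>Logarithm on \<open>[0, \<infinity>)\<close> with \<open>log 0 = -\<infinity>\<close> (the library has \<open>ln 0 = 0\<close>).\<close>

definition elog :: "real \<Rightarrow> ereal" where
  "elog x = (if x = 0 then -\<infinity> else ereal (ln x))"

definition scalar_prod :: "('n::finite \<Rightarrow> int) \<Rightarrow> ('n \<Rightarrow> int) \<Rightarrow> int" where
  "scalar_prod u v = (\<Sum>i\<in>UNIV. u i * v i)"

definition std_basis :: "'n \<Rightarrow> 'n \<Rightarrow> int" where
  "std_basis i j = (if j = i then 1 else 0)"


text \<open>
  Integration of forms over a compact \<open>n\<close>-dimensional subset of \<open>\<complex>\<^sup>n\<close> goes through
  parametrizations by finitely many \<open>C\<^sup>1\<close> cubes \<open>\<phi> : [0,1]\<^sup>n \<rightarrow> \<complex>\<^sup>n\<close> (continuously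
  differentiable up to the boundary).
\<close>

definition cube_deriv :: "(real ^ 'n::finite \<Rightarrow> complex ^ 'n) \<Rightarrow> real ^ 'n \<Rightarrow> real ^ 'n \<Rightarrow> complex ^ 'n" where
  "cube_deriv \<phi> t = frechet_derivative \<phi> (at t within cbox 0 1)"

definition C1_cube :: "(real ^ 'n::finite \<Rightarrow> complex ^ 'n) \<Rightarrow> bool" where
  "C1_cube \<phi> \<longleftrightarrow>
    \<phi> differentiable_on cbox 0 1 \<and>
    (\<forall>v. continuous_on (cbox 0 1) (\<lambda>t. cube_deriv \<phi> t v))"

text \<open>
  The integral of \<open>F dx\<^sub>1 \<and> \<dots> \<and> dx\<^sub>n\<close> over a cube: the pullback of the form is
  \<open>F(\<phi>(t)) det(\<partial>\<phi>\<^sub>i/\<partial>t\<^sub>j) dt\<^sub>1 \<and> \<dots> \<and> dt\<^sub>n\<close>. Rows and columns carry the same unordered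
  index type. A choice of an order on it affects neither this determinant nor the one in
  \<open>arg_pullback\<close>.
\<close>

definition cube_integral ::
  "(complex ^ 'n::finite \<Rightarrow> complex) \<Rightarrow> (real ^ 'n \<Rightarrow> complex ^ 'n) \<Rightarrow> complex" where
  "cube_integral F \<phi> =
    integral (cbox 0 1)
      (\<lambda>t. F (\<phi> t) * det ((\<chi> i j. cube_deriv \<phi> t (axis j 1) $ i) :: complex ^ 'n ^ 'n))"

text \<open>
  The 1-form \<open>d arg(p) = Im (dp / p)\<close> at \<open>z\<close>, applied to the tangent vector \<open>v\<close>, and the
  coefficient of the pullback of \<open>d arg(f\<^sub>1) \<and> \<dots> \<and> d arg(f\<^sub>n)\<close> to a cube.
\<close>

definition darg :: "int poly \<Rightarrow> complex \<Rightarrow> complex \<Rightarrow> real" where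
  "darg p z v = Im (cpoly (pderiv p) z * v / cpoly p z)"

definition arg_pullback ::
  "('n::finite \<Rightarrow> int poly) \<Rightarrow> (real ^ 'n \<Rightarrow> complex ^ 'n) \<Rightarrow> real ^ 'n \<Rightarrow> real" where
  "arg_pullback f \<phi> t =
    det ((\<chi> i j. darg (f i) (\<phi> t $ i) (cube_deriv \<phi> t (axis j 1) $ i)) :: real ^ 'n ^ 'n)"

text \<open>
  \<open>\<Phi>\<close> dissects \<open>\<Gamma>\<close> into \<open>C\<^sup>1\<close> cubes that do not overlap except along images of faces, each of
  them positively oriented for \<open>d arg(f\<^sub>1) \<and> \<dots> \<and> d arg(f\<^sub>n)\<close>.
\<close>

definition oriented_param ::
  "('n::finite \<Rightarrow> int poly) \<Rightarrow> (complex ^ 'n) set \<Rightarrow> (real ^ 'n \<Rightarrow> complex ^ 'n) set \<Rightarrow> bool" where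
  "oriented_param f \<Gamma> \<Phi> \<longleftrightarrow>
    finite \<Phi> \<and>
    (\<forall>\<phi>\<in>\<Phi>. C1_cube \<phi> \<and> inj_on \<phi> (box 0 1) \<and> (\<forall>t\<in>box 0 1. arg_pullback f \<phi> t > 0)) \<and>
    disjoint_family_on (\<lambda>\<phi>. \<phi> ` box 0 1) \<Phi> \<and>
    (\<Union>\<phi>\<in>\<Phi>. \<phi> ` cbox 0 1) = \<Gamma>"

text \<open>The integral of \<open>F dx\<^sub>1 \<and> \<dots> \<and> dx\<^sub>n\<close> over \<open>\<Gamma>\<close> with this orientation is \<open>c\<close>.\<close>

definition has_cycle_integral ::
  "(complex ^ 'n::finite \<Rightarrow> complex) \<Rightarrow> ('n \<Rightarrow> int poly) \<Rightarrow> (complex ^ 'n) set \<Rightarrow> complex \<Rightarrow> bool" where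
  "has_cycle_integral F f \<Gamma> c \<longleftrightarrow>
    (\<exists>\<Phi>. oriented_param f \<Gamma> \<Phi>) \<and>
    (\<forall>\<Phi>. oriented_param f \<Gamma> \<Phi> \<longrightarrow> (\<Sum>\<phi>\<in>\<Phi>. cube_integral F \<phi>) = c)"

definition residue_cycle :: "('n::finite \<Rightarrow> int poly) \<Rightarrow> real \<Rightarrow> ('n \<Rightarrow> real) \<Rightarrow> (complex ^ 'n) set" where
  "residue_cycle f R \<epsilon> = {x \<in> ball 0 R. \<forall>i. norm (cpoly (f i) (x $ i)) = \<epsilon> i}"

definition common_zeros :: "('n::finite \<Rightarrow> int poly) \<Rightarrow> (complex ^ 'n) set" where
  "common_zeros f = {x. \<forall>i. cpoly (f i) (x $ i) = 0}"

text \<open>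
  The residue of \<open>g dx\<^sub>1 \<and> \<dots> \<and> dx\<^sub>n\<close> with respect to \<open>f\<^sub>1\<^bsup>\<alpha>\<^sub>1+1\<^esup>, \<dots>, f\<^sub>n\<^bsup>\<alpha>\<^sub>n+1\<^esup>\<close>: the common value
  of the integrals for all admissible radii \<open>R\<close> and all sufficiently small \<open>\<epsilon>\<close>.
\<close>

definition global_residue :: "('n::finite) mpoly \<Rightarrow> ('n \<Rightarrow> int poly) \<Rightarrow> ('n \<Rightarrow> nat) \<Rightarrow> complex" where
  "global_residue g f \<alpha> =
    (THE c. \<forall>R. common_zeros f \<subseteq> ball 0 R \<longrightarrow>
      (\<exists>\<delta>>0. \<forall>\<epsilon>. (\<forall>i. 0 < \<epsilon> i \<and> \<epsilon> i < \<delta>) \<longrightarrow>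
        has_cycle_integral
          (\<lambda>x. mpoly_eval g x / (\<Prod>i\<in>UNIV. cpoly (f i) (x $ i) ^ (\<alpha> i + 1)))
          f (residue_cycle f R \<epsilon>) ((2 * of_real pi * \<i>) ^ CARD('n) * c)))"

end

theory Submission
  imports Defs "HOL-Complex_Analysis.Conformal_Mappings" "HOL-Computational_Algebra.Fundamental_Theorem_Algebra"
begin

text \<open>
  Along a level curve \<open>|f\<^sub>i(x\<^sub>i)| = \<epsilon>\<^sub>i\<close> that contains no critical point, the angle
  \<open>\<theta>\<^sub>i = arg f\<^sub>i(x\<^sub>i)\<close> is a local coordinate and \<open>dx\<^sub>i = \<i> (f\<^sub>i / f\<^sub>i') d\<theta>\<^sub>i\<close>. Hence the residue
  integral is the integral over \<open>\<theta> \<in> [0, 2\<pi>)\<^sup>n\<close> of a sum over the fibre of all \<open>x\<close> with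
  \<open>f\<^sub>i(x\<^sub>i) = \<zeta>\<^sub>i = \<epsilon>\<^sub>i exp(\<i> \<theta>\<^sub>i)\<close>. The integrand is a sum over the monomials of \<open>g\<close> of products of
  functions of one variable, so that only the fibre sums \<open>\<Sum> x\<^sup>m / f'(x)\<close> over \<open>f(x) = \<zeta>\<close> have to be
  understood. Such a sum is the coefficient of \<open>1/x\<close> in the expansion of \<open>x\<^sup>m / (f - \<zeta>)\<close> at infinity,
  and thus a polynomial in \<open>\<zeta>\<close>, in which \<open>\<zeta>\<^sup>\<alpha>\<close> has as its coefficient the coefficient of \<open>1/x\<close> in
  \<open>x\<^sup>m / f\<^bsup>\<alpha>+1\<^esup>\<close> (\<open>fibre_sum_eq_residues\<close>). Integration over the circle, after division by \<open>\<zeta>\<^sup>\<alpha>\<close>,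
  selects this coefficient. So the global residue is the sum over the monomials \<open>m\<close> of \<open>g\<close> of
  \<open>g\<^sub>m\<close> times the product of the residues of \<open>x\<^bsup>m\<^sub>i\<^esup> / f\<^sub>i\<^bsup>\<alpha>\<^sub>i+1\<^esup>\<close> at infinity
  (\<open>global_residue_eq\<close>; the sign is that of the coefficient of \<open>1/x\<close>).

  The cycle is only given through its dissections into cubes, and the integral has to be the same
  for all of them. The circle of radius \<open>\<epsilon>\<^sub>i\<close> is cut into arcs so short that \<open>f\<^sub>i\<close> has \<open>deg f\<^sub>i\<close>
  inverse branches over each of them (\<open>exists_arcs\<close>). Products of branches over arcs form one
  dissection (\<open>oriented_param_charts\<close>). The cubes of any other one are cut along the same arcs, and
  the angles transform its integral into the integral over the first one
  (\<open>oriented_param_integral\<close>): positive orientation makes the Jacobian of the angles positive, and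
  the boundaries of the cubes have negligible image.

  For the arithmetic part, let \<open>c\<close> be the leading coefficient of \<open>f\<close>, let \<open>d\<close> be its degree, let
  \<open>H\<close> bound the absolute values of its coefficients, and put \<open>k = m + 1 - (\<alpha> + 1) d\<close>. The residue
  of \<open>x\<^sup>m / f\<^bsup>\<alpha>+1\<^esup>\<close> at infinity is zero if \<open>k < 0\<close>, and otherwise an integer divided by
  \<open>c\<^bsup>k+\<alpha>+1\<^esup>\<close>. This integer is given by a linear recurrence with integral coefficients, from which
  the bound \<open>H\<^sup>k 2\<^bsup>k+\<alpha>d\<^esup>\<close> follows by induction (\<open>inf_coeff_bound\<close>). Multiplied over all
  coordinates, with \<open>\<Sum> k\<^sub>i \<le> K = e + n - \<langle>\<alpha> + 1, d\<rangle>\<close>, these facts give the integrality, the height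
  bound and, as \<open>K < 0\<close> forces some \<open>k\<^sub>i < 0\<close>, the vanishing.
\<close>

section \<open>Residues at infinity in one variable\<close>

text \<open>
  With \<open>y = 1 / (c x)\<close>, where \<open>c\<close> is the leading coefficient, a polynomial of degree \<open>d\<close> is
  \<open>c x\<^sup>d (1 + p\<^bsub>d-1\<^esub> y + p\<^bsub>d-2\<^esub> c y\<^sup>2 + \<dots> + p\<^sub>0 c\<^bsup>d-1\<^esup> y\<^sup>d)\<close>. The number \<open>inf_coeff p b k\<close> is the coefficient
  of \<open>y\<^sup>k\<close> in the \<open>b\<close>-th inverse power of the factor in parentheses; the equation for \<open>Suc b\<close> comes
  from multiplying the \<open>(b+1)\<close>-st inverse power by this factor.
\<close>

function inf_coeff :: "int poly \<Rightarrow> nat \<Rightarrow> nat \<Rightarrow> int" where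
  "inf_coeff p 0 k = (if k = 0 then 1 else 0)"
| "inf_coeff p (Suc b) k = inf_coeff p b k
     - (\<Sum>i\<in>{1..min k (degree p)}. coeff p (degree p - i) * lead_coeff p ^ (i - 1) * inf_coeff p (Suc b) (k - i))"
  by pat_completeness auto
termination
  by (relation "(\<lambda>(p, b, k). b) <*mlex*> (\<lambda>(p, b, k). k) <*mlex*> {}") (auto simp: wf_mlex mlex_prod_def)

declare inf_coeff.simps(2) [simp del]

text \<open>
  The coefficient of \<open>1/x\<close> in the expansion of \<open>x\<^sup>m / p\<^sup>b\<close> at infinity, which is the sum of all
  residues of this rational function in the complex plane.
\<close>

definition univ_residue :: "int poly \<Rightarrow> nat \<Rightarrow> nat \<Rightarrow> complex" where
  "univ_residue p b m = (if b * degree p \<le> m + 1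
     then of_int (inf_coeff p b (m + 1 - b * degree p))
          / of_int (lead_coeff p) ^ (m + 1 - b * degree p + b)
     else 0)"

lemma geometric_sum_half:
  "(\<Sum>i\<in>{1..n}. (2::real) ^ (N - i)) \<le> 2 ^ N - 2 ^ (N - n)" if "n \<le> N"
  using that
proof (induction n)
  case (Suc n)
  have "N - n = Suc (N - Suc n)" using Suc.prems by simp
  then have "(2::real) ^ (N - n) = 2 * 2 ^ (N - Suc n)" by simp
  then show ?case using Suc by simp
qed simp

text \<open>
  Both inductions close because the powers of two that the recurrence adds up form a geometric sum
  and its remainder: \<open>2\<^bsup>k+bd\<^esup> = 2\<^bsup>k+(b-1)d\<^esup> + (2\<^bsup>k+bd-1\<^esup> + \<dots> + 2\<^bsup>k+bd-d\<^esup>)\<close>. For the first inverse power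
  the remainder is left out.
\<close>

lemma inf_coeff_bound:
  assumes H: "\<And>i. \<bar>coeff p i\<bar> \<le> H"
  shows "\<bar>inf_coeff p (Suc b) k\<bar> \<le> H ^ k * 2 ^ (k + b * degree p)"
proof (induction b arbitrary: k)
  case 0
  show ?case
  proof (induction k rule: less_induct)
    case (less k)
    have H0: "0 \<le> H" using H[of 0] by linarith
    show ?case
    proof (cases "k = 0")
      case False
      let ?d = "min k (degree p)"
      have "\<bar>inf_coeff p (Suc 0) k\<bar> \<le>
          (\<Sum>i\<in>{1..?d}. \<bar>coeff p (degree p - i) * lead_coeff p ^ (i - 1) * inf_coeff p (Suc 0) (k - i)\<bar>)"
        using False by (simp add: inf_coeff.simps(2)[of p 0 k] sum_abs)
      also have "\<dots> \<le> (\<Sum>i\<in>{1..?d}. H * H ^ (i - 1) * (H ^ (k - i) * 2 ^ (k - i)))"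
        unfolding abs_mult power_abs
        by (intro sum_mono mult_mono power_mono H order.trans[OF less]) (use H0 in auto)
      also have "\<dots> = (\<Sum>i\<in>{1..?d}. H ^ k * 2 ^ (k - i))"
        by (intro sum.cong refl) (simp add: power_add [symmetric] power_Suc [symmetric] mult.assoc [symmetric] del: power_Suc)
      also have "\<dots> = H ^ k * (\<Sum>i\<in>{1..?d}. 2 ^ (k - i))"
        by (simp add: sum_distrib_left)
      also have "(\<Sum>i\<in>{1..?d}. (2::int) ^ (k - i)) \<le> 2 ^ k"
      proof -
        have "real_of_int (\<Sum>i\<in>{1..?d}. (2::int) ^ (k - i)) \<le> 2 ^ k - 2 ^ (k - ?d)"
          using geometric_sum_half[of ?d k] by simp
        also have "\<dots> \<le> real_of_int (2 ^ k)" by simp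
        finally show ?thesis by (simp only: of_int_le_iff)
      qed
      finally show ?thesis using H0 by (simp add: mult_left_mono)
    next
      case True
      have "inf_coeff p (Suc 0) 0 = 1" by (subst inf_coeff.simps(2)) simp
      then show ?thesis using True by simp
    qed
  qed
next
  case (Suc b)
  show ?case
  proof (induction k rule: less_induct)
    case (less k)
    have H0: "0 \<le> H" using H[of 0] by linarith
    let ?d = "min k (degree p)" and ?N = "k + Suc b * degree p"
    have "\<bar>inf_coeff p (Suc (Suc b)) k\<bar> \<le> \<bar>inf_coeff p (Suc b) k\<bar> +
          \<bar>\<Sum>i\<in>{1..?d}. coeff p (degree p - i) * lead_coeff p ^ (i - 1) * inf_coeff p (Suc (Suc b)) (k - i)\<bar>"
      by (subst inf_coeff.simps(2)) (rule abs_triangle_ineq4)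
    also have "\<dots> \<le> \<bar>inf_coeff p (Suc b) k\<bar> +
          (\<Sum>i\<in>{1..?d}. \<bar>coeff p (degree p - i) * lead_coeff p ^ (i - 1) * inf_coeff p (Suc (Suc b)) (k - i)\<bar>)"
      by (intro add_left_mono sum_abs)
    also have "\<dots> \<le> H ^ k * 2 ^ (k + b * degree p) +
        (\<Sum>i\<in>{1..?d}. H * H ^ (i - 1) * (H ^ (k - i) * 2 ^ (k - i + Suc b * degree p)))"
      unfolding abs_mult power_abs
      by (intro add_mono sum_mono mult_mono power_mono H Suc.IH less) (use H0 in auto)
    also have "\<dots> = H ^ k * 2 ^ (k + b * degree p) + (\<Sum>i\<in>{1..?d}. H ^ k * 2 ^ (?N - i))"
      by (intro arg_cong2[where f = "(+)"] sum.cong refl)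
         (simp add: power_add [symmetric] power_Suc [symmetric] mult.assoc [symmetric] del: power_Suc)
    also have "\<dots> = H ^ k * (2 ^ (k + b * degree p) + (\<Sum>i\<in>{1..?d}. 2 ^ (?N - i)))"
      by (simp add: sum_distrib_left ring_distribs)
    also have "(2::int) ^ (k + b * degree p) + (\<Sum>i\<in>{1..?d}. 2 ^ (?N - i)) \<le> 2 ^ ?N"
    proof -
      have "k + b * degree p \<le> ?N - ?d" by simp
      then have "(2::real) ^ (k + b * degree p) \<le> 2 ^ (?N - ?d)"
        by (intro power_increasing) auto
      moreover have "real_of_int (\<Sum>i\<in>{1..?d}. (2::int) ^ (?N - i)) \<le> 2 ^ ?N - 2 ^ (?N - ?d)"
        using geometric_sum_half[of ?d ?N] by simp
      ultimately have "real_of_int (2 ^ (k + b * degree p) + (\<Sum>i\<in>{1..?d}. (2::int) ^ (?N - i))) \<le> real_of_int (2 ^ ?N)"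
        by (simp only: of_int_add of_int_power of_int_numeral)
      then show ?thesis by (simp only: of_int_le_iff)
    qed
    finally show ?case using H0 by (simp add: mult_left_mono)
  qed
qed

text \<open>
  Coefficients of \<open>1/x\<close> in the identity \<open>x\<^sup>m p / p\<^bsup>b+1\<^esup> = x\<^sup>m / p\<^sup>b\<close>.
\<close>

lemma univ_residue_recurrence:
  assumes d: "degree p > 0"
  shows "of_int (lead_coeff p) * univ_residue p (Suc b) (m + degree p) =
    univ_residue p b m - (\<Sum>j<degree p. of_int (coeff p j) * univ_residue p (Suc b) (m + j))"
proof -
  define d where "d = degree p"
  define c :: complex where "c = of_int (lead_coeff p)"
  have c: "c \<noteq> 0" and d0: "d > 0" using d by (auto simp: c_def d_def)
  show ?thesis
  proof (cases "b * d \<le> m + 1")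
    case False
    then show ?thesis by (simp add: univ_residue_def d_def)
  next
    case True
    define k where "k = m + 1 - b * d"
    have mk: "m + 1 = k + b * d" using True by (simp add: k_def)
    have 1: "univ_residue p (Suc b) (m + d) = of_int (inf_coeff p (Suc b) k) / c ^ (k + Suc b)"
      using mk by (simp add: univ_residue_def c_def flip: d_def)
    have 2: "univ_residue p b m = of_int (inf_coeff p b k) / c ^ (k + b)"
      using mk by (simp add: univ_residue_def c_def flip: d_def)
    have 3: "univ_residue p (Suc b) (m + (d - i)) =
        (if i \<le> k then of_int (inf_coeff p (Suc b) (k - i)) / c ^ (k - i + Suc b) else 0)"
      if "i \<in> {1..d}" for i
    proof -
      have "Suc b * d \<le> m + (d - i) + 1 \<longleftrightarrow> i \<le> k" and "m + (d - i) + 1 - Suc b * d = k - i"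
        using that mk by (auto simp: algebra_simps)
      then show ?thesis by (simp add: univ_residue_def c_def flip: d_def)
    qed
    have "(\<Sum>j<d. of_int (coeff p j) * univ_residue p (Suc b) (m + j)) =
       (\<Sum>i\<in>{1..d}. of_int (coeff p (d - i)) * univ_residue p (Suc b) (m + (d - i)))"
      by (rule sum.reindex_bij_witness[of _ "\<lambda>i. d - i" "\<lambda>j. d - j"]) auto
    also have "\<dots> = (\<Sum>i\<in>{1..d}. if i \<le> k then
        of_int (coeff p (d - i)) * of_int (inf_coeff p (Suc b) (k - i)) / c ^ (k - i + Suc b) else 0)"
      by (intro sum.cong refl, subst 3) (auto simp del: power_Suc)
    also have "\<dots> = (\<Sum>i\<in>{1..min k d}.
        of_int (coeff p (d - i)) * of_int (inf_coeff p (Suc b) (k - i)) / c ^ (k - i + Suc b))"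
      by (subst sum.inter_filter [symmetric]) (auto intro!: sum.cong)
    also have "\<dots> = (\<Sum>i\<in>{1..min k d}.
        of_int (coeff p (d - i) * lead_coeff p ^ (i - 1) * inf_coeff p (Suc b) (k - i))) / c ^ (k + b)"
      unfolding sum_divide_distrib
    proof (intro sum.cong refl)
      fix i assume i: "i \<in> {1..min k d}"
      then have "c ^ (k + b) = c ^ (i - 1) * c ^ (k - i + Suc b)"
        by (simp flip: power_add add: Suc_diff_le del: power_Suc)
      then show "of_int (coeff p (d - i)) * of_int (inf_coeff p (Suc b) (k - i)) / c ^ (k - i + Suc b) =
        of_int (coeff p (d - i) * lead_coeff p ^ (i - 1) * inf_coeff p (Suc b) (k - i)) / c ^ (k + b)"
        using c by (simp add: c_def [symmetric])
    qed
    finally have 4: "(\<Sum>j<d. of_int (coeff p j) * univ_residue p (Suc b) (m + j)) =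
      of_int (inf_coeff p b k - inf_coeff p (Suc b) k) / c ^ (k + b)"
      by (simp add: inf_coeff.simps(2)[of p b k] d_def)
    show ?thesis
      unfolding c_def [symmetric] unfolding d_def [symmetric] 1 2 4 using c by (simp add: field_simps)
  qed
qed

lemma univ_residue_eq_0: "univ_residue p (Suc b) m = 0" if "degree p > 0" "b > m"
proof -
  have "Suc b * 1 \<le> Suc b * degree p" using that by (intro mult_le_mono2) linarith
  moreover have "Suc m < Suc b * 1" using that by simp
  ultimately have "Suc m < Suc b * degree p" by (rule order.strict_trans2[rotated])
  then show ?thesis by (simp add: univ_residue_def)
qed

lemma degree_map_of_int [simp]: "degree (map_poly of_int p :: complex poly) = degree p"
  by (intro degree_map_poly) auto

lemma cpoly_eq_poly_sum: "cpoly p x = (\<Sum>i\<le>degree p. of_int (coeff p i) * x ^ i)"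
  by (simp add: cpoly_def poly_altdef coeff_map_poly)

lemma cpoly_pderiv: "cpoly (pderiv p) x = poly (pderiv (map_poly of_int p)) x"
proof -
  have "map_poly of_int (pderiv p) = (pderiv (map_poly of_int p) :: complex poly)"
    by (rule poly_eqI) (simp add: coeff_map_poly coeff_pderiv)
  then show ?thesis by (simp add: cpoly_def)
qed

definition shifted :: "int poly \<Rightarrow> complex \<Rightarrow> complex poly" where
  "shifted p \<zeta> = map_poly of_int p - [:\<zeta>:]"

lemma poly_shifted: "poly (shifted p \<zeta>) x = cpoly p x - \<zeta>"
  by (simp add: shifted_def cpoly_def)

lemma degree_shifted: "degree (shifted p \<zeta>) = degree p" if "degree p > 0"
  using that degree_add_eq_left[of "[:- \<zeta>:]" "map_poly of_int p"]
  by (simp add: shifted_def diff_conv_add_uminus del: add_uminus_conv_diff)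

lemma lead_coeff_shifted: "lead_coeff (shifted p \<zeta>) = of_int (lead_coeff p)" if "degree p > 0"
  unfolding degree_shifted[OF that] using that by (cases "degree p") (simp_all add: shifted_def coeff_map_poly)

lemma finite_fibre: "finite {x. cpoly p x = \<zeta>}" if "degree p > 0"
proof -
  have "shifted p \<zeta> \<noteq> 0" using degree_shifted[OF that, of \<zeta>] that by force
  then have "finite {x. poly (shifted p \<zeta>) x = 0}" by (rule poly_roots_finite)
  then show ?thesis by (simp add: poly_shifted)
qed

lemma card_fibre_le: "card {x. cpoly p x = \<zeta>} \<le> degree p" if "degree p > 0"
proof -
  have "shifted p \<zeta> \<noteq> 0" using degree_shifted[OF that, of \<zeta>] that by force
  then show ?thesis using card_poly_roots_bound[of "shifted p \<zeta>"] that by (simp add: poly_shifted degree_shifted)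
qed

lemma shifted_eq_prod:
  assumes d: "degree p > 0" and nc: "\<And>x. cpoly p x = \<zeta> \<Longrightarrow> cpoly (pderiv p) x \<noteq> 0"
  shows "shifted p \<zeta> = smult (of_int (lead_coeff p)) (\<Prod>z | cpoly p z = \<zeta>. [:- z, 1:])"
proof -
  let ?q = "shifted p \<zeta>"
  have q0: "?q \<noteq> 0" using degree_shifted[OF d, of \<zeta>] d by force
  have pd: "pderiv ?q = pderiv (map_poly of_int p)"
    by (simp add: shifted_def pderiv_diff pderiv_pCons)
  have "rsquarefree ?q"
    unfolding rsquarefree_roots using nc by (auto simp: pd poly_shifted cpoly_pderiv)
  then have o: "order z ?q = 1" if "poly ?q z = 0" for z
    using that q0 unfolding rsquarefree_def by (metis order_root)
  have "?q = smult (lead_coeff ?q) (\<Prod>z | poly ?q z = 0. [:- z, 1:] ^ order z ?q)"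
    by (rule complex_poly_decompose [symmetric])
  also have "\<dots> = smult (of_int (lead_coeff p)) (\<Prod>z | cpoly p z = \<zeta>. [:- z, 1:])"
    using o by (intro arg_cong2[where f = smult] prod.cong) (auto simp: lead_coeff_shifted[OF d] poly_shifted)
  finally show ?thesis .
qed

lemma card_fibre:
  assumes d: "degree p > 0" and nc: "\<And>x. cpoly p x = \<zeta> \<Longrightarrow> cpoly (pderiv p) x \<noteq> 0"
  shows "card {x. cpoly p x = \<zeta>} = degree p"
proof -
  have "degree (shifted p \<zeta>) = card {x. cpoly p x = \<zeta>}"
    using d by (subst shifted_eq_prod[OF assms]) (auto simp: degree_prod_sum_eq)
  then show ?thesis using degree_shifted[OF d] by simp
qed

lemma cpoly_pderiv_fibre:
  assumes d: "degree p > 0" and nc: "\<And>x. cpoly p x = \<zeta> \<Longrightarrow> cpoly (pderiv p) x \<noteq> 0"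
    and w: "cpoly p w = \<zeta>"
  shows "cpoly (pderiv p) w = of_int (lead_coeff p) * (\<Prod>z\<in>{z. cpoly p z = \<zeta>} - {w}. w - z)"
proof -
  let ?Z = "{z. cpoly p z = \<zeta>}"
  note fin = finite_fibre[OF d, of \<zeta>]
  have "cpoly (pderiv p) w = poly (pderiv (shifted p \<zeta>)) w"
    by (simp add: shifted_def pderiv_diff pderiv_pCons cpoly_pderiv)
  also have "\<dots> = of_int (lead_coeff p) * (\<Sum>a\<in>?Z. \<Prod>z\<in>?Z - {a}. w - z)"
    by (subst shifted_eq_prod[OF d nc]) (auto simp: pderiv_smult pderiv_prod poly_sum poly_prod pderiv_pCons)
  also have "(\<Sum>a\<in>?Z. \<Prod>z\<in>?Z - {a}. w - z) = (\<Sum>a\<in>?Z. if a = w then \<Prod>z\<in>?Z - {w}. w - z else 0)"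
    using fin w by (intro sum.cong refl) auto
  also have "\<dots> = (\<Prod>z\<in>?Z - {w}. w - z)"
    using fin w by simp
  finally show ?thesis .
qed

text \<open>
  The Euler--Jacobi formula. Lagrange interpolation of \<open>x\<^sup>m\<close> at the points of a fibre without critical
  points reproduces \<open>x\<^sup>m\<close> for \<open>m < d\<close>, and the coefficient of \<open>x\<^bsup>d-1\<^esup>\<close> in the interpolation
  polynomial is \<open>c\<close> times the sum in question, because \<open>p'(w) = c \<Prod>\<^bsub>z \<noteq> w\<^esub> (w - z)\<close>.
\<close>

lemma euler_jacobi:
  assumes d: "degree p > 0" and nc: "\<And>x. cpoly p x = \<zeta> \<Longrightarrow> cpoly (pderiv p) x \<noteq> 0"
    and m: "m < degree p"
  shows "(\<Sum>x | cpoly p x = \<zeta>. x ^ m / cpoly (pderiv p) x) =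
    (if m + 1 = degree p then 1 / of_int (lead_coeff p) else 0)"
proof -
  let ?Z = "{z. cpoly p z = \<zeta>}" and ?c = "of_int (lead_coeff p) :: complex"
  note fin = finite_fibre[OF d, of \<zeta>]
  have card: "card ?Z = degree p" by (rule card_fibre[OF d nc])
  have c: "?c \<noteq> 0" using d by auto
  \<comment> \<open>The interpolation polynomial, with \<open>p'(w) / c\<close> for the product of the differences of the nodes.\<close>
  define q where "q = (\<Sum>w\<in>?Z. smult (w ^ m * ?c / cpoly (pderiv p) w) (\<Prod>z\<in>?Z - {w}. [:- z, 1:]))"
  have degp: "degree (\<Prod>z\<in>?Z - {w}. [:- z, 1:]) = degree p - 1"
    "coeff (\<Prod>z\<in>?Z - {w}. [:- z, 1:]) (degree p - 1) = 1" if "w \<in> ?Z" for w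
  proof -
    have D: "degree (\<Prod>z\<in>?Z - {w}. [:- z, 1:]) = card (?Z - {w})"
      by (subst degree_prod_sum_eq) auto
    show 1: "degree (\<Prod>z\<in>?Z - {w}. [:- z, 1:]) = degree p - 1"
      unfolding D using card fin that by (subst card_Diff_singleton) auto
    have "lead_coeff (\<Prod>z\<in>?Z - {w}. [:- z, 1:]) = 1"
      by (simp add: lead_coeff_prod)
    then show "coeff (\<Prod>z\<in>?Z - {w}. [:- z, 1:]) (degree p - 1) = 1" unfolding 1 .
  qed
  have "q = monom 1 m"
  proof (rule poly_eqI_degree[of ?Z])
    fix x assume x: "x \<in> ?Z"
    have "poly q x = (\<Sum>w\<in>?Z. if w = x then x ^ m else 0)"
      unfolding q_def poly_sum
    proof (intro sum.cong refl)
      fix w assume w: "w \<in> ?Z"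
      show "poly (smult (w ^ m * ?c / cpoly (pderiv p) w) (\<Prod>z\<in>?Z - {w}. [:- z, 1:])) x =
        (if w = x then x ^ m else 0)"
      proof (cases "w = x")
        case True
        then show ?thesis
          using cpoly_pderiv_fibre[OF d nc, of \<zeta> x] x nc[of x] by (simp add: poly_prod)
      next
        case False
        then have "(\<Prod>z\<in>?Z - {w}. x - z) = 0"
          using x fin by (intro prod_zero) auto
        then show ?thesis using False by (simp add: poly_prod)
      qed
    qed
    also have "\<dots> = x ^ m" using fin x by simp
    finally show "poly q x = poly (monom 1 m) x" by (simp add: poly_monom)
  next
    have "degree q \<le> degree p - 1"
      unfolding q_def by (intro degree_sum_le fin) (use degp(1) in \<open>auto intro: order.trans[OF degree_smult_le]\<close>)
    then show "degree q < card ?Z" using d card by simp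
    show "degree (monom (1::complex) m) < card ?Z" using m card by (simp add: degree_monom_eq)
  qed
  then have "coeff q (degree p - 1) = (if m = degree p - 1 then 1 else 0)"
    by simp
  moreover have "coeff q (degree p - 1) = (\<Sum>w\<in>?Z. w ^ m * ?c / cpoly (pderiv p) w)"
    using degp(2) by (simp add: q_def coeff_sum)
  moreover have "\<dots> = ?c * (\<Sum>x\<in>?Z. x ^ m / cpoly (pderiv p) x)"
    by (simp add: sum_distrib_left mult_ac)
  ultimately show ?thesis using c d by (auto simp: field_simps split: if_splits)
qed

text \<open>
  Multiplication of \<open>p(x) = \<zeta>\<close> by \<open>x\<^sup>m / p'(x)\<close> and summation over the fibre yields a linear
  recurrence in \<open>m\<close> for the left-hand side. The right-hand side satisfies the same one by
  \<open>univ_residue_recurrence\<close>, and the initial values are those of the Euler--Jacobi formula.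
\<close>

lemma fibre_sum_eq_residues:
  assumes d: "degree p > 0" and nc: "\<And>x. cpoly p x = \<zeta> \<Longrightarrow> cpoly (pderiv p) x \<noteq> 0"
  shows "(\<Sum>x | cpoly p x = \<zeta>. x ^ m / cpoly (pderiv p) x) = (\<Sum>b\<le>m. \<zeta> ^ b * univ_residue p (Suc b) m)"
proof (induction m rule: less_induct)
  case (less m)
  let ?Z = "{z. cpoly p z = \<zeta>}" and ?c = "of_int (lead_coeff p) :: complex"
  note fin = finite_fibre[OF d, of \<zeta>]
  have c: "?c \<noteq> 0" using d by auto
  show ?case
  proof (cases "m < degree p")
    case True
    have "univ_residue p (Suc b) m = (if b = 0 \<and> m + 1 = degree p then 1 / ?c else 0)" for b
    proof -
      have "b = 0 \<and> m + 1 = degree p" if "Suc b * degree p \<le> m + 1"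
      proof -
        have "b * degree p + degree p \<le> degree p" using that True unfolding mult_Suc by linarith
        then have "b * degree p = 0" by simp
        then have "b = 0" using d by simp
        then show ?thesis using that True by simp
      qed
      then have "Suc b * degree p \<le> m + 1 \<longleftrightarrow> b = 0 \<and> m + 1 = degree p"
        by fastforce
      moreover have "inf_coeff p (Suc 0) 0 = 1" by (subst inf_coeff.simps(2)) simp
      ultimately show ?thesis
        unfolding univ_residue_def by (cases "b = 0 \<and> m + 1 = degree p") (simp, auto)
    qed
    then have "(\<Sum>b\<le>m. \<zeta> ^ b * univ_residue p (Suc b) m) =
       (\<Sum>b\<le>m. if b = 0 then (if m + 1 = degree p then 1 / ?c else 0) else 0)"
      by (intro sum.cong refl) simp
    then show ?thesis using euler_jacobi[OF d nc True] by simp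
  next
    case False
    define M where "M = m - degree p"
    have m: "m = M + degree p" using False by (simp add: M_def)
    let ?T = "\<lambda>m. \<Sum>x\<in>?Z. x ^ m / cpoly (pderiv p) x"
    let ?r = "\<lambda>m. \<Sum>b\<le>m. \<zeta> ^ b * univ_residue p (Suc b) m"
    have rext: "?r k = (\<Sum>b\<le>m. \<zeta> ^ b * univ_residue p (Suc b) k)" if "k \<le> m" for k
      by (rule sum.mono_neutral_left) (use that univ_residue_eq_0[OF d] in auto)
    have "\<zeta> * ?T M = (\<Sum>x\<in>?Z. cpoly p x * x ^ M / cpoly (pderiv p) x)"
      unfolding sum_distrib_left by (intro sum.cong refl) simp
    also have "\<dots> = (\<Sum>x\<in>?Z. \<Sum>i\<le>degree p. of_int (coeff p i) * (x ^ (M + i) / cpoly (pderiv p) x))"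
      by (intro sum.cong refl, subst cpoly_eq_poly_sum[of p])
         (simp add: sum_distrib_right sum_distrib_left sum_divide_distrib power_add mult_ac)
    also have "\<dots> = (\<Sum>i\<le>degree p. of_int (coeff p i) * ?T (M + i))"
      by (subst sum.swap) (simp only: sum_distrib_left)
    also have "\<dots> = ?c * ?T m + (\<Sum>i<degree p. of_int (coeff p i) * ?T (M + i))"
      by (simp only: m lessThan_Suc_atMost [symmetric] sum.lessThan_Suc add.commute)
    also have "(\<Sum>i<degree p. of_int (coeff p i) * ?T (M + i)) = (\<Sum>i<degree p. of_int (coeff p i) * ?r (M + i))"
      by (intro sum.cong refl arg_cong2[where f = "(*)"] less) (simp add: m)
    finally have T: "?c * ?T m = \<zeta> * ?T M - (\<Sum>i<degree p. of_int (coeff p i) * ?r (M + i))"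
      by (simp add: algebra_simps)
    have "M < m" using d by (simp add: m)
    then have TM: "?T M = ?r M" by (rule less)
    have "?c * ?r m = (\<Sum>b\<le>m. \<zeta> ^ b * (?c * univ_residue p (Suc b) (M + degree p)))"
      unfolding sum_distrib_left m by (intro sum.cong refl) (simp only: mult_ac)
    also have "\<dots> = (\<Sum>b\<le>m. \<zeta> ^ b * univ_residue p b M) -
       (\<Sum>b\<le>m. \<Sum>i<degree p. of_int (coeff p i) * (\<zeta> ^ b * univ_residue p (Suc b) (M + i)))"
      by (simp only: univ_residue_recurrence[OF d] right_diff_distrib sum_subtractf)
         (simp only: sum_distrib_left mult_ac)
    also have "(\<Sum>b\<le>m. \<Sum>i<degree p. of_int (coeff p i) * (\<zeta> ^ b * univ_residue p (Suc b) (M + i))) =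
       (\<Sum>i<degree p. of_int (coeff p i) * ?r (M + i))"
      by (subst sum.swap, intro sum.cong refl, subst rext) (simp_all only: sum_distrib_left lessThan_iff, simp add: m)
    also have "(\<Sum>b\<le>m. \<zeta> ^ b * univ_residue p b M) = \<zeta> * ?r M"
    proof -
      obtain m' where m': "m = Suc m'" using \<open>M < m\<close> by (cases m) auto
      have "(\<Sum>b\<le>m. \<zeta> ^ b * univ_residue p b M) = univ_residue p 0 M + (\<Sum>b\<le>m'. \<zeta> ^ Suc b * univ_residue p (Suc b) M)"
        unfolding m' by (subst sum.atMost_Suc_shift) simp
      also have "univ_residue p 0 M = 0" by (simp add: univ_residue_def)
      also have "(\<Sum>b\<le>m'. \<zeta> ^ Suc b * univ_residue p (Suc b) M) = (\<Sum>b\<le>M. \<zeta> ^ Suc b * univ_residue p (Suc b) M)"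
        by (rule sum.mono_neutral_right) (use univ_residue_eq_0[OF d] \<open>M < m\<close> m' in auto)
      finally show ?thesis by (simp add: sum_distrib_left mult_ac)
    qed
    finally have "?c * ?r m = ?c * ?T m" by (simp only: T TM)
    then show ?thesis using c by simp
  qed
qed

section \<open>Change of variables over an arbitrary finite index type\<close>

lemma swapidseq_conjugate:
  assumes r: "bij r" and "swapidseq n p"
  shows "swapidseq n (r \<circ> p \<circ> inv r)"
  using assms(2)
proof induction
  case id
  have "r \<circ> id \<circ> inv r = id" using r by (simp add: fun_eq_iff bij_is_surj surj_f_inv_f)
  then show ?case by (simp only: swapidseq.id)
next
  case (comp_Suc n p a b)
  have "r \<circ> (Transposition.transpose a b \<circ> p) \<circ> inv r = Transposition.transpose (r a) (r b) \<circ> (r \<circ> p \<circ> inv r)"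
    using r by (auto simp: fun_eq_iff Transposition.transpose_def bij_is_inj inj_eq)
  moreover have "r a \<noteq> r b" using comp_Suc.hyps r by (simp add: bij_is_inj inj_eq)
  ultimately show ?case using comp_Suc.IH swapidseq.comp_Suc by metis
qed

lemma sign_conjugate:
  fixes r :: "'a::finite \<Rightarrow> 'b::finite"
  assumes r: "bij r" and p: "p permutes UNIV"
  shows "sign (r \<circ> p \<circ> inv r) = sign p"
proof -
  obtain n where n: "swapidseq n p"
    using p finite permutes_imp_permutation unfolding permutation_def by blast
  from swapidseq_conjugate[OF r this] n show ?thesis
    by (metis evenperm_unique sign_def)
qed

text \<open>
  Conjugation with the bijection matches the permutations in the two Leibniz sums and preserves
  their signs.
\<close>

lemma det_reindex:
  fixes r :: "'b::finite \<Rightarrow> 'a::finite" and A :: "'c::comm_ring_1 ^ 'a ^ 'a"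
  assumes r: "bij r"
  shows "det (\<chi> i j. A $ r i $ r j) = det A"
proof -
  have "det A = (\<Sum>p | p permutes UNIV. of_int (sign p) * (\<Prod>i\<in>UNIV. A $ i $ p i))"
    by (simp add: det_def)
  also have "\<dots> = (\<Sum>q | q permutes (UNIV :: 'b set). of_int (sign q) * (\<Prod>i\<in>UNIV. A $ r i $ r (q i)))"
  proof (rule sum.reindex_bij_witness[of _ "\<lambda>q. r \<circ> q \<circ> inv r" "\<lambda>p. inv r \<circ> p \<circ> r"])
    fix q :: "'b \<Rightarrow> 'b" assume q: "q \<in> {q. q permutes UNIV}"
    then show "r \<circ> q \<circ> inv r \<in> {p. p permutes UNIV}"
      using r by (auto simp: permutes_bij bij_imp_bij_inv intro!: bij_imp_permutes bij_comp)
    show "inv r \<circ> (r \<circ> q \<circ> inv r) \<circ> r = q"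
      using r by (auto simp: fun_eq_iff bij_is_inj)
  next
    fix p :: "'a \<Rightarrow> 'a" assume p: "p \<in> {q. q permutes UNIV}"
    then show p': "inv r \<circ> p \<circ> r \<in> {p. p permutes UNIV}"
      using r by (auto simp: permutes_bij bij_imp_bij_inv intro!: bij_imp_permutes bij_comp)
    show inv: "r \<circ> (inv r \<circ> p \<circ> r) \<circ> inv r = p"
      using r by (auto simp: fun_eq_iff bij_is_surj surj_f_inv_f)
    have "sign (inv r \<circ> p \<circ> r) = sign p"
      using sign_conjugate[OF r, of "inv r \<circ> p \<circ> r"] p' inv by simp
    moreover have "(\<Prod>i\<in>UNIV. A $ r i $ r ((inv r \<circ> p \<circ> r) i)) = (\<Prod>i\<in>UNIV. A $ i $ p i)"
      using r by (intro prod.reindex_bij_betw[OF r, THEN trans[rotated]] )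
        (auto simp: bij_is_surj surj_f_inv_f)
    ultimately show "of_int (sign (inv r \<circ> p \<circ> r)) * (\<Prod>i\<in>UNIV. A $ r i $ r ((inv r \<circ> p \<circ> r) i)) =
        of_int (sign p) * (\<Prod>i\<in>UNIV. A $ i $ p i)" by simp
  qed
  finally show ?thesis by (simp add: det_def)
qed

definition reindex :: "('b \<Rightarrow> 'a) \<Rightarrow> real ^ 'a \<Rightarrow> real ^ 'b" where
  "reindex r x = (\<chi> i. x $ r i)"

lemma reindex_inverse [simp]:
  assumes "bij r"
  shows "reindex (inv r) (reindex r x) = x" "reindex r (reindex (inv r) y) = y"
  using assms by (simp_all add: reindex_def vec_eq_iff bij_is_surj bij_is_inj surj_f_inv_f)

lemma linear_reindex: "linear (reindex r)"
  by (rule linearI) (simp_all add: reindex_def vec_eq_iff)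

lemma bounded_linear_reindex: "bounded_linear (reindex (r :: 'b::finite \<Rightarrow> 'a::finite))"
  by (simp add: linear_conv_bounded_linear [symmetric] linear_reindex)

lemma norm_reindex:
  assumes "bij (r :: 'b::finite \<Rightarrow> 'a::finite)"
  shows "norm (reindex r x) = norm x"
  unfolding norm_vec_def L2_set_def reindex_def
  using sum.reindex_bij_betw[OF assms, of "\<lambda>i. (norm (x $ i))\<^sup>2"] by simp

lemma reindex_cbox:
  assumes "bij (r :: 'b::finite \<Rightarrow> 'a::finite)"
  shows "reindex r ` cbox a b = cbox (reindex r a) (reindex r b)"
proof (intro equalityI subsetI)
  fix y assume "y \<in> cbox (reindex r a) (reindex r b)"
  then have "\<forall>i. a $ r i \<le> y $ i \<and> y $ i \<le> b $ r i" by (auto simp: mem_box_cart reindex_def)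
  then have "reindex (inv r) y \<in> cbox a b"
    using assms by (auto simp: mem_box_cart reindex_def) (metis bij_inv_eq_iff)+
  then show "y \<in> reindex r ` cbox a b"
    using reindex_inverse(2)[OF assms, of y] by (metis imageI)
qed (auto simp: mem_box_cart reindex_def)

lemma measure_reindex_cbox:
  assumes "bij (r :: 'b::finite \<Rightarrow> 'a::finite)"
  shows "measure lborel (reindex r ` cbox a b) = measure lborel (cbox a b)"
proof -
  have "cbox (reindex r a) (reindex r b) = {} \<longleftrightarrow> cbox a b = {}"
    by (simp flip: reindex_cbox[OF assms])
  moreover have "(\<Prod>i\<in>UNIV. b $ r i - a $ r i) = (\<Prod>i\<in>UNIV. b $ i - a $ i)"
    by (rule prod.reindex_bij_betw[OF assms])
  ultimately show ?thesis
    unfolding reindex_cbox[OF assms] by (simp add: content_cbox_if_cart reindex_def)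
qed

lemma has_integral_reindex_cbox:
  fixes f :: "real ^ 'a::finite \<Rightarrow> 'c::banach"
  assumes r: "bij (r :: 'b::finite \<Rightarrow> 'a::finite)" and f: "(f has_integral I) (cbox a b)"
  shows "((\<lambda>y. f (reindex (inv r) y)) has_integral I) (cbox (reindex r a) (reindex r b))"
proof -
  have ri: "bij (inv r)" using r by (rule bij_imp_bij_inv)
  have "((\<lambda>y. f (reindex (inv r) y)) has_integral (1 / 1) *\<^sub>R I) (reindex r ` cbox a b)"
  proof (rule has_integral_twiddle[OF zero_less_one _ _ _ _ _ _ f])
    show "continuous (at x) (reindex (inv r))" for x
      by (intro linear_continuous_at bounded_linear_reindex)
  qed (use r measure_reindex_cbox[OF ri, unfolded reindex_cbox[OF ri]] reindex_cbox[OF r] reindex_cbox[OF ri] in \<open>auto\<close>)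
  then show ?thesis by (simp add: reindex_cbox[OF r])
qed

text \<open>
  A permutation of coordinates maps boxes to boxes of equal content and preserves norms, so it carries
  the conditions on boxes that define the integral to each other.
\<close>

lemma has_integral_reindex:
  fixes f :: "real ^ 'a::finite \<Rightarrow> 'c::banach"
  assumes r: "bij (r :: 'b::finite \<Rightarrow> 'a::finite)" and f: "(f has_integral I) S"
  shows "((\<lambda>y. f (reindex (inv r) y)) has_integral I) (reindex r ` S)"
proof -
  let ?F = "\<lambda>x. if x \<in> S then f x else 0"
  let ?G = "\<lambda>y. if y \<in> reindex r ` S then f (reindex (inv r) y) else 0"
  have ri: "bij (inv r)" using r by (rule bij_imp_bij_inv)
  have G: "?G = (\<lambda>y. ?F (reindex (inv r) y))"
  proof
    fix y
    have "y \<in> reindex r ` S \<longleftrightarrow> reindex (inv r) y \<in> S"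
    proof
      assume "reindex (inv r) y \<in> S"
      then have "reindex r (reindex (inv r) y) \<in> reindex r ` S" by (rule imageI)
      then show "y \<in> reindex r ` S" by (simp add: r)
    qed (auto simp: r)
    then show "?G y = ?F (reindex (inv r) y)" by simp
  qed
  have box: "cbox a b = cbox (reindex r (reindex (inv r) a)) (reindex r (reindex (inv r) b))" for a b
    by (simp add: r)
  from f have int: "\<And>a b. ?F integrable_on cbox a b"
    and lim: "\<And>e. e > 0 \<Longrightarrow> \<exists>B>0. \<forall>a b. ball 0 B \<subseteq> cbox a b \<longrightarrow> norm (integral (cbox a b) ?F - I) < e"
    unfolding has_integral_alt'[of f I S] by auto
  have G_int: "(?G has_integral (integral (cbox (reindex (inv r) a) (reindex (inv r) b)) ?F)) (cbox a b)" for a b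
    unfolding G by (subst box, rule has_integral_reindex_cbox[OF r], rule integrable_integral[OF int])
  show ?thesis
    unfolding has_integral_alt'[of _ I "reindex r ` S"]
  proof (intro conjI allI impI)
    show "?G integrable_on cbox a b" for a b using G_int by blast
    fix e :: real assume "e > 0"
    then obtain B where B: "B > 0" "\<And>a b. ball 0 B \<subseteq> cbox a b \<Longrightarrow> norm (integral (cbox a b) ?F - I) < e"
      using lim by blast
    show "\<exists>B>0. \<forall>a b. ball 0 B \<subseteq> cbox a b \<longrightarrow> norm (integral (cbox a b) ?G - I) < e"
    proof (intro exI conjI allI impI)
      fix a b :: "real ^ 'b" assume ab: "ball 0 B \<subseteq> cbox a b"
      have "ball 0 B \<subseteq> cbox (reindex (inv r) a) (reindex (inv r) b)"
      proof
        fix x :: "real ^ 'a" assume "x \<in> ball 0 B"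
        then have "reindex r x \<in> cbox a b" using ab norm_reindex[OF r, of x] by auto
        then have "reindex (inv r) (reindex r x) \<in> reindex (inv r) ` cbox a b" by (rule imageI)
        then show "x \<in> cbox (reindex (inv r) a) (reindex (inv r) b)"
          by (simp add: r reindex_cbox[OF ri])
      qed
      from B(2)[OF this] integral_unique[OF G_int, of a b]
      show "norm (integral (cbox a b) ?G - I) < e" by simp
    qed (use B in auto)
  qed
qed

lemma absolutely_integrable_reindex:
  fixes f :: "real ^ 'a::finite \<Rightarrow> 'c::euclidean_space"
  assumes r: "bij (r :: 'b::finite \<Rightarrow> 'a::finite)" and f: "f absolutely_integrable_on S"
  shows "(\<lambda>y. f (reindex (inv r) y)) absolutely_integrable_on (reindex r ` S)"
  using f has_integral_reindex[OF r, of f _ S] has_integral_reindex[OF r, of "\<lambda>x. norm (f x)" _ S]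
  unfolding absolutely_integrable_on_def integrable_on_def by blast

text \<open>
  A copy of a finite type, well-ordered by an enumeration. Results on \<open>real ^ 'n\<close> whose index type
  carries an order apply to this copy, and \<open>reindex\<close> transports them back to the given type.
\<close>

typedef 'a ordered = "UNIV :: 'a set" ..

instance ordered :: (finite) finite
proof
  have "range (Abs_ordered :: 'a \<Rightarrow> 'a ordered) = UNIV"
    by (metis Rep_ordered_inverse surj_def)
  then show "finite (UNIV :: 'a ordered set)"
    by (metis finite finite_imageI)
qed

instantiation ordered :: (finite) wellorder
begin

definition less_eq_ordered :: "'a ordered \<Rightarrow> 'a ordered \<Rightarrow> bool" where
  "less_eq_ordered x y \<longleftrightarrow> to_nat (Rep_ordered x) \<le> to_nat (Rep_ordered y)"

definition less_ordered :: "'a ordered \<Rightarrow> 'a ordered \<Rightarrow> bool" where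
  "less_ordered x y \<longleftrightarrow> to_nat (Rep_ordered x) < to_nat (Rep_ordered y)"

instance
proof
  fix P :: "'a ordered \<Rightarrow> bool" and a
  assume step: "\<And>x. (\<And>y. y < x \<Longrightarrow> P y) \<Longrightarrow> P x"
  show "P a"
  proof (induction a rule: measure_induct_rule[of "\<lambda>x. to_nat (Rep_ordered x)"])
    case (less x)
    show ?case by (rule step) (use less in \<open>simp add: less_ordered_def\<close>)
  qed
qed (auto simp: less_eq_ordered_def less_ordered_def Rep_ordered_inject)

end

lemma bij_Rep_ordered: "bij Rep_ordered"
  by (intro bij_betwI[of _ _ _ Abs_ordered]) (auto simp: Rep_ordered_inverse Abs_ordered_inverse)

text \<open>
  The theorem on vector-valued integrands, with the complex numbers regarded as a plane.
\<close>

lemma change_of_variables_wellorder: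
  fixes F :: "real ^ 'n::{finite,wellorder} \<Rightarrow> complex" and g :: "real ^ 'n::_ \<Rightarrow> real ^ 'n::_"
  assumes S: "S \<in> sets lebesgue"
    and g: "\<And>x. x \<in> S \<Longrightarrow> (g has_derivative g' x) (at x within S)"
    and inj: "inj_on g S"
    and F: "F absolutely_integrable_on (g ` S)"
  shows "((\<lambda>x. \<bar>det (matrix (g' x))\<bar> *\<^sub>R F (g x)) has_integral integral (g ` S) F) S"
proof -
  define C :: "complex \<Rightarrow> real ^ 2" where "C z = (\<chi> i. if i = 1 then Re z else Im z)" for z
  define D :: "real ^ 2 \<Rightarrow> complex" where "D v = Complex (v $ 1) (v $ 2)" for v
  have DC: "D (C z) = z" for z by (simp add: C_def D_def)
  have C: "bounded_linear C"
    unfolding linear_conv_bounded_linear [symmetric] by (rule linearI) (auto simp: C_def vec_eq_iff)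
  have D: "bounded_linear D"
    unfolding linear_conv_bounded_linear [symmetric] by (rule linearI) (auto simp: D_def complex_eq_iff)
  have CF: "(C \<circ> F) absolutely_integrable_on (g ` S)"
    by (rule absolutely_integrable_linear[OF F C])
  have "(\<lambda>x. \<bar>det (matrix (g' x))\<bar> *\<^sub>R (C \<circ> F) (g x)) absolutely_integrable_on S \<and>
      integral S (\<lambda>x. \<bar>det (matrix (g' x))\<bar> *\<^sub>R (C \<circ> F) (g x)) = integral (g ` S) (C \<circ> F)"
    (is "?G absolutely_integrable_on S \<and> _")
    using has_absolute_integral_change_of_variables[OF S g inj, of "C \<circ> F" "integral (g ` S) (C \<circ> F)"] CF
    by blast
  then have "((\<lambda>x. \<bar>det (matrix (g' x))\<bar> *\<^sub>R (C \<circ> F) (g x)) has_integral integral (g ` S) (C \<circ> F)) S"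
    using integrable_integral[of ?G S] by (simp add: absolutely_integrable_on_def)
  from has_integral_linear[OF this D]
  have "((\<lambda>x. \<bar>det (matrix (g' x))\<bar> *\<^sub>R F (g x)) has_integral D (integral (g ` S) (C \<circ> F))) S"
    by (simp add: o_def linear_cmul[OF bounded_linear.linear[OF D]] DC)
  moreover have "D (integral (g ` S) (C \<circ> F)) = integral (g ` S) (D \<circ> (C \<circ> F))"
    using CF by (intro integral_linear[OF _ D, symmetric]) (simp add: absolutely_integrable_on_def)
  ultimately show ?thesis by (simp add: o_def DC)
qed

lemma change_of_variables:
  fixes F :: "real ^ 'n::finite \<Rightarrow> complex" and g :: "real ^ 'n \<Rightarrow> real ^ 'n"
  assumes S: "S \<in> sets lebesgue"
    and g: "\<And>x. x \<in> S \<Longrightarrow> (g has_derivative g' x) (at x within S)"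
    and inj: "inj_on g S"
    and F: "F absolutely_integrable_on (g ` S)"
  shows "((\<lambda>x. \<bar>det (matrix (g' x))\<bar> *\<^sub>R F (g x)) has_integral integral (g ` S) F) S"
proof -
  define r :: "'n ordered \<Rightarrow> 'n" where "r = Rep_ordered"
  have r: "bij r" by (simp add: r_def bij_Rep_ordered)
  have ri: "bij (inv r)" using r by (rule bij_imp_bij_inv)
  let ?L = "reindex r" and ?M = "reindex (inv r)"
  note [simp] = reindex_inverse[OF r]
  define h where "h y = ?L (g (?M y))" for y
  define h' where "h' y v = ?L (g' (?M y) (?M v))" for y v
  have hS: "h ` (?L ` S) = ?L ` (g ` S)"
    by (auto simp: h_def image_iff)
  have "((\<lambda>y. \<bar>det (matrix (h' y))\<bar> *\<^sub>R F (?M (h y))) has_integral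
      integral (h ` (?L ` S)) (\<lambda>y. F (?M y))) (?L ` S)"
  proof (rule change_of_variables_wellorder)
    show "?L ` S \<in> sets lebesgue"
      by (rule differentiable_image_in_sets_lebesgue[OF S])
         (use bij_betw_same_card[OF r] in \<open>auto intro!: linear_imp_differentiable_on linear_reindex\<close>)
    show "inj_on h (?L ` S)"
    proof (rule inj_onI)
      fix y z assume "y \<in> ?L ` S" "z \<in> ?L ` S" and eq: "h y = h z"
      then obtain a b where ab: "a \<in> S" "b \<in> S" "y = ?L a" "z = ?L b" by auto
      from arg_cong[OF eq, of ?M] ab have "g a = g b" by (simp add: h_def)
      then show "y = z" using inj ab by (auto dest: inj_onD)
    qed
    show "(h has_derivative h' y) (at y within ?L ` S)" if "y \<in> ?L ` S" for y
    proof -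
      from that obtain a where a: "a \<in> S" "y = ?L a" by auto
      have "?M ` (?L ` S) = S" by (auto simp: image_iff)
      moreover have "(?M has_derivative ?M) (at y within ?L ` S)"
        by (intro bounded_linear_imp_has_derivative bounded_linear_reindex)
      ultimately have "(g \<circ> ?M has_derivative g' (?M y) \<circ> ?M) (at y within ?L ` S)"
        using g[of a] a by (intro diff_chain_within) auto
      moreover have "(?L has_derivative ?L) (at x)" for x
        by (intro bounded_linear_imp_has_derivative bounded_linear_reindex)
      ultimately have "(?L \<circ> (g \<circ> ?M) has_derivative ?L \<circ> (g' (?M y) \<circ> ?M)) (at y within ?L ` S)"
        by (rule diff_chain_within[OF _ has_derivative_at_withinI])
      then show ?thesis by (simp add: h_def[abs_def] h'_def[abs_def] o_def)
    qed
    show "(\<lambda>y. F (?M y)) absolutely_integrable_on h ` (?L ` S)"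
      unfolding hS by (rule absolutely_integrable_reindex[OF r F])
  qed
  from has_integral_reindex[OF ri this]
  have "((\<lambda>x. \<bar>det (matrix (h' (?L x)))\<bar> *\<^sub>R F (g x)) has_integral
      integral (h ` (?L ` S)) (\<lambda>y. F (?M y))) (?M ` (?L ` S))"
    by (simp add: inv_inv_eq[OF r] h_def)
  moreover have "?M ` (?L ` S) = S" by (auto simp: image_iff)
  moreover have "integral (h ` (?L ` S)) (\<lambda>y. F (?M y)) = integral (g ` S) F"
    unfolding hS using F absolutely_integrable_on_def
    by (intro integral_unique has_integral_reindex[OF r]) (auto intro: integrable_integral)
  moreover have "det (matrix (h' (?L x))) = det (matrix (g' x))" for x
  proof -
    have "?M (axis j 1) = axis (r j) 1" for j
      using r by (auto simp: reindex_def axis_def vec_eq_iff bij_inv_eq_iff) (metis bij_inv_eq_iff)+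
    then have "matrix (h' (?L x)) = (\<chi> i j. matrix (g' x) $ r i $ r j)"
      by (simp add: matrix_def h'_def vec_eq_iff) (simp add: reindex_def)
    then show ?thesis by (simp only: det_reindex[OF r])
  qed
  ultimately show ?thesis by simp
qed

section \<open>Level curves of one polynomial\<close>

text \<open>
  If \<open>x\<close> is at distance at least \<open>\<eta>\<close> from all roots, then the factorization of \<open>p\<close> shows that
  \<open>|p(x)| \<ge> |c| \<eta>\<^sup>d\<close>.
\<close>

lemma small_value_near_root:
  assumes d: "degree p > 0" and \<eta>: "\<eta> > 0"
  shows "\<exists>\<delta>>0. \<forall>x. norm (cpoly p x) < \<delta> \<longrightarrow> (\<exists>w. cpoly p w = 0 \<and> norm (x - w) < \<eta>)"
proof -
  let ?P = "map_poly of_int p :: complex poly"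
  obtain root where P: "smult (lead_coeff ?P) (\<Prod>i<degree ?P. [:- root i, 1:]) = ?P"
    by (rule complex_poly_decompose')
  let ?c = "norm (lead_coeff ?P)"
  have c: "?c > 0" using d by (auto simp: coeff_map_poly)
  have val: "norm (cpoly p x) = ?c * (\<Prod>i<degree ?P. norm (x - root i))" for x
  proof -
    have "cpoly p x = poly (smult (lead_coeff ?P) (\<Prod>i<degree ?P. [:- root i, 1:])) x"
      by (simp only: P cpoly_def)
    then show ?thesis by (simp add: poly_prod norm_mult prod_norm)
  qed
  show ?thesis
  proof (intro exI[of _ "?c * \<eta> ^ degree p"] conjI allI impI)
    show "?c * \<eta> ^ degree p > 0" using c \<eta> by simp
    fix x assume x: "norm (cpoly p x) < ?c * \<eta> ^ degree p"
    have "\<exists>i<degree ?P. norm (x - root i) < \<eta>"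
    proof (rule ccontr)
      assume "\<not> ?thesis"
      then have "(\<Prod>i<degree ?P. \<eta>) \<le> (\<Prod>i<degree ?P. norm (x - root i))"
        using \<eta> by (intro prod_mono) auto
      then have "?c * \<eta> ^ degree p \<le> norm (cpoly p x)"
        unfolding val by (intro mult_left_mono) auto
      then show False using x by simp
    qed
    then obtain i where i: "i < degree ?P" "norm (x - root i) < \<eta>" by blast
    have "norm (cpoly p (root i)) = 0"
      unfolding val using i(1) by auto
    then show "\<exists>w. cpoly p w = 0 \<and> norm (x - w) < \<eta>" using i(2) by auto
  qed
qed

text \<open>
  There are only finitely many critical values.
\<close>

lemma small_value_noncritical:
  assumes d: "degree p > 0"
  shows "\<exists>\<delta>>0. \<forall>x. 0 < norm (cpoly p x) \<and> norm (cpoly p x) < \<delta> \<longrightarrow> cpoly (pderiv p) x \<noteq> 0"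
proof -
  let ?C = "{x. cpoly (pderiv p) x = 0}" and ?P = "map_poly of_int p :: complex poly"
  have "pderiv ?P \<noteq> 0" using d by (simp add: pderiv_eq_0_iff)
  then have "finite ?C" unfolding cpoly_pderiv by (rule poly_roots_finite)
  then have fin: "finite (insert 1 ((\<lambda>x. norm (cpoly p x)) ` ?C) - {0})" (is "finite ?M") by simp
  have pos: "Min ?M > 0"
    using Min_in[OF fin] by force
  show ?thesis
  proof (intro exI[of _ "Min ?M"] conjI pos allI impI notI)
    fix x assume x: "0 < norm (cpoly p x) \<and> norm (cpoly p x) < Min ?M" "cpoly (pderiv p) x = 0"
    then have "Min ?M \<le> norm (cpoly p x)" by (intro Min_le fin) auto
    then show False using x by simp
  qed
qed

lemma has_field_derivative_cpoly: "(cpoly p has_field_derivative cpoly (pderiv p) x) (at x within S)"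
  unfolding cpoly_pderiv unfolding cpoly_def[abs_def] by (rule poly_DERIV[THEN has_field_derivative_at_within])

lemma holomorphic_cpoly: "cpoly p holomorphic_on S"
  unfolding holomorphic_on_def field_differentiable_def using has_field_derivative_cpoly by blast

lemma deriv_cpoly: "deriv (cpoly p) x = cpoly (pderiv p) x"
  by (rule DERIV_imp_deriv[OF has_field_derivative_cpoly])

lemma continuous_on_cpoly [continuous_intros]:
  "continuous_on S h \<Longrightarrow> continuous_on S (\<lambda>t. cpoly p (h t))"
  unfolding cpoly_def by (intro continuous_intros)

text \<open>
  The fibre over \<open>\<zeta>\<close> consists of \<open>d\<close> points at which \<open>p\<close> is locally invertible. The local inverses
  provide \<open>d\<close> distinct points in each nearby fibre, and a fibre cannot have more.
\<close>

lemma local_branches: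
  assumes d: "degree p > 0" and nc: "\<And>x. cpoly p x = \<zeta> \<Longrightarrow> cpoly (pderiv p) x \<noteq> 0"
  shows "\<exists>r>0. \<exists>g. (\<forall>k<degree p. g k holomorphic_on ball \<zeta> r) \<and>
    (\<forall>\<xi>\<in>ball \<zeta> r. bij_betw (\<lambda>k. g k \<xi>) {..<degree p} {x. cpoly p x = \<xi>})"
proof -
  let ?Z = "{x. cpoly p x = \<zeta>}" and ?d = "degree p"
  have fin: "finite ?Z" by (rule finite_fibre[OF d])
  obtain h where h: "bij_betw h {..<?d} ?Z"
    using finite_same_card_bij[of "{..<?d}" ?Z] fin card_fibre[OF d nc] by auto
  have hZ: "cpoly p (h k) = \<zeta>" if "k < ?d" for k using h that by (auto simp: bij_betw_def)
  \<comment> \<open>Radii of at most half the distance to the other points make the balls disjoint.\<close>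
  have "\<exists>R>0. inj_on (cpoly p) (ball (h k) R) \<and> (\<forall>b\<in>?Z. b \<noteq> h k \<longrightarrow> 2 * R \<le> dist (h k) b)"
    if k: "k < ?d" for k
  proof -
    obtain R1 where R1: "R1 > 0" "inj_on (cpoly p) (ball (h k) R1)"
      using has_complex_derivative_locally_injective[OF holomorphic_cpoly[of p UNIV], of "h k"] nc[OF hZ[OF k]]
      by (auto simp: deriv_cpoly)
    obtain R2 where R2: "R2 > 0" "\<forall>x\<in>?Z. x \<noteq> h k \<longrightarrow> R2 \<le> dist (h k) x"
      using finite_set_avoid[OF fin, of "h k"] by blast
    show ?thesis
      using R1 R2 by (intro exI[of _ "min R1 (R2 / 2)"]) (auto intro: inj_on_subset)
  qed
  then obtain R where R: "\<And>k. k < ?d \<Longrightarrow> R k > 0"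
      "\<And>k. k < ?d \<Longrightarrow> inj_on (cpoly p) (ball (h k) (R k))"
      "\<And>k b. k < ?d \<Longrightarrow> b \<in> ?Z \<Longrightarrow> b \<noteq> h k \<Longrightarrow> 2 * R k \<le> dist (h k) b"
    by metis
  have disj: "ball (h k) (R k) \<inter> ball (h l) (R l) = {}" if "k < ?d" "l < ?d" "k \<noteq> l" for k l
  proof -
    have "h k \<noteq> h l" using h that by (auto simp: bij_betw_def inj_on_def)
    then have "2 * R k \<le> dist (h k) (h l)" "2 * R l \<le> dist (h k) (h l)"
      using R(3)[of k "h l"] R(3)[of l "h k"] hZ that by (auto simp: dist_commute)
    then show ?thesis by (intro disjoint_ballI) linarith
  qed
  let ?U = "\<lambda>k. cpoly p ` ball (h k) (R k)"
  have openU: "open (?U k)" if "k < ?d" for k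
    by (rule open_mapping_thm3[OF holomorphic_cpoly open_ball R(2)[OF that]])
  have "\<exists>g. g holomorphic_on ?U k \<and> (\<forall>z\<in>ball (h k) (R k). g (cpoly p z) = z)" if "k < ?d" for k
    using holomorphic_has_inverse[OF holomorphic_cpoly open_ball R(2)[OF that]] by metis
  then obtain g where g: "\<And>k. k < ?d \<Longrightarrow> g k holomorphic_on ?U k"
      "\<And>k z. k < ?d \<Longrightarrow> z \<in> ball (h k) (R k) \<Longrightarrow> g k (cpoly p z) = z"
    by metis
  have "open (\<Inter>k\<in>{..<?d}. ?U k)" using openU by (intro open_INT) auto
  moreover have "\<zeta> \<in> (\<Inter>k\<in>{..<?d}. ?U k)"
    using hZ R(1) by (force simp: image_iff)
  ultimately obtain r where r: "r > 0" "ball \<zeta> r \<subseteq> (\<Inter>k\<in>{..<?d}. ?U k)"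
    by (rule openE)
  have inv: "g k \<xi> \<in> ball (h k) (R k) \<and> cpoly p (g k \<xi>) = \<xi>" if "k < ?d" "\<xi> \<in> ball \<zeta> r" for k \<xi>
  proof -
    have "\<xi> \<in> ?U k" using r that by blast
    then show ?thesis using g(2)[OF that(1)] by auto
  qed
  show ?thesis
  proof (intro exI[of _ r] conjI r(1) exI[of _ g] allI impI ballI)
    show "g k holomorphic_on ball \<zeta> r" if "k < ?d" for k
      using g(1)[OF that] r(2) that by (blast intro: holomorphic_on_subset)
    fix \<xi> assume \<xi>: "\<xi> \<in> ball \<zeta> r"
    have inj: "inj_on (\<lambda>k. g k \<xi>) {..<?d}"
    proof (rule inj_onI, rule ccontr)
      fix k l assume "k \<in> {..<?d}" "l \<in> {..<?d}" "g k \<xi> = g l \<xi>" "k \<noteq> l"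
      then show False using disj[of k l] inv[OF _ \<xi>, of k] inv[OF _ \<xi>, of l] by auto
    qed
    have sub: "(\<lambda>k. g k \<xi>) ` {..<?d} \<subseteq> {x. cpoly p x = \<xi>}" using inv[OF _ \<xi>] by auto
    have "(\<lambda>k. g k \<xi>) ` {..<?d} = {x. cpoly p x = \<xi>}"
      by (rule card_seteq[OF finite_fibre[OF d] sub]) (simp add: card_image[OF inj] card_fibre_le[OF d])
    then show "bij_betw (\<lambda>k. g k \<xi>) {..<?d} {x. cpoly p x = \<xi>}"
      using inj by (simp add: bij_betw_def)
  qed
qed

definition angle :: "nat \<Rightarrow> nat \<Rightarrow> real \<Rightarrow> real" where
  "angle N q s = 2 * pi / real N * (real q + s)"

text \<open>
  The circle of radius \<open>\<epsilon>\<close> is cut into \<open>N\<close> arcs of equal length, and \<open>z (q, k)\<close> is the \<open>k\<close>-th branch of the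
  inverse of \<open>p\<close> over the \<open>q\<close>-th arc, parametrized by \<open>[0, 1]\<close>. At least two arcs are required so
  that each of them avoids the ray opposite to its midpoint, on which the logarithm used in
  \<open>angle_coord\<close> jumps.
\<close>

definition arcs :: "int poly \<Rightarrow> real \<Rightarrow> nat \<Rightarrow> (nat \<times> nat \<Rightarrow> real \<Rightarrow> complex) \<Rightarrow> bool" where
  "arcs p \<epsilon> N z \<longleftrightarrow> 2 \<le> N \<and>
    (\<forall>q<N. \<forall>s\<in>{0..1}. bij_betw (\<lambda>k. z (q, k) s) {..<degree p} {x. cpoly p x = of_real \<epsilon> * cis (angle N q s)}) \<and>
    (\<forall>q<N. \<forall>k<degree p. \<forall>s\<in>{0..1}. \<exists>D. (z (q, k) has_vector_derivative D) (at s))"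

lemma norm_cis_diff_le: "norm (cis a - cis b) \<le> \<bar>a - b\<bar>"
proof -
  have "cis a - cis b = cis b * (exp (\<i> * of_real (a - b)) - 1)"
    by (simp add: cis_conv_exp algebra_simps flip: exp_add)
  then have "norm (cis a - cis b) = 2 * \<bar>sin ((a - b) / 2)\<bar>"
    by (simp only: norm_mult dist_exp_i_1 norm_cis mult_1)
  also have "\<dots> \<le> 2 * \<bar>(a - b) / 2\<bar>" by (intro mult_left_mono abs_sin_x_le_abs_x) auto
  finally show ?thesis by simp
qed

lemma has_vector_derivative_circle:
  "((\<lambda>s. of_real \<epsilon> * cis (angle N q s)) has_vector_derivative
    (of_real \<epsilon> * (\<i> * of_real (2 * pi / real N) * cis (angle N q s)))) (at s within S)"
proof -
  define c where "c = 2 * pi / real N"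
  have "angle N q = (\<lambda>s. c * (real q + s))" by (simp add: angle_def c_def fun_eq_iff)
  then show ?thesis
    unfolding c_def [symmetric] has_vector_derivative_def
    by (auto intro!: derivative_eq_intros simp: scaleR_conv_of_real algebra_simps)
qed

text \<open>
  The discs on which local branches exist cover the circle; arcs shorter than a Lebesgue number of this
  covering lie in one disc each.
\<close>

lemma exists_arcs:
  assumes d: "degree p > 0" and \<epsilon>: "\<epsilon> > 0"
    and nc: "\<And>x. norm (cpoly p x) = \<epsilon> \<Longrightarrow> cpoly (pderiv p) x \<noteq> 0"
  shows "\<exists>N z. arcs p \<epsilon> N z"
proof -
  let ?d = "degree p"
  have "\<exists>r>0. \<exists>g. (\<forall>k<?d. g k holomorphic_on ball \<zeta> r) \<and>
    (\<forall>\<xi>\<in>ball \<zeta> r. bij_betw (\<lambda>k. g k \<xi>) {..<?d} {x. cpoly p x = \<xi>})" if "\<zeta> \<in> sphere 0 \<epsilon>" for \<zeta>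
    by (rule local_branches[OF d]) (use that nc in auto)
  then obtain r g where rg: "\<And>\<zeta>. \<zeta> \<in> sphere 0 \<epsilon> \<Longrightarrow> r \<zeta> > 0"
      "\<And>\<zeta> k. \<zeta> \<in> sphere 0 \<epsilon> \<Longrightarrow> k < ?d \<Longrightarrow> g \<zeta> k holomorphic_on ball \<zeta> (r \<zeta>)"
      "\<And>\<zeta> \<xi>. \<zeta> \<in> sphere 0 \<epsilon> \<Longrightarrow> \<xi> \<in> ball \<zeta> (r \<zeta>) \<Longrightarrow> bij_betw (\<lambda>k. g \<zeta> k \<xi>) {..<?d} {x. cpoly p x = \<xi>}"
    by metis
  have "sphere 0 \<epsilon> \<subseteq> \<Union> ((\<lambda>\<zeta>. ball \<zeta> (r \<zeta>)) ` sphere 0 \<epsilon>)" using rg(1) by (auto simp: dist_norm)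
  then obtain e where e: "e > 0" "\<And>x. x \<in> sphere 0 \<epsilon> \<Longrightarrow> \<exists>G\<in>(\<lambda>\<zeta>. ball \<zeta> (r \<zeta>)) ` sphere 0 \<epsilon>. ball x e \<subseteq> G"
    using Heine_Borel_lemma[OF compact_sphere, of 0 \<epsilon> "(\<lambda>\<zeta>. ball \<zeta> (r \<zeta>)) ` sphere 0 \<epsilon>"]
    by (metis (no_types, lifting) imageE open_ball)
  \<comment> \<open>An arc has length \<open>2 \<pi> \<epsilon> / N\<close>, which is to be less than the Lebesgue number \<open>e\<close>.\<close>
  obtain N0 :: nat where N0: "2 * pi * \<epsilon> / e < real N0" using reals_Archimedean2 by blast
  define N where "N = max 2 N0"
  have N: "2 \<le> N" "2 * pi * \<epsilon> / e < real N" using N0 by (auto simp: N_def)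
  define P where "P q s = of_real \<epsilon> * cis (angle N q s)" for q s
  have P_sphere: "P q s \<in> sphere 0 \<epsilon>" for q s using \<epsilon> by (simp add: P_def norm_mult)
  have "\<exists>\<zeta>\<in>sphere 0 \<epsilon>. ball (P q 0) e \<subseteq> ball \<zeta> (r \<zeta>)" for q
    using e(2)[OF P_sphere[of q 0]] by auto
  then obtain c where c: "\<And>q. c q \<in> sphere 0 \<epsilon>" "\<And>q. ball (P q 0) e \<subseteq> ball (c q) (r (c q))"
    by metis
  have P_ball: "P q s \<in> ball (c q) (r (c q))" if "s \<in> {0..1}" for q s
  proof -
    have "norm (P q 0 - P q s) = \<epsilon> * norm (cis (angle N q 0) - cis (angle N q s))"
      using \<epsilon> by (simp add: P_def norm_mult flip: right_diff_distrib)
    also have "\<dots> \<le> \<epsilon> * \<bar>angle N q 0 - angle N q s\<bar>"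
      using \<epsilon> norm_cis_diff_le by (intro mult_left_mono) auto
    also have "angle N q 0 - angle N q s = - (2 * pi / real N * s)"
      by (simp only: angle_def right_diff_distrib [symmetric]) simp
    also have "\<epsilon> * \<bar>- (2 * pi / real N * s)\<bar> \<le> \<epsilon> * (2 * pi / real N)"
      using \<epsilon> that N by (intro mult_left_mono) (auto simp: abs_mult field_simps mult_left_le)
    also have "\<dots> < e" using N e \<epsilon> by (simp add: field_simps)
    finally show ?thesis using c(2)[of q] by (auto simp: dist_norm)
  qed
  define z where "z \<kappa> s = g (c (fst \<kappa>)) (snd \<kappa>) (P (fst \<kappa>) s)" for \<kappa> s
  have "arcs p \<epsilon> N z"
    unfolding arcs_def
  proof (intro conjI allI impI ballI N(1))
    fix q and s :: real assume "q < N" "s \<in> {0..1}"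
    then show "bij_betw (\<lambda>k. z (q, k) s) {..<?d} {x. cpoly p x = of_real \<epsilon> * cis (angle N q s)}"
      using rg(3)[OF c(1) P_ball] by (simp add: z_def P_def)
  next
    fix q k and s :: real assume "q < N" and k: "k < ?d" and s: "s \<in> {0..1}"
    let ?g = "g (c q) k" and ?B = "ball (c q) (r (c q))"
    have hol: "?g holomorphic_on ?B" by (rule rg(2)[OF c(1) k])
    have P': "(P q has_vector_derivative (of_real \<epsilon> * (\<i> * of_real (2 * pi / real N) * cis (angle N q s)))) (at s)"
      unfolding P_def by (rule has_vector_derivative_circle)
    have "(?g has_field_derivative deriv ?g (P q s)) (at (P q s))"
      by (rule holomorphic_derivI[OF hol open_ball P_ball[OF s]])
    from field_vector_diff_chain_at[OF P' this]
    have "(z (q, k) has_vector_derivative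
        (of_real \<epsilon> * (\<i> * of_real (2 * pi / real N) * cis (angle N q s)) * deriv ?g (P q s))) (at s)"
      by (simp add: z_def[abs_def] o_def)
    then show "\<exists>D. (z (q, k) has_vector_derivative D) (at s)" by blast
  qed
  then show ?thesis by blast
qed

text \<open>
  A common inverse of all branches over the \<open>q\<close>-th arc: it depends on \<open>x\<close> only through \<open>p(x)\<close>, whose angle
  is measured from the midpoint of the arc, at which the parameter is \<open>1/2\<close>.
\<close>

definition angle_coord :: "int poly \<Rightarrow> real \<Rightarrow> nat \<Rightarrow> nat \<Rightarrow> complex \<Rightarrow> real" where
  "angle_coord p \<epsilon> N q x = Im (Ln (cpoly p x / (of_real \<epsilon> * cis (angle N q (1/2))))) / (2 * pi / real N) + 1/2"

context
  fixes p \<epsilon> N q s x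
  assumes \<epsilon>: "\<epsilon> > 0" and N: "2 \<le> N" and s: "s \<in> {0..1}"
    and x: "cpoly p x = of_real \<epsilon> * cis (angle N q s)"
begin

lemma angle_ratio:
  "cpoly p x / (of_real \<epsilon> * cis (angle N q (1/2))) = exp (\<i> * of_real (2 * pi / real N * (s - 1/2)))"
  "\<bar>2 * pi / real N * (s - 1/2)\<bar> < pi"
proof -
  show "cpoly p x / (of_real \<epsilon> * cis (angle N q (1/2))) = exp (\<i> * of_real (2 * pi / real N * (s - 1/2)))"
  proof -
    have "angle N q s - angle N q (1/2) = 2 * pi / real N * (s - 1/2)"
      by (simp only: angle_def right_diff_distrib [symmetric]) simp
    then have "cis (angle N q s) / cis (angle N q (1/2)) = cis (2 * pi / real N * (s - 1/2))"
      by (simp only: cis_divide)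
    then show ?thesis using \<epsilon> by (simp add: x cis_conv_exp)
  qed
  have "\<bar>s - 1/2\<bar> \<le> 1/2" using s unfolding abs_le_iff atLeastAtMost_iff by linarith
  have "\<bar>2 * pi / real N * (s - 1/2)\<bar> = 2 * pi / real N * \<bar>s - 1/2\<bar>"
    using N by (simp add: abs_mult)
  also have "\<dots> \<le> 2 * pi / real N * (1/2)"
    using \<open>\<bar>s - 1/2\<bar> \<le> 1/2\<close> N by (intro mult_left_mono) auto
  also have "\<dots> < pi" using N pi_gt_zero by (simp add: field_simps)
  finally show "\<bar>2 * pi / real N * (s - 1/2)\<bar> < pi" .
qed

lemma Ln_angle_ratio:
  "Ln (cpoly p x / (of_real \<epsilon> * cis (angle N q (1/2)))) = \<i> * of_real (2 * pi / real N * (s - 1/2))"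
proof -
  define t where "t = 2 * pi / real N * (s - 1/2)"
  have "\<bar>t\<bar> < pi" using angle_ratio(2) by (simp only: t_def)
  then have "Ln (exp (\<i> * of_real t)) = \<i> * of_real t" by (intro Ln_exp) auto
  then show ?thesis unfolding angle_ratio(1) t_def .
qed

lemma angle_coord_eq: "angle_coord p \<epsilon> N q x = s"
  unfolding angle_coord_def Ln_angle_ratio using N by simp

lemma has_derivative_angle_coord:
  "(angle_coord p \<epsilon> N q has_derivative (\<lambda>v. darg p x v / (2 * pi / real N))) (at x within S)"
proof -
  let ?c = "of_real \<epsilon> * cis (angle N q (1/2)) :: complex"
  have c: "?c \<noteq> 0" using \<epsilon> by simp
  have px: "cpoly p x \<noteq> 0" using \<epsilon> x by simp
  have "cpoly p x / ?c \<notin> \<real>\<^sub>\<le>\<^sub>0"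
  proof
    define y where "y = cpoly p x / ?c"
    assume "cpoly p x / ?c \<in> \<real>\<^sub>\<le>\<^sub>0"
    then have "Re y \<le> 0 \<and> Im y = 0" by (simp add: y_def complex_nonpos_Reals_iff)
    moreover have "y \<noteq> 0" using px c by (simp add: y_def)
    ultimately have "Im (Ln y) = pi"
      by (auto simp: Im_Ln_eq_pi less_le complex_eq_iff)
    then have "Im (Ln (cpoly p x / ?c)) = pi" by (simp only: y_def)
    then have "2 * pi / real N * (s - 1/2) = pi" unfolding Ln_angle_ratio by simp
    then show False using angle_ratio(2) by simp
  qed
  then have "((\<lambda>x. Ln (cpoly p x / ?c)) has_field_derivative
      (cpoly (pderiv p) x / ?c) * (1 / (cpoly p x / ?c))) (at x within S)"
    by (auto intro!: derivative_eq_intros has_field_derivative_cpoly)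
  then have "((\<lambda>x. Ln (cpoly p x / ?c)) has_field_derivative cpoly (pderiv p) x / cpoly p x) (at x within S)"
    using c by simp
  then have "((\<lambda>x. Ln (cpoly p x / ?c)) has_derivative (*) (cpoly (pderiv p) x / cpoly p x)) (at x within S)"
    by (rule has_field_derivative_imp_has_derivative)
  from has_derivative_Im[OF this]
  have "((\<lambda>x. Im (Ln (cpoly p x / ?c))) has_derivative (\<lambda>v. darg p x v)) (at x within S)"
    by (simp add: darg_def)
  from has_derivative_add_const[OF bounded_linear.has_derivative[OF bounded_linear_divide this, of "2 * pi / real N"], of "1/2"] show ?thesis
    unfolding angle_coord_def[abs_def] .
qed

end

section \<open>A dissection of the product of level curves\<close>

lemma has_derivative_vec:
  fixes h :: "'n::finite \<Rightarrow> 'a::euclidean_space \<Rightarrow> 'b::euclidean_space"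
  assumes "\<And>i. (h i has_derivative h' i) (at x within S)"
  shows "((\<lambda>x. \<chi> i. h i x) has_derivative (\<lambda>v. \<chi> i. h' i v)) (at x within S)"
  using assms unfolding has_derivative_componentwise_within[of "\<lambda>x. \<chi> i. h i x"]
  by (auto simp: Basis_vec_def inner_axis intro: has_derivative_inner_left)

lemma has_derivative_vec_nth:
  "(h has_derivative h') F \<Longrightarrow> ((\<lambda>x. h x $ i) has_derivative (\<lambda>v. h' v $ i)) F"
  by (rule bounded_linear.has_derivative[OF bounded_linear_vec_nth])

lemma cis_inj_period:
  assumes "cis a = cis b" "0 \<le> a" "a < 2 * pi" "0 \<le> b" "b < 2 * pi"
  shows "a = b"
proof -
  have arg: "Arg2pi (cis x) = x" if "0 \<le> x" "x < 2 * pi" for x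
    by (rule Arg2pi_unique[of 1]) (use that in \<open>simp_all add: cis_conv_exp\<close>)
  show ?thesis using arg[of a] arg[of b] assms by metis
qed

lemma angle_in_period:
  assumes "q < N" "s \<in> {0..<1}"
  shows "0 \<le> angle N q s" "angle N q s < 2 * pi"
proof -
  have "real q + s < real N" using assms by (auto simp: less_eq_real_def)
  then have "(real q + s) / real N < 1" using assms by simp
  then have "2 * pi * ((real q + s) / real N) < 2 * pi * 1"
    by (intro mult_strict_left_mono) auto
  then show "angle N q s < 2 * pi" by (simp add: angle_def)
  show "0 \<le> angle N q s" using assms by (auto simp: angle_def)
qed

lemma angle_inj:
  assumes "cis (angle N q s) = cis (angle N q' t)" "q < N" "q' < N" "s \<in> {0..<1}" "t \<in> {0..<1}"
  shows "q = q' \<and> s = t"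
proof -
  have "angle N q s = angle N q' t"
    using assms angle_in_period by (intro cis_inj_period) auto
  then have eq: "real q + s = real q' + t" using assms by (simp add: angle_def)
  then have "\<lfloor>real q + s\<rfloor> = \<lfloor>real q' + t\<rfloor>" by simp
  moreover have "\<lfloor>real q + s\<rfloor> = int q" "\<lfloor>real q' + t\<rfloor> = int q'"
    using assms by (auto simp: floor_eq_iff)
  ultimately show ?thesis using eq by simp
qed

lemma exists_angle:
  assumes "norm \<zeta> = \<epsilon>" "N > 0"
  shows "\<exists>q<N. \<exists>s\<in>{0..<1}. \<zeta> = of_real \<epsilon> * cis (angle N q s)"
proof -
  define a where "a = Arg2pi \<zeta> * real N / (2 * pi)"
  have arg: "0 \<le> Arg2pi \<zeta>" "Arg2pi \<zeta> < 2 * pi" using Arg2pi_ge_0 Arg2pi_lt_2pi by auto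
  have a: "0 \<le> a" "a < real N"
    using arg assms by (auto simp: a_def field_simps)
  define q where "q = nat \<lfloor>a\<rfloor>"
  have q: "real q \<le> a" "a < real q + 1" using a(1) by (auto simp: q_def of_nat_nat)
  have "q < N" using q(1) a(2) by linarith
  moreover have "a - real q \<in> {0..<1}" using q by auto
  moreover have "angle N q (a - real q) = Arg2pi \<zeta>"
    using assms by (simp add: angle_def a_def)
  ultimately show ?thesis
    using Arg2pi_eq[of \<zeta>] assms by (auto simp: cis_conv_exp intro!: exI[of _ q] bexI[of _ "a - real q"])
qed

lemma det_of_real:
  fixes A :: "real ^ 'n::finite ^ 'n"
  shows "det ((\<chi> i j. of_real (A $ i $ j)) :: complex ^ 'n ^ 'n) = of_real (det A)"
  by (simp add: det_def)

text \<open>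
  A choice of arcs and branches for each of the polynomials. Everything that refers to the cycle of
  the residue takes place in this setting.
\<close>

locale level_arcs =
  fixes f :: "'n::finite \<Rightarrow> int poly" and \<epsilon> :: "'n \<Rightarrow> real" and N :: "'n \<Rightarrow> nat"
    and z :: "'n \<Rightarrow> nat \<times> nat \<Rightarrow> real \<Rightarrow> complex"
  assumes degree: "\<And>i. degree (f i) > 0"
    and pos: "\<And>i. \<epsilon> i > 0"
    and arcs: "\<And>i. arcs (f i) (\<epsilon> i) (N i) (z i)"
    and noncritical: "\<And>i x. norm (cpoly (f i) x) = \<epsilon> i \<Longrightarrow> cpoly (pderiv (f i)) x \<noteq> 0"
begin

definition width :: "'n \<Rightarrow> real" where
  "width i = 2 * pi / real (N i)"

definition pieces :: "'n \<Rightarrow> (nat \<times> nat) set" where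
  "pieces i = {..<N i} \<times> {..<degree (f i)}"

text \<open>
  A cell selects an arc and a branch over it in each coordinate.
\<close>

definition cells :: "('n \<Rightarrow> nat \<times> nat) set" where
  "cells = PiE UNIV pieces"

definition chart :: "('n \<Rightarrow> nat \<times> nat) \<Rightarrow> real ^ 'n \<Rightarrow> complex ^ 'n" where
  "chart \<kappa> s = (\<chi> i. z i (\<kappa> i) (s $ i))"

text \<open>
  The cycle without the restriction to a ball; for small \<open>\<epsilon>\<close> it lies in every ball that contains the
  common zeros.
\<close>

definition torus :: "(complex ^ 'n) set" where
  "torus = {x. \<forall>i. norm (cpoly (f i) (x $ i)) = \<epsilon> i}"

text \<open>
  The factor in \<open>dx\<^sub>i = \<i> (f\<^sub>i / f\<^sub>i') d arg(f\<^sub>i)\<close> along the level curve.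
\<close>

definition arg_factor :: "'n \<Rightarrow> complex \<Rightarrow> complex" where
  "arg_factor i x = \<i> * cpoly (f i) x / cpoly (pderiv (f i)) x"

lemma N_ge_2: "2 \<le> N i"
  using arcs[of i] by (simp add: arcs_def)

lemma width_pos: "width i > 0"
  using N_ge_2[of i] by (simp add: width_def)

lemma finite_cells: "finite cells"
  by (auto simp: cells_def pieces_def intro!: finite_PiE)

lemma cells_pieces: "\<kappa> \<in> cells \<Longrightarrow> \<kappa> i \<in> pieces i"
  by (auto simp: cells_def PiE_def)

lemma cpoly_arc:
  assumes "a \<in> pieces i" "s \<in> {0..1}"
  shows "cpoly (f i) (z i a s) = of_real (\<epsilon> i) * cis (angle (N i) (fst a) s)"
proof -
  have "bij_betw (\<lambda>k. z i (fst a, k) s) {..<degree (f i)} {x. cpoly (f i) x = of_real (\<epsilon> i) * cis (angle (N i) (fst a) s)}"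
    using arcs[of i] assms by (auto simp: arcs_def pieces_def)
  then show ?thesis using assms by (auto simp: bij_betw_def pieces_def)
qed

lemma norm_cpoly_arc: "a \<in> pieces i \<Longrightarrow> s \<in> {0..1} \<Longrightarrow> norm (cpoly (f i) (z i a s)) = \<epsilon> i"
  using pos[of i] by (simp add: cpoly_arc norm_mult)

lemma chart_in_torus: "\<kappa> \<in> cells \<Longrightarrow> s \<in> cbox 0 1 \<Longrightarrow> chart \<kappa> s \<in> torus"
  by (auto simp: torus_def chart_def mem_box_cart intro!: norm_cpoly_arc cells_pieces)

text \<open>
  With the endpoint \<open>1\<close> left out of each arc, the pieces of a level curve are disjoint; by \<open>exists_arc\<close>
  they still cover it.
\<close>

lemma arc_unique:
  assumes "a \<in> pieces i" "b \<in> pieces i" "s \<in> {0..<1}" "t \<in> {0..<1}" "z i a s = z i b t"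
  shows "a = b \<and> s = t"
proof -
  have "cis (angle (N i) (fst a) s) = cis (angle (N i) (fst b) t)"
    using cpoly_arc[of a i s] cpoly_arc[of b i t] assms pos[of i] by simp
  then have "fst a = fst b \<and> s = t"
    using assms by (intro angle_inj) (auto simp: pieces_def)
  moreover have "bij_betw (\<lambda>k. z i (fst a, k) s) {..<degree (f i)} {x. cpoly (f i) x = of_real (\<epsilon> i) * cis (angle (N i) (fst a) s)}"
    using arcs[of i] assms by (auto simp: arcs_def pieces_def)
  ultimately show ?thesis
    using assms by (auto simp: bij_betw_def inj_on_def pieces_def prod_eq_iff)
qed

lemma exists_arc:
  assumes "norm (cpoly (f i) x) = \<epsilon> i"
  shows "\<exists>a\<in>pieces i. \<exists>s\<in>{0..<1}. x = z i a s"
proof -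
  obtain q s where qs: "q < N i" "s \<in> {0..<1}" "cpoly (f i) x = of_real (\<epsilon> i) * cis (angle (N i) q s)"
    using exists_angle[OF assms, of "N i"] N_ge_2[of i] by auto
  then have "bij_betw (\<lambda>k. z i (q, k) s) {..<degree (f i)} {x. cpoly (f i) x = of_real (\<epsilon> i) * cis (angle (N i) q s)}"
    using arcs[of i] by (auto simp: arcs_def)
  then obtain k where "k < degree (f i)" "x = z i (q, k) s"
    using qs(3) by (force simp: bij_betw_def)
  then show ?thesis using qs by (intro bexI[of _ "(q, k)"] bexI[of _ s]) (auto simp: pieces_def)
qed

lemma exists_cell:
  assumes "x \<in> torus"
  shows "\<exists>\<kappa>\<in>cells. \<exists>s. (\<forall>i. s $ i \<in> {0..<1}) \<and> x = chart \<kappa> s"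
proof -
  have "\<exists>a s. a \<in> pieces i \<and> s \<in> {0..<1} \<and> x $ i = z i a s" for i
  proof -
    have "norm (cpoly (f i) (x $ i)) = \<epsilon> i" using assms by (simp add: torus_def)
    then show ?thesis using exists_arc by blast
  qed
  then obtain a s where "\<And>i. a i \<in> pieces i \<and> s i \<in> {0..<1} \<and> x $ i = z i (a i) (s i)" by metis
  then show ?thesis
    by (intro bexI[of _ a] exI[of _ "\<chi> i. s i"]) (auto simp: cells_def chart_def vec_eq_iff)
qed

text \<open>
  Differentiation of \<open>f\<^sub>i(z(s)) = \<epsilon>\<^sub>i exp(\<i> \<theta>(s))\<close>, where the angle \<open>\<theta>\<close> has speed \<open>width i\<close>.
\<close>

lemma arc_has_vector_derivative:
  assumes "a \<in> pieces i" "s \<in> {0..1}"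
  shows "(z i a has_vector_derivative width i *\<^sub>R arg_factor i (z i a s)) (at s within {0..1})"
proof -
  obtain D where D: "(z i a has_vector_derivative D) (at s)"
  proof -
    from assms(1) obtain q k where "a = (q, k)" "q < N i" "k < degree (f i)" by (auto simp: pieces_def)
    then show ?thesis using arcs[of i] assms(2) that unfolding arcs_def by blast
  qed
  have "((\<lambda>s. cpoly (f i) (z i a s)) has_vector_derivative D * cpoly (pderiv (f i)) (z i a s)) (at s within {0..1})"
    using field_vector_diff_chain_within[OF has_vector_derivative_at_within[OF D] has_field_derivative_cpoly]
    by (simp add: o_def)
  then have "((\<lambda>s. of_real (\<epsilon> i) * cis (angle (N i) (fst a) s)) has_vector_derivative D * cpoly (pderiv (f i)) (z i a s)) (at s within {0..1})"
    using assms by (elim has_vector_derivative_transform[rotated 2]) (auto simp: cpoly_arc)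
  moreover have "((\<lambda>s. of_real (\<epsilon> i) * cis (angle (N i) (fst a) s)) has_vector_derivative
      (of_real (\<epsilon> i) * (\<i> * of_real (width i) * cis (angle (N i) (fst a) s)))) (at s within {0..1})"
    unfolding width_def by (rule has_vector_derivative_circle)
  ultimately have "D * cpoly (pderiv (f i)) (z i a s) = of_real (\<epsilon> i) * (\<i> * of_real (width i) * cis (angle (N i) (fst a) s))"
    using assms by (intro vector_derivative_unique_within_closed_interval[of 0 1 s]) auto
  also have "\<dots> = \<i> * of_real (width i) * cpoly (f i) (z i a s)"
    using assms by (simp add: cpoly_arc)
  finally have "D = width i *\<^sub>R arg_factor i (z i a s)"
    using noncritical[OF norm_cpoly_arc[OF assms]]
    by (simp add: arg_factor_def scaleR_conv_of_real field_simps)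
  then show ?thesis using D by (simp add: has_vector_derivative_at_within)
qed

lemma continuous_on_arc: "a \<in> pieces i \<Longrightarrow> continuous_on {0..1} (z i a)"
  using arc_has_vector_derivative by (meson continuous_on_vector_derivative)

lemma darg_arg_factor:
  assumes "norm (cpoly (f i) x) = \<epsilon> i"
  shows "darg (f i) x (of_real r * arg_factor i x) = r"
proof -
  have "cpoly (pderiv (f i)) x * (of_real r * arg_factor i x) / cpoly (f i) x = \<i> * of_real r"
    using noncritical[OF assms] assms pos[of i] by (auto simp: arg_factor_def field_simps)
  then show ?thesis by (simp add: darg_def)
qed

lemma continuous_on_arg_factor:
  assumes "continuous_on S h" "\<And>t. t \<in> S \<Longrightarrow> norm (cpoly (f i) (h t)) = \<epsilon> i"
  shows "continuous_on S (\<lambda>t. arg_factor i (h t))"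
  unfolding arg_factor_def using assms noncritical by (intro continuous_intros) auto

lemma chart_has_derivative:
  assumes "\<kappa> \<in> cells" "t \<in> cbox 0 1"
  shows "(chart \<kappa> has_derivative (\<lambda>v. \<chi> i. (v $ i) *\<^sub>R (width i *\<^sub>R arg_factor i (z i (\<kappa> i) (t $ i))))) (at t within cbox 0 1)"
  unfolding chart_def
proof (rule has_derivative_vec)
  fix i
  have t: "t $ i \<in> {0..1}" using assms by (simp add: mem_box_cart)
  have img: "(\<lambda>t. t $ i) ` cbox 0 (1 :: real ^ 'n) \<subseteq> {0..1}" by (auto simp: mem_box_cart)
  have "((\<lambda>t. t $ i) has_derivative (\<lambda>v. v $ i)) (at t within cbox 0 1)"
    by (rule bounded_linear_imp_has_derivative[OF bounded_linear_vec_nth])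
  moreover have "(z i (\<kappa> i) has_derivative (\<lambda>r. r *\<^sub>R (width i *\<^sub>R arg_factor i (z i (\<kappa> i) (t $ i)))))
      (at (t $ i) within (\<lambda>t. t $ i) ` cbox 0 (1 :: real ^ 'n))"
    using arc_has_vector_derivative[OF cells_pieces[OF assms(1)] t] img
    unfolding has_vector_derivative_def by (rule has_derivative_subset)
  ultimately show "((\<lambda>t. z i (\<kappa> i) (t $ i)) has_derivative (\<lambda>v. (v $ i) *\<^sub>R (width i *\<^sub>R arg_factor i (z i (\<kappa> i) (t $ i))))) (at t within cbox 0 1)"
    by (rule diff_chain_within[unfolded o_def])
qed

lemma continuous_on_chart: "\<kappa> \<in> cells \<Longrightarrow> continuous_on (cbox 0 1) (chart \<kappa>)"
  using chart_has_derivative by (meson has_derivative_continuous_on)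

lemma cube_deriv_chart:
  assumes "\<kappa> \<in> cells" "t \<in> cbox 0 1"
  shows "cube_deriv (chart \<kappa>) t v = (\<chi> i. (v $ i) *\<^sub>R (width i *\<^sub>R arg_factor i (z i (\<kappa> i) (t $ i))))"
proof -
  have "(0 :: real ^ 'n) \<bullet> b < 1 \<bullet> b" if "b \<in> Basis" for b
    using that by (auto simp: Basis_vec_def inner_axis)
  then show ?thesis
    unfolding cube_deriv_def
    using frechet_derivative_within_cbox[OF _ assms(2) chart_has_derivative[OF assms]] by simp
qed

lemma C1_cube_chart:
  assumes "\<kappa> \<in> cells"
  shows "C1_cube (chart \<kappa>)"
  unfolding C1_cube_def
proof (intro conjI allI)
  show "chart \<kappa> differentiable_on cbox 0 1"
    using chart_has_derivative[OF assms] unfolding differentiable_on_def differentiable_def by blast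
  fix v :: "real ^ 'n"
  have "continuous_on (cbox 0 1) (\<lambda>t. \<chi> i. (v $ i) *\<^sub>R (width i *\<^sub>R arg_factor i (z i (\<kappa> i) (t $ i))))"
  proof (intro continuous_on_vec_lambda continuous_on_scaleR continuous_on_const continuous_on_arg_factor)
    fix i
    show "continuous_on (cbox 0 1) (\<lambda>t. z i (\<kappa> i) (t $ i))"
      by (rule continuous_on_compose2[OF continuous_on_arc[OF cells_pieces[OF assms]]])
         (auto simp: mem_box_cart intro: continuous_intros)
    show "norm (cpoly (f i) (z i (\<kappa> i) (t $ i))) = \<epsilon> i" if "t \<in> cbox 0 1" for t
      using norm_cpoly_arc[OF cells_pieces[OF assms]] that by (simp add: mem_box_cart)
  qed
  then show "continuous_on (cbox 0 1) (\<lambda>t. cube_deriv (chart \<kappa>) t v)"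
    by (rule continuous_on_eq) (simp add: cube_deriv_chart[OF assms])
qed

lemma arg_pullback_chart:
  assumes "\<kappa> \<in> cells" "t \<in> cbox 0 1"
  shows "arg_pullback f (chart \<kappa>) t = (\<Prod>i\<in>UNIV. width i)"
proof -
  have "darg (f i) (chart \<kappa> t $ i) (cube_deriv (chart \<kappa>) t (axis j 1) $ i) = (if i = j then width i else 0)" for i j
  proof -
    have "t $ i \<in> {0..1}" using assms(2) by (simp add: mem_box_cart)
    then have "darg (f i) (z i (\<kappa> i) (t $ i)) (of_real (width i) * arg_factor i (z i (\<kappa> i) (t $ i))) = width i"
      by (intro darg_arg_factor norm_cpoly_arc cells_pieces assms)
    then show ?thesis
      by (cases "i = j") (simp_all add: cube_deriv_chart[OF assms] chart_def axis_def scaleR_conv_of_real, simp add: darg_def)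
  qed
  then show ?thesis
    unfolding arg_pullback_def by (subst det_diagonal) auto
qed

lemma chart_inj:
  assumes "\<kappa> \<in> cells" "\<kappa>' \<in> cells" "\<And>i. s $ i \<in> {0..<1}" "\<And>i. t $ i \<in> {0..<1}" "chart \<kappa> s = chart \<kappa>' t"
  shows "\<kappa> = \<kappa>' \<and> s = t"
proof -
  have "\<kappa> i = \<kappa>' i \<and> s $ i = t $ i" for i
    by (rule arc_unique) (use assms cells_pieces in \<open>auto simp: chart_def vec_eq_iff\<close>)
  then show ?thesis by (auto simp: vec_eq_iff)
qed

text \<open>
  In the charts the form \<open>d arg(f\<^sub>1) \<and> \<dots> \<and> d arg(f\<^sub>n)\<close> has the constant coefficient
  \<open>\<Prod> width i\<close>, which settles the orientation.
\<close>

lemma oriented_param_charts: "oriented_param f torus (chart ` cells)"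
  unfolding oriented_param_def
proof (intro conjI ballI)
  have box: "t $ i \<in> {0..<1}" if "t \<in> box 0 1" for t :: "real ^ 'n" and i
    using that by (auto simp: mem_box_cart less_imp_le)
  show "finite (chart ` cells)" using finite_cells by simp
  fix \<phi> assume "\<phi> \<in> chart ` cells"
  then obtain \<kappa> where \<kappa>: "\<kappa> \<in> cells" "\<phi> = chart \<kappa>" by auto
  show "C1_cube \<phi>" using C1_cube_chart \<kappa> by simp
  show "inj_on \<phi> (box 0 1)" using chart_inj \<kappa> box by (auto intro!: inj_onI)
  show "0 < arg_pullback f \<phi> t" if "t \<in> box 0 1" for t
    using that arg_pullback_chart[OF \<kappa>(1), of t] \<kappa>(2) box_subset_cbox[of 0 "1 :: real ^ 'n"]
    by (auto intro!: prod_pos width_pos)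
next
  have box: "t $ i \<in> {0..<1}" if "t \<in> box 0 1" for t :: "real ^ 'n" and i
    using that by (auto simp: mem_box_cart less_imp_le)
  show "disjoint_family_on (\<lambda>\<phi>. \<phi> ` box 0 1) (chart ` cells)"
    unfolding disjoint_family_on_def
  proof (intro ballI impI equals0I)
    fix \<phi> \<psi> x
    assume "\<phi> \<in> chart ` cells" "\<psi> \<in> chart ` cells" "\<phi> \<noteq> \<psi>" and x: "x \<in> \<phi> ` box 0 1 \<inter> \<psi> ` box 0 1"
    then obtain \<kappa> \<kappa>' where \<kappa>: "\<kappa> \<in> cells" "\<kappa>' \<in> cells" "\<phi> = chart \<kappa>" "\<psi> = chart \<kappa>'" by auto
    from x obtain s t where "s \<in> box 0 1" "t \<in> box 0 1" "x = \<phi> s" "x = \<psi> t" by auto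
    then have "\<kappa> = \<kappa>'" using chart_inj[OF \<kappa>(1,2) box box, of s t] \<kappa>(3,4) by metis
    then show False using \<open>\<phi> \<noteq> \<psi>\<close> \<kappa> by simp
  qed
  show "(\<Union>\<phi>\<in>chart ` cells. \<phi> ` cbox 0 1) = torus"
  proof (intro equalityI subsetI)
    fix x assume "x \<in> torus"
    then obtain \<kappa> s where "\<kappa> \<in> cells" "\<forall>i. s $ i \<in> {0..<1}" "x = chart \<kappa> s"
      using exists_cell by blast
    moreover from this have "s \<in> cbox 0 1" by (auto simp: mem_box_cart less_imp_le)
    ultimately show "x \<in> (\<Union>\<phi>\<in>chart ` cells. \<phi> ` cbox 0 1)" by blast
  qed (use chart_in_torus in blast)
qed

end

section \<open>Integrals over arbitrary dissections\<close>

lemma Basis_zero_less_one: "b \<in> Basis \<Longrightarrow> (0 :: real ^ 'n::finite) \<bullet> b < 1 \<bullet> b"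
  by (auto simp: Basis_vec_def inner_axis)

context level_arcs
begin

text \<open>
  The inverse of the chart, defined by a formula on all of \<open>\<complex>\<^sup>n\<close> so that it can be differentiated along
  any cube that meets the cell.
\<close>

definition coord :: "('n \<Rightarrow> nat \<times> nat) \<Rightarrow> complex ^ 'n \<Rightarrow> real ^ 'n" where
  "coord \<kappa> x = (\<chi> i. angle_coord (f i) (\<epsilon> i) (N i) (fst (\<kappa> i)) (x $ i))"

definition cell :: "('n \<Rightarrow> nat \<times> nat) \<Rightarrow> (complex ^ 'n) set" where
  "cell \<kappa> = {x. \<forall>i. x $ i \<in> z i (\<kappa> i) ` {0..<1}}"

lemma in_cellE:
  assumes "x \<in> cell \<kappa>"
  obtains s where "s \<in> {0..<1}" "x $ i = z i (\<kappa> i) s"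
proof -
  have "x $ i \<in> z i (\<kappa> i) ` {0..<1}" using assms by (simp add: cell_def)
  then show ?thesis using that by blast
qed

lemma angle_coord_arc:
  assumes "a \<in> pieces i" "s \<in> {0..1}"
  shows "angle_coord (f i) (\<epsilon> i) (N i) (fst a) (z i a s) = s"
  using angle_coord_eq[OF pos N_ge_2 assms(2) cpoly_arc[OF assms]] .

lemma cell_chart:
  assumes "\<kappa> \<in> cells" "x \<in> cell \<kappa>"
  shows "chart \<kappa> (coord \<kappa> x) = x" "coord \<kappa> x $ i \<in> {0..<1}"
proof -
  have *: "coord \<kappa> x $ i \<in> {0..<1} \<and> z i (\<kappa> i) (coord \<kappa> x $ i) = x $ i" for i
  proof -
    from assms(2) obtain s where "s \<in> {0..<1}" "x $ i = z i (\<kappa> i) s" by (rule in_cellE)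
    then show ?thesis using angle_coord_arc[OF cells_pieces[OF assms(1)], of s i] by (simp add: coord_def)
  qed
  show "coord \<kappa> x $ i \<in> {0..<1}" using * by blast
  show "chart \<kappa> (coord \<kappa> x) = x" using * by (simp add: chart_def vec_eq_iff)
qed

lemma coord_chart:
  assumes "\<kappa> \<in> cells" "s \<in> cbox 0 1"
  shows "coord \<kappa> (chart \<kappa> s) = s"
  using assms angle_coord_arc[OF cells_pieces[OF assms(1)]]
  by (simp add: coord_def chart_def vec_eq_iff mem_box_cart)

lemma cells_disjoint:
  assumes "\<kappa> \<in> cells" "\<kappa>' \<in> cells" "x \<in> cell \<kappa>" "x \<in> cell \<kappa>'"
  shows "\<kappa> = \<kappa>'"
  using chart_inj[OF assms(1,2), of "coord \<kappa> x" "coord \<kappa>' x"] cell_chart[OF assms(1,3)] cell_chart[OF assms(2,4)]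
  by simp

lemma torus_eq_cells: "torus = (\<Union>\<kappa>\<in>cells. cell \<kappa>)"
proof (intro equalityI subsetI)
  fix x assume "x \<in> torus"
  then obtain \<kappa> s where "\<kappa> \<in> cells" "\<forall>i. s $ i \<in> {0..<1}" "x = chart \<kappa> s"
    using exists_cell by blast
  then show "x \<in> (\<Union>\<kappa>\<in>cells. cell \<kappa>)" by (intro UN_I[of \<kappa>]) (auto simp: cell_def chart_def)
next
  fix x assume "x \<in> (\<Union>\<kappa>\<in>cells. cell \<kappa>)"
  then obtain \<kappa> where \<kappa>: "\<kappa> \<in> cells" "x \<in> cell \<kappa>" by blast
  have "norm (cpoly (f i) (x $ i)) = \<epsilon> i" for i
  proof -
    from \<kappa>(2) obtain s where "s \<in> {0..<1}" "x $ i = z i (\<kappa> i) s" by (rule in_cellE)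
    then show ?thesis using norm_cpoly_arc[OF cells_pieces[OF \<kappa>(1)], of s i] by simp
  qed
  then show "x \<in> torus" by (simp add: torus_def)
qed

context
  fixes \<phi> :: "real ^ 'n \<Rightarrow> complex ^ 'n"
  assumes C1: "C1_cube \<phi>" and img: "\<phi> ` cbox 0 1 \<subseteq> torus"
begin

lemma cube_has_derivative:
  assumes "t \<in> cbox 0 1"
  shows "(\<phi> has_derivative cube_deriv \<phi> t) (at t within cbox 0 1)"
  using C1 assms unfolding C1_cube_def cube_deriv_def differentiable_on_def
  by (metis frechet_derivative_works)

lemma norm_cpoly_cube: "t \<in> cbox 0 1 \<Longrightarrow> norm (cpoly (f i) (\<phi> t $ i)) = \<epsilon> i"
  using img by (auto simp: torus_def)

text \<open>
  As \<open>|f\<^sub>i|\<close> is constant on the cube, the derivative of \<open>f\<^sub>i\<close> along it is orthogonal to \<open>f\<^sub>i\<close>. The logarithmic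
  derivative is therefore purely imaginary, that is, equal to \<open>\<i> d arg(f\<^sub>i)\<close>.
\<close>

lemma cube_deriv_tangent:
  assumes t: "t \<in> cbox 0 1"
  shows "cube_deriv \<phi> t v $ i = arg_factor i (\<phi> t $ i) * of_real (darg (f i) (\<phi> t $ i) (cube_deriv \<phi> t v $ i))"
proof -
  define y where "y t = cpoly (f i) (\<phi> t $ i)" for t
  define y' where "y' v = cpoly (pderiv (f i)) (\<phi> t $ i) * (cube_deriv \<phi> t v $ i)" for v
  have y: "(y has_derivative y') (at t within cbox 0 1)"
  proof -
    have "((\<lambda>t. \<phi> t $ i) has_derivative (\<lambda>v. cube_deriv \<phi> t v $ i)) (at t within cbox 0 1)"
      by (rule has_derivative_vec_nth[OF cube_has_derivative[OF t]])
    from diff_chain_within[OF this has_field_derivative_imp_has_derivative[OF has_field_derivative_cpoly]]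
    show ?thesis unfolding y_def y'_def[abs_def] by (simp add: o_def)
  qed
  have "((\<lambda>t. y t \<bullet> y t) has_derivative (\<lambda>v. y t \<bullet> y' v + y' v \<bullet> y t)) (at t within cbox 0 1)"
    by (rule has_derivative_inner[OF y y])
  moreover have "((\<lambda>t. y t \<bullet> y t) has_derivative (\<lambda>v. 0)) (at t within cbox 0 1)"
    by (rule has_derivative_transform[OF t _ has_derivative_const[of "(\<epsilon> i)\<^sup>2"]])
       (simp add: y_def norm_cpoly_cube flip: power2_norm_eq_inner)
  ultimately have "(\<lambda>v. y t \<bullet> y' v + y' v \<bullet> y t) = (\<lambda>v. 0)"
    using frechet_derivative_unique_within_closed_interval[of 0 1 t "\<lambda>t. y t \<bullet> y t"] t Basis_zero_less_one
    by blast
  then have "y t \<bullet> y' v + y' v \<bullet> y t = 0" by (rule fun_cong)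
  then have orth: "y t \<bullet> y' v = 0" by (simp add: inner_commute)
  have norm: "norm (y t) = \<epsilon> i" by (simp add: y_def norm_cpoly_cube[OF t])
  then have y0: "y t \<noteq> 0" using pos[of i] by auto
  have "Re (y' v / y t) = 0"
    using orth by (simp add: Re_divide inner_complex_def mult.commute)
  then have "y' v / y t = \<i> * of_real (Im (y' v / y t))" by (simp add: complex_eq_iff)
  then have "y' v = y t * (\<i> * of_real (Im (y' v / y t)))" using y0 by (simp add: field_simps)
  moreover have "Im (y' v / y t) = darg (f i) (\<phi> t $ i) (cube_deriv \<phi> t v $ i)"
    by (simp add: darg_def y'_def y_def)
  ultimately show ?thesis
    using noncritical[OF norm_cpoly_cube[OF t]]
    by (simp add: arg_factor_def y'_def y_def field_simps)
qed

text \<open>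
  This turns the complex Jacobian of a cube into the real coefficient of
  \<open>d arg(f\<^sub>1) \<and> \<dots> \<and> d arg(f\<^sub>n)\<close>, whose sign is prescribed by the orientation.
\<close>

lemma det_cube_deriv:
  assumes t: "t \<in> cbox 0 1"
  shows "det ((\<chi> i j. cube_deriv \<phi> t (axis j 1) $ i) :: complex ^ 'n ^ 'n) =
    (\<Prod>i\<in>UNIV. arg_factor i (\<phi> t $ i)) * of_real (arg_pullback f \<phi> t)"
proof -
  let ?A = "(\<chi> i j. darg (f i) (\<phi> t $ i) (cube_deriv \<phi> t (axis j 1) $ i)) :: real ^ 'n ^ 'n"
  have "((\<chi> i j. cube_deriv \<phi> t (axis j 1) $ i) :: complex ^ 'n ^ 'n) =
      (\<chi> i. arg_factor i (\<phi> t $ i) *s (\<chi> j. of_real (?A $ i $ j)))"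
    using cube_deriv_tangent[OF t] by (simp add: vec_eq_iff)
  then have "det ((\<chi> i j. cube_deriv \<phi> t (axis j 1) $ i) :: complex ^ 'n ^ 'n) =
      (\<Prod>i\<in>UNIV. arg_factor i (\<phi> t $ i)) * det ((\<chi> i j. of_real (?A $ i $ j)) :: complex ^ 'n ^ 'n)"
    by (simp only: det_rows_mul)
  also have "det ((\<chi> i j. of_real (?A $ i $ j)) :: complex ^ 'n ^ 'n) = of_real (arg_pullback f \<phi> t)"
    unfolding arg_pullback_def by (rule det_of_real)
  finally show ?thesis .
qed

lemma coord_cube_has_derivative:
  assumes \<kappa>: "\<kappa> \<in> cells" and t: "t \<in> cbox 0 1" "\<phi> t \<in> cell \<kappa>"
  shows "((\<lambda>t. coord \<kappa> (\<phi> t)) has_derivative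
    (\<lambda>v. \<chi> i. darg (f i) (\<phi> t $ i) (cube_deriv \<phi> t v $ i) / width i)) (at t within cbox 0 1)"
  unfolding coord_def
proof (rule has_derivative_vec)
  fix i
  from t(2) obtain s where s: "s \<in> {0..<1}" "\<phi> t $ i = z i (\<kappa> i) s" by (rule in_cellE)
  then have "cpoly (f i) (\<phi> t $ i) = of_real (\<epsilon> i) * cis (angle (N i) (fst (\<kappa> i)) s)"
    using cpoly_arc[OF cells_pieces[OF \<kappa>], of s i] by simp
  then have "(angle_coord (f i) (\<epsilon> i) (N i) (fst (\<kappa> i)) has_derivative
      (\<lambda>v. darg (f i) (\<phi> t $ i) v / width i)) (at (\<phi> t $ i) within (\<lambda>t. \<phi> t $ i) ` cbox 0 1)"
    unfolding width_def using s by (intro has_derivative_angle_coord[OF pos N_ge_2]) auto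
  from diff_chain_within[OF has_derivative_vec_nth[OF cube_has_derivative[OF t(1)]] this]
  show "((\<lambda>t. angle_coord (f i) (\<epsilon> i) (N i) (fst (\<kappa> i)) (\<phi> t $ i)) has_derivative
      (\<lambda>v. darg (f i) (\<phi> t $ i) (cube_deriv \<phi> t v $ i) / width i)) (at t within cbox 0 1)"
    by (simp add: o_def)
qed

text \<open>
  A half-open arc is a compact arc without one point, so its preimage is a difference of closed sets.
\<close>

lemma cell_preimage_lebesgue:
  assumes \<kappa>: "\<kappa> \<in> cells"
  shows "{t \<in> box 0 1. \<phi> t \<in> cell \<kappa>} \<in> sets lebesgue"
proof -
  let ?A = "\<lambda>i. {t \<in> cbox 0 1. \<phi> t $ i \<in> z i (\<kappa> i) ` {0..1}}"
  let ?B = "\<lambda>i. {t \<in> cbox 0 1. \<phi> t $ i \<in> {z i (\<kappa> i) 1}}"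
  have cont: "continuous_on (cbox 0 1) (\<lambda>t. \<phi> t $ i)" for i
    by (rule has_derivative_continuous_on[OF has_derivative_vec_nth[OF cube_has_derivative]])
  have closed: "closed {t \<in> cbox 0 1. \<phi> t $ i \<in> C}" if "closed C" for C i
    using continuous_closed_preimage[OF cont closed_cbox that, of i]
    by (simp add: vimage_def Int_def conj_commute)
  have "closed (z i (\<kappa> i) ` {0..1})" for i
    by (intro compact_imp_closed compact_continuous_image continuous_on_arc cells_pieces \<kappa> compact_Icc)
  then have AB: "?A i \<in> sets lebesgue" "?B i \<in> sets lebesgue" for i
    using closed[of "z i (\<kappa> i) ` {0..1}" i] closed[of "{z i (\<kappa> i) 1}" i] by (auto dest: borel_closed)
  have one: "z i (\<kappa> i) s = z i (\<kappa> i) 1 \<Longrightarrow> s = 1" if "s \<in> {0..1}" for i s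
    using angle_coord_arc[OF cells_pieces[OF \<kappa>] that] angle_coord_arc[OF cells_pieces[OF \<kappa>], of 1 i]
    by (metis atLeastAtMost_iff order_refl zero_le_one)
  have half: "z i (\<kappa> i) ` {0..<1} = z i (\<kappa> i) ` {0..1} - {z i (\<kappa> i) 1}" for i
  proof (intro equalityI subsetI)
    fix x assume "x \<in> z i (\<kappa> i) ` {0..<1}"
    then show "x \<in> z i (\<kappa> i) ` {0..1} - {z i (\<kappa> i) 1}" using one[of _ i] by fastforce
  next
    fix x assume "x \<in> z i (\<kappa> i) ` {0..1} - {z i (\<kappa> i) 1}"
    then show "x \<in> z i (\<kappa> i) ` {0..<1}" by (force simp: less_le)
  qed
  have "{t \<in> box 0 1. \<phi> t \<in> cell \<kappa>} = box 0 1 \<inter> (\<Inter>i\<in>UNIV. ?A i - ?B i)"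
    using box_subset_cbox[of 0 "1 :: real ^ 'n"] by (auto simp: cell_def half)
  also have "\<dots> \<in> sets lebesgue"
    using AB by (intro sets.Int sets.finite_INT sets.Diff) auto
  finally show ?thesis .
qed

end

text \<open>
  The integrand of \<open>F dx\<^sub>1 \<and> \<dots> \<and> dx\<^sub>n\<close> in the coordinates of a chart.
\<close>

definition chart_density :: "(complex ^ 'n \<Rightarrow> complex) \<Rightarrow> ('n \<Rightarrow> nat \<times> nat) \<Rightarrow> real ^ 'n \<Rightarrow> complex" where
  "chart_density F \<kappa> s = F (chart \<kappa> s) * (\<Prod>i\<in>UNIV. of_real (width i) * arg_factor i (chart \<kappa> s $ i))"

lemma continuous_on_chart_density:
  assumes F: "continuous_on torus F" and \<kappa>: "\<kappa> \<in> cells"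
  shows "continuous_on (cbox 0 1) (chart_density F \<kappa>)"
  unfolding chart_density_def
proof (intro continuous_on_mult continuous_on_prod continuous_on_const continuous_on_arg_factor)
  have c: "continuous_on (cbox 0 1) (chart \<kappa>)" by (rule continuous_on_chart[OF \<kappa>])
  show "continuous_on (cbox 0 1) (\<lambda>s. F (chart \<kappa> s))"
    by (rule continuous_on_compose2[OF F c]) (use chart_in_torus[OF \<kappa>] in auto)
  show "continuous_on (cbox 0 1) (\<lambda>s. chart \<kappa> s $ i)" for i
    by (intro continuous_on_component c)
  show "norm (cpoly (f i) (chart \<kappa> s $ i)) = \<epsilon> i" if "s \<in> cbox 0 1" for s i
    using chart_in_torus[OF \<kappa> that] by (simp add: torus_def)
qed

abbreviation cell_part :: "(real ^ 'n \<Rightarrow> complex ^ 'n) \<Rightarrow> ('n \<Rightarrow> nat \<times> nat) \<Rightarrow> (real ^ 'n) set" where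
  "cell_part \<phi> \<kappa> \<equiv> {t \<in> box 0 1. \<phi> t \<in> cell \<kappa>}"

abbreviation cell_image :: "(real ^ 'n \<Rightarrow> complex ^ 'n) \<Rightarrow> ('n \<Rightarrow> nat \<times> nat) \<Rightarrow> (real ^ 'n) set" where
  "cell_image \<phi> \<kappa> \<equiv> (\<lambda>t. coord \<kappa> (\<phi> t)) ` cell_part \<phi> \<kappa>"

lemma cell_image_subset: "\<kappa> \<in> cells \<Longrightarrow> cell_image \<phi> \<kappa> \<subseteq> cbox 0 1"
  by (rule image_subsetI) (use cell_chart(2) in \<open>auto simp: mem_box_cart less_imp_le\<close>)

lemma cell_image_lebesgue:
  assumes "C1_cube \<phi>" "\<phi> ` cbox 0 1 \<subseteq> torus" "\<kappa> \<in> cells"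
  shows "cell_image \<phi> \<kappa> \<in> sets lebesgue"
proof (rule differentiable_image_in_sets_lebesgue[OF cell_preimage_lebesgue[OF assms]])
  show "(\<lambda>t. coord \<kappa> (\<phi> t)) differentiable_on cell_part \<phi> \<kappa>"
    unfolding differentiable_on_def differentiable_def
    using coord_cube_has_derivative[OF assms] box_subset_cbox[of 0 "1 :: real ^ 'n"]
    by (blast intro: has_derivative_subset)
qed simp

lemma chart_density_absolutely_integrable:
  assumes "C1_cube \<phi>" "\<phi> ` cbox 0 1 \<subseteq> torus" "\<kappa> \<in> cells" "continuous_on torus F"
  shows "chart_density F \<kappa> absolutely_integrable_on cell_image \<phi> \<kappa>"
  by (rule set_integrable_subset[OF absolutely_integrable_continuous[OF continuous_on_chart_density[OF assms(4,3)]]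
        cell_image_lebesgue[OF assms(1-3)] cell_image_subset[OF assms(3)]])

text \<open>
  Change of variables to the coordinates of the cell. The Jacobian of the coordinates along the cube is
  \<open>arg_pullback f \<phi> t / \<Prod> width i\<close>, which is positive on an oriented cube.
\<close>

lemma has_integral_cell_part:
  assumes C1: "C1_cube \<phi>" and img: "\<phi> ` cbox 0 1 \<subseteq> torus" and \<kappa>: "\<kappa> \<in> cells" and F: "continuous_on torus F"
    and inj: "inj_on \<phi> (box 0 1)" and orient: "\<And>t. t \<in> box 0 1 \<Longrightarrow> arg_pullback f \<phi> t > 0"
  shows "((\<lambda>t. F (\<phi> t) * det ((\<chi> i j. cube_deriv \<phi> t (axis j 1) $ i) :: complex ^ 'n ^ 'n))
    has_integral integral (cell_image \<phi> \<kappa>) (chart_density F \<kappa>)) (cell_part \<phi> \<kappa>)"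
proof -
  let ?g = "\<lambda>t. coord \<kappa> (\<phi> t)"
  let ?g' = "\<lambda>t v. (\<chi> i. darg (f i) (\<phi> t $ i) (cube_deriv \<phi> t v $ i) / width i) :: real ^ 'n"
  have sub: "t \<in> cbox 0 1" if "t \<in> box 0 1" for t :: "real ^ 'n"
    using that box_subset_cbox by blast
  have "((\<lambda>t. \<bar>det (matrix (?g' t))\<bar> *\<^sub>R chart_density F \<kappa> (?g t)) has_integral
      integral (cell_image \<phi> \<kappa>) (chart_density F \<kappa>)) (cell_part \<phi> \<kappa>)"
  proof (rule change_of_variables)
    show "cell_part \<phi> \<kappa> \<in> sets lebesgue" by (rule cell_preimage_lebesgue[OF C1 img \<kappa>])
    show "(?g has_derivative ?g' t) (at t within cell_part \<phi> \<kappa>)" if "t \<in> cell_part \<phi> \<kappa>" for t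
      by (rule has_derivative_subset[OF coord_cube_has_derivative[OF C1 img \<kappa>]]) (use that sub in auto)
    show "inj_on ?g (cell_part \<phi> \<kappa>)"
    proof (rule inj_onI)
      fix s t assume st: "s \<in> cell_part \<phi> \<kappa>" "t \<in> cell_part \<phi> \<kappa>" "?g s = ?g t"
      then have "\<phi> s = \<phi> t" using cell_chart(1)[OF \<kappa>] by (metis (no_types, lifting) mem_Collect_eq)
      then show "s = t" using inj st by (auto dest: inj_onD)
    qed
    show "chart_density F \<kappa> absolutely_integrable_on cell_image \<phi> \<kappa>"
      by (rule chart_density_absolutely_integrable[OF C1 img \<kappa> F])
  qed
  then show ?thesis
  proof (rule has_integral_eq[rotated])
    fix t assume t: "t \<in> cell_part \<phi> \<kappa>"
    have "matrix (?g' t) = (\<chi> i. (1 / width i) *s (\<chi> j. darg (f i) (\<phi> t $ i) (cube_deriv \<phi> t (axis j 1) $ i)))"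
      by (simp add: matrix_def vec_eq_iff)
    then have "det (matrix (?g' t)) = (\<Prod>i\<in>UNIV. 1 / width i) * arg_pullback f \<phi> t"
      by (simp only: det_rows_mul arg_pullback_def)
    moreover have "\<dots> > 0"
      using t orient width_pos by (intro mult_pos_pos prod_pos) auto
    ultimately have det: "\<bar>det (matrix (?g' t))\<bar> = (\<Prod>i\<in>UNIV. 1 / width i) * arg_pullback f \<phi> t" by simp
    have chart: "chart \<kappa> (?g t) = \<phi> t" using t by (intro cell_chart \<kappa>) auto
    have w: "(\<Prod>i\<in>UNIV. of_real (1 / width i)) * (\<Prod>i\<in>UNIV. of_real (width i)) = (1 :: complex)"
      using width_pos by (simp add: less_imp_neq[symmetric] flip: prod.distrib)
    have "\<bar>det (matrix (?g' t))\<bar> *\<^sub>R chart_density F \<kappa> (?g t) =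
      F (\<phi> t) * ((\<Prod>i\<in>UNIV. arg_factor i (\<phi> t $ i)) * of_real (arg_pullback f \<phi> t)) *
      ((\<Prod>i\<in>UNIV. of_real (1 / width i)) * (\<Prod>i\<in>UNIV. of_real (width i)))"
      unfolding det chart_density_def chart prod.distrib scaleR_conv_of_real of_real_mult of_real_prod by (simp only: mult_ac)
    then show "\<bar>det (matrix (?g' t))\<bar> *\<^sub>R chart_density F \<kappa> (?g t) =
      F (\<phi> t) * det ((\<chi> i j. cube_deriv \<phi> t (axis j 1) $ i) :: complex ^ 'n ^ 'n)"
      unfolding w using t sub by (simp add: det_cube_deriv[OF C1 img])
  qed
qed

lemma cube_integral_eq:
  assumes C1: "C1_cube \<phi>" and img: "\<phi> ` cbox 0 1 \<subseteq> torus" and F: "continuous_on torus F"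
    and inj: "inj_on \<phi> (box 0 1)" and orient: "\<And>t. t \<in> box 0 1 \<Longrightarrow> arg_pullback f \<phi> t > 0"
  shows "cube_integral F \<phi> = (\<Sum>\<kappa>\<in>cells. integral (cell_image \<phi> \<kappa>) (chart_density F \<kappa>))"
proof -
  let ?h = "\<lambda>t. F (\<phi> t) * det ((\<chi> i j. cube_deriv \<phi> t (axis j 1) $ i) :: complex ^ 'n ^ 'n)"
  have "(?h has_integral (\<Sum>\<kappa>\<in>cells. integral (cell_image \<phi> \<kappa>) (chart_density F \<kappa>))) (\<Union>\<kappa>\<in>cells. cell_part \<phi> \<kappa>)"
  proof (rule has_integral_UN[OF finite_cells])
    show "(?h has_integral integral (cell_image \<phi> \<kappa>) (chart_density F \<kappa>)) (cell_part \<phi> \<kappa>)" if "\<kappa> \<in> cells" for \<kappa>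
      by (rule has_integral_cell_part[OF C1 img that F inj orient])
    show "pairwise (\<lambda>\<kappa> \<kappa>'. negligible (cell_part \<phi> \<kappa> \<inter> cell_part \<phi> \<kappa>')) cells"
    proof (rule pairwiseI)
      fix \<kappa> \<kappa>' assume "\<kappa> \<in> cells" "\<kappa>' \<in> cells" "\<kappa> \<noteq> \<kappa>'"
      then have "cell_part \<phi> \<kappa> \<inter> cell_part \<phi> \<kappa>' = {}" using cells_disjoint by blast
      then show "negligible (cell_part \<phi> \<kappa> \<inter> cell_part \<phi> \<kappa>')" by simp
    qed
  qed
  moreover have "(\<Union>\<kappa>\<in>cells. cell_part \<phi> \<kappa>) = box 0 1"
  proof -
    have "\<exists>\<kappa>\<in>cells. \<phi> t \<in> cell \<kappa>" if "t \<in> box 0 1" for t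
    proof -
      have "t \<in> cbox 0 1" using that box_subset_cbox by blast
      then have "\<phi> t \<in> torus" using img by blast
      then show ?thesis unfolding torus_eq_cells by blast
    qed
    then show ?thesis by auto
  qed
  ultimately show ?thesis
    unfolding cube_integral_def by (simp add: has_integral_open_interval integral_unique)
qed

text \<open>
  The integral is the same for all dissections. For a fixed cell, the parts of the cubes that lie in it
  have disjoint images under the coordinates. These images fill the unit cube up to the images of
  the boundaries of the cubes, which are negligible.
\<close>

lemma oriented_param_integral:
  assumes \<Phi>: "oriented_param f torus \<Phi>" and F: "continuous_on torus F"
  shows "(\<Sum>\<phi>\<in>\<Phi>. cube_integral F \<phi>) = (\<Sum>\<kappa>\<in>cells. integral (cbox 0 1) (chart_density F \<kappa>))"
proof -
  have fin: "finite \<Phi>" and C1: "\<And>\<phi>. \<phi> \<in> \<Phi> \<Longrightarrow> C1_cube \<phi>" and inj: "\<And>\<phi>. \<phi> \<in> \<Phi> \<Longrightarrow> inj_on \<phi> (box 0 1)"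
    and orient: "\<And>\<phi> t. \<phi> \<in> \<Phi> \<Longrightarrow> t \<in> box 0 1 \<Longrightarrow> arg_pullback f \<phi> t > 0"
    and disj: "disjoint_family_on (\<lambda>\<phi>. \<phi> ` box 0 1) \<Phi>" and cover: "(\<Union>\<phi>\<in>\<Phi>. \<phi> ` cbox 0 1) = torus"
    using \<Phi> unfolding oriented_param_def by auto
  have img: "\<phi> ` cbox 0 1 \<subseteq> torus" if "\<phi> \<in> \<Phi>" for \<phi> using cover that by blast
  have "(\<Sum>\<phi>\<in>\<Phi>. integral (cell_image \<phi> \<kappa>) (chart_density F \<kappa>)) = integral (cbox 0 1) (chart_density F \<kappa>)"
    if \<kappa>: "\<kappa> \<in> cells" for \<kappa>
  proof -
    let ?U = "\<Union>\<phi>\<in>\<Phi>. cell_image \<phi> \<kappa>"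
    have "(chart_density F \<kappa> has_integral (\<Sum>\<phi>\<in>\<Phi>. integral (cell_image \<phi> \<kappa>) (chart_density F \<kappa>))) ?U"
    proof (rule has_integral_UN[OF fin])
      show "(chart_density F \<kappa> has_integral integral (cell_image \<phi> \<kappa>) (chart_density F \<kappa>)) (cell_image \<phi> \<kappa>)"
        if "\<phi> \<in> \<Phi>" for \<phi>
        using chart_density_absolutely_integrable[OF C1[OF that] img[OF that] \<kappa> F]
        by (intro integrable_integral) (simp add: absolutely_integrable_on_def)
      show "pairwise (\<lambda>\<phi> \<psi>. negligible (cell_image \<phi> \<kappa> \<inter> cell_image \<psi> \<kappa>)) \<Phi>"
      proof (rule pairwiseI)
        fix \<phi> \<psi> assume \<phi>\<psi>: "\<phi> \<in> \<Phi>" "\<psi> \<in> \<Phi>" "\<phi> \<noteq> \<psi>"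
        have "cell_image \<phi> \<kappa> \<inter> cell_image \<psi> \<kappa> = {}"
        proof (rule equals0I)
          fix s assume "s \<in> cell_image \<phi> \<kappa> \<inter> cell_image \<psi> \<kappa>"
          then obtain t t' where t: "t \<in> cell_part \<phi> \<kappa>" "s = coord \<kappa> (\<phi> t)"
            and t': "t' \<in> cell_part \<psi> \<kappa>" "s = coord \<kappa> (\<psi> t')" by blast
          have "\<phi> t = chart \<kappa> s" using t cell_chart(1)[OF \<kappa>, of "\<phi> t"] by simp
          also have "\<dots> = \<psi> t'" using t' cell_chart(1)[OF \<kappa>, of "\<psi> t'"] by simp
          finally have "\<phi> t = \<psi> t'" .
          moreover have "\<phi> t \<in> \<phi> ` box 0 1" "\<psi> t' \<in> \<psi> ` box 0 1" using t t' by auto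
          ultimately have "\<phi> t \<in> \<phi> ` box 0 1 \<inter> \<psi> ` box 0 1" by simp
          then show False using disj \<phi>\<psi> unfolding disjoint_family_on_def by blast
        qed
        then show "negligible (cell_image \<phi> \<kappa> \<inter> cell_image \<psi> \<kappa>)" by simp
      qed
    qed
    moreover have "(chart_density F \<kappa> has_integral y) ?U \<longleftrightarrow> (chart_density F \<kappa> has_integral y) (cbox 0 1)" for y
    proof (rule has_integral_spike_set_eq)
      have "?U - cbox 0 1 = {}" using cell_image_subset[OF \<kappa>] by blast
      then have "{x \<in> ?U - cbox 0 1. chart_density F \<kappa> x \<noteq> 0} = {}" by blast
      then show "negligible {x \<in> ?U - cbox 0 1. chart_density F \<kappa> x \<noteq> 0}" by (simp only: negligible_empty)
      \<comment> \<open>What the cubes leave out comes from the boundary of the chart or from that of a cube.\<close>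
      let ?B = "\<lambda>\<phi>. {t \<in> cbox 0 1 - box 0 1. \<phi> t \<in> cell \<kappa>}"
      let ?N = "(cbox 0 1 - box 0 1) \<union> (\<Union>\<phi>\<in>\<Phi>. (\<lambda>t. coord \<kappa> (\<phi> t)) ` ?B \<phi>)"
      have "negligible ((\<lambda>t. coord \<kappa> (\<phi> t)) ` ?B \<phi>)" if "\<phi> \<in> \<Phi>" for \<phi>
      proof (rule negligible_differentiable_image_negligible[OF order_refl])
        show "negligible (?B \<phi>)"
          by (rule negligible_subset[OF negligible_frontier_interval]) auto
        show "(\<lambda>t. coord \<kappa> (\<phi> t)) differentiable_on ?B \<phi>"
          unfolding differentiable_on_def differentiable_def
          using coord_cube_has_derivative[OF C1[OF that] img[OF that] \<kappa>]
          by (blast intro: has_derivative_subset)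
      qed
      then have "negligible ?N"
        using fin by (intro negligible_Un negligible_frontier_interval negligible_Union) auto
      moreover have "cbox 0 1 - ?U \<subseteq> ?N"
      proof
        fix s assume s: "s \<in> cbox 0 1 - ?U"
        show "s \<in> ?N"
        proof (cases "s \<in> box 0 1")
          case True
          then have "\<forall>i. s $ i \<in> {0..<1}" by (auto simp: mem_box_cart less_imp_le)
          then have cell: "chart \<kappa> s \<in> cell \<kappa>" by (auto simp: cell_def chart_def)
          have "chart \<kappa> s \<in> torus" using s by (intro chart_in_torus \<kappa>) auto
          then obtain \<phi> t where t: "\<phi> \<in> \<Phi>" "t \<in> cbox 0 1" "chart \<kappa> s = \<phi> t" using cover by blast
          have s_eq: "s = coord \<kappa> (\<phi> t)" using coord_chart[OF \<kappa>, of s] s t(3) by simp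
          have "t \<notin> box 0 1"
          proof
            assume "t \<in> box 0 1"
            then have "s \<in> cell_image \<phi> \<kappa>" using cell t(3) s_eq by auto
            then show False using s t(1) by blast
          qed
          then have "t \<in> ?B \<phi>" using t cell by simp
          then show ?thesis using s_eq t(1) by blast
        qed (use s in auto)
      qed
      ultimately have "negligible (cbox 0 1 - ?U)" by (rule negligible_subset)
      then show "negligible {x \<in> cbox 0 1 - ?U. chart_density F \<kappa> x \<noteq> 0}"
        by (rule negligible_subset) blast
    qed
    ultimately show ?thesis by (simp add: integral_unique)
  qed
  moreover have "(\<Sum>\<phi>\<in>\<Phi>. cube_integral F \<phi>) = (\<Sum>\<kappa>\<in>cells. \<Sum>\<phi>\<in>\<Phi>. integral (cell_image \<phi> \<kappa>) (chart_density F \<kappa>))"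
    by (subst sum.swap, intro sum.cong refl cube_integral_eq C1 img F inj orient)
  ultimately show ?thesis by simp
qed

end

section \<open>Evaluation of the global residue\<close>

text \<open>
  Fubini's theorem for products of functions of one coordinate each, obtained from the description of
  Lebesgue measure on \<open>real ^ 'n\<close> as a product measure over the basis vectors.
\<close>

lemma integral_cbox_prod:
  fixes h :: "'n::finite \<Rightarrow> real \<Rightarrow> complex"
  assumes h: "\<And>i. continuous_on {0..1} (h i)"
  shows "integral (cbox 0 1) (\<lambda>s :: real ^ 'n. \<Prod>i\<in>UNIV. h i (s $ i)) = (\<Prod>i\<in>UNIV. integral {0..1} (h i))"
proof -
  have basis: "bij_betw (\<lambda>i. axis i 1) UNIV (Basis :: (real ^ 'n) set)"
    by (auto simp: bij_betw_def inj_on_def axis_eq_axis Basis_vec_def)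
  have some: "(SOME j. axis i 1 = (axis j 1 :: real ^ 'n)) = i" for i :: 'n
    by (rule some_equality) (auto simp: axis_eq_axis)
  define k where "k i x = indicator {0..1} x *\<^sub>R h i x" for i x
  have k_int: "integrable lborel (k i)" for i
    unfolding k_def[abs_def] by (rule borel_integrable_compact[OF compact_Icc h])
  have k_eq: "integral\<^sup>L lborel (k i) = integral {0..1} (h i)" for i
    using set_borel_integral_eq_integral(2)[of "{0..1}" "h i"] k_int[of i]
    by (simp add: k_def[abs_def] set_lebesgue_integral_def set_integrable_def)
  have ind: "indicator (cbox 0 1) s *\<^sub>R (\<Prod>i\<in>UNIV. h i (s $ i)) = (\<Prod>i\<in>UNIV. k i (s $ i))" for s :: "real ^ 'n"
  proof (cases "s \<in> cbox 0 1")
    case True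
    then show ?thesis by (simp add: k_def mem_box_cart)
  next
    case False
    then obtain i where "\<not> (0 \<le> s $ i \<and> s $ i \<le> 1)" by (auto simp: mem_box_cart)
    then have "k i (s $ i) = 0" by (auto simp: k_def indicator_def)
    then have "(\<Prod>i\<in>UNIV. k i (s $ i)) = 0" by (intro prod_zero) auto
    then show ?thesis using False by simp
  qed
  have cont: "continuous_on (cbox 0 1) (\<lambda>s :: real ^ 'n. \<Prod>i\<in>UNIV. h i (s $ i))"
  proof (intro continuous_on_prod)
    show "continuous_on (cbox 0 1) (\<lambda>s :: real ^ 'n. h i (s $ i))" for i
      by (rule continuous_on_compose2[OF h]) (auto simp: mem_box_cart intro: continuous_intros)
  qed
  have int: "set_integrable lborel (cbox 0 1) (\<lambda>s :: real ^ 'n. \<Prod>i\<in>UNIV. h i (s $ i))"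
    unfolding set_integrable_def by (rule borel_integrable_compact[OF compact_cbox cont])
  have "integral (cbox 0 1) (\<lambda>s :: real ^ 'n. \<Prod>i\<in>UNIV. h i (s $ i)) =
      integral\<^sup>L lborel (\<lambda>s :: real ^ 'n. \<Prod>i\<in>UNIV. k i (s $ i))"
    using set_borel_integral_eq_integral(2)[OF int] by (simp add: set_lebesgue_integral_def ind)
  also have "\<dots> = integral\<^sup>L (\<Pi>\<^sub>M b\<in>Basis. lborel) (\<lambda>x. \<Prod>i\<in>UNIV. k i ((\<Sum>b\<in>(Basis :: (real ^ 'n) set). x b *\<^sub>R b) $ i))"
    using k_int by (subst lborel_eq, subst integral_distr) (auto intro!: borel_measurable_prod measurable_compose[of _ _ borel "k _"])
  also have "\<dots> = integral\<^sup>L (\<Pi>\<^sub>M b\<in>(Basis :: (real ^ 'n) set). lborel) (\<lambda>x. \<Prod>b\<in>Basis. k (SOME i. b = axis i 1) (x b))"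
  proof (rule Bochner_Integration.integral_cong[OF refl])
    fix x :: "real ^ 'n \<Rightarrow> real"
    have nth: "(\<Sum>b\<in>(Basis :: (real ^ 'n) set). x b *\<^sub>R b) $ i = x (axis i 1)" for i
      by (subst sum.reindex_bij_betw[OF basis, symmetric]) (simp add: axis_def if_distrib cong: if_cong)
    show "(\<Prod>i\<in>UNIV. k i ((\<Sum>b\<in>(Basis :: (real ^ 'n) set). x b *\<^sub>R b) $ i)) = (\<Prod>b\<in>Basis. k (SOME i. b = axis i 1) (x b))"
      by (subst prod.reindex_bij_betw[OF basis, symmetric]) (simp only: nth some)
  qed
  also have "\<dots> = (\<Prod>b\<in>(Basis :: (real ^ 'n) set). integral\<^sup>L lborel (k (SOME i. b = axis i 1)))"
  proof -
    interpret product_sigma_finite "\<lambda>_ :: real ^ 'n. lborel :: real measure" ..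
    show ?thesis by (rule product_integral_prod[OF finite_Basis k_int])
  qed
  also have "\<dots> = (\<Prod>i\<in>UNIV. integral\<^sup>L lborel (k i))"
    by (subst prod.reindex_bij_betw[OF basis, symmetric]) (simp add: some)
  finally show ?thesis by (simp add: k_eq)
qed

text \<open>
  The integrals over the arcs add up to \<open>\<integral> \<zeta>\<^bsup>b-\<alpha>-1\<^esup> d\<zeta>\<close> over the circle, because
  \<open>d\<zeta> = \<i> \<zeta> d\<theta>\<close>. For \<open>b \<noteq> \<alpha>\<close> the integrand has a primitive and the sum telescopes.
\<close>

lemma circle_power_integral:
  fixes b \<alpha> :: nat
  assumes \<epsilon>: "\<epsilon> > 0" and N: "N > 0"
  defines "\<zeta> \<equiv> \<lambda>q s. of_real \<epsilon> * cis (angle N q s) :: complex"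
  shows "(\<Sum>q<N. integral {0..1} (\<lambda>s. \<i> * of_real (2 * pi / real N) * (\<zeta> q s ^ b / \<zeta> q s ^ \<alpha>))) =
    (if b = \<alpha> then 2 * of_real pi * \<i> else 0)"
proof (cases "b = \<alpha>")
  case True
  have "\<zeta> q s \<noteq> 0" for q s using \<epsilon> by (simp add: \<zeta>_def)
  then show ?thesis using True N by simp
next
  case False
  define c where "c = real b - real \<alpha>"
  define C where "C = of_real (\<epsilon> ^ b / \<epsilon> ^ \<alpha>) / (of_real c :: complex)"
  define H where "H q = C * cis (c * angle N q 0)" for q
  have c: "c \<noteq> 0" using False by (simp add: c_def)
  have angle_Suc: "angle N q 1 = angle N (Suc q) 0" for q by (simp add: angle_def)
  have "integral {0..1} (\<lambda>s. \<i> * of_real (2 * pi / real N) * (\<zeta> q s ^ b / \<zeta> q s ^ \<alpha>)) = H (Suc q) - H q" for q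
  proof -
    define w where "w = 2 * pi / real N"
    have ang: "angle N q s = w * (real q + s)" for s by (simp add: angle_def w_def)
    have pow: "\<zeta> q s ^ b / \<zeta> q s ^ \<alpha> = of_real (\<epsilon> ^ b / \<epsilon> ^ \<alpha>) * cis (c * angle N q s)" for s
    proof -
      have "cis (angle N q s) ^ b / cis (angle N q s) ^ \<alpha> = cis (c * angle N q s)"
        by (simp add: Complex.DeMoivre cis_divide c_def left_diff_distrib)
      then show ?thesis by (simp add: \<zeta>_def power_mult_distrib times_divide_times_eq [symmetric])
    qed
    have "((\<lambda>s. \<i> * of_real w * (\<zeta> q s ^ b / \<zeta> q s ^ \<alpha>)) has_integral
        C * cis (c * angle N q 1) - C * cis (c * angle N q 0)) {0..1}"
    proof (rule fundamental_theorem_of_calculus)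
      fix s :: real assume "s \<in> {0..1}"
      have "((\<lambda>s. C * cis (c * angle N q s)) has_vector_derivative C * (\<i> * of_real (c * w) * cis (c * angle N q s))) (at s within {0..1})"
        unfolding ang has_vector_derivative_def
        by (auto intro!: derivative_eq_intros simp: scaleR_conv_of_real algebra_simps)
      also have "C * (\<i> * of_real (c * w) * cis (c * angle N q s)) = \<i> * of_real w * (\<zeta> q s ^ b / \<zeta> q s ^ \<alpha>)"
        unfolding pow C_def using c by simp
      finally show "((\<lambda>s. C * cis (c * angle N q s)) has_vector_derivative \<i> * of_real w * (\<zeta> q s ^ b / \<zeta> q s ^ \<alpha>)) (at s within {0..1})" .
    qed simp
    then show ?thesis by (simp add: w_def H_def angle_Suc integral_unique)
  qed
  then have "(\<Sum>q<N. integral {0..1} (\<lambda>s. \<i> * of_real (2 * pi / real N) * (\<zeta> q s ^ b / \<zeta> q s ^ \<alpha>))) = H N - H 0"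
    by (simp add: sum_lessThan_telescope)
  also have "H N = H 0"
  proof -
    have "cis (c * (2 * pi)) = 1"
      using cis_multiple_2pi[of c] by (simp add: c_def mult.commute)
    then show ?thesis using N by (simp add: H_def angle_def)
  qed
  finally show ?thesis using False by simp
qed

context level_arcs
begin

text \<open>
  The form \<open>x\<^sup>m dx / f\<^sub>i\<^bsup>\<alpha>+1\<^esup>\<close> in the parameter of an arc.
\<close>

definition arc_integrand :: "'n \<Rightarrow> nat \<Rightarrow> nat \<Rightarrow> nat \<times> nat \<Rightarrow> real \<Rightarrow> complex" where
  "arc_integrand i \<alpha> m a s =
    z i a s ^ m / cpoly (f i) (z i a s) ^ (\<alpha> + 1) * (of_real (width i) * arg_factor i (z i a s))"

lemma continuous_on_arc_integrand:
  assumes "a \<in> pieces i"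
  shows "continuous_on {0..1} (arc_integrand i \<alpha> m a)"
proof -
  note c = continuous_on_arc[OF assms]
  have "cpoly (f i) (z i a s) \<noteq> 0" if "s \<in> {0..1}" for s
    using norm_cpoly_arc[OF assms that] pos[of i] by auto
  moreover have "continuous_on {0..1} (\<lambda>s. arg_factor i (z i a s))"
    by (rule continuous_on_arg_factor[OF c norm_cpoly_arc[OF assms]])
  ultimately show ?thesis
    unfolding arc_integrand_def by (intro continuous_intros c) auto
qed

lemma arc_integrand_fibre:
  assumes "q < N i" "s \<in> {0..1}"
  defines "\<zeta> \<equiv> of_real (\<epsilon> i) * cis (angle (N i) q s)"
  shows "(\<Sum>k<degree (f i). arc_integrand i \<alpha> m (q, k) s) =
    (\<Sum>b\<le>m. univ_residue (f i) (Suc b) m * (\<i> * of_real (width i) * (\<zeta> ^ b / \<zeta> ^ \<alpha>)))"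
proof -
  have nc: "cpoly (pderiv (f i)) x \<noteq> 0" if "cpoly (f i) x = \<zeta>" for x
    by (rule noncritical) (use that pos[of i] in \<open>simp add: \<zeta>_def norm_mult\<close>)
  have \<zeta>0: "\<zeta> \<noteq> 0" using pos[of i] by (simp add: \<zeta>_def)
  have bij: "bij_betw (\<lambda>k. z i (q, k) s) {..<degree (f i)} {x. cpoly (f i) x = \<zeta>}"
    using arcs[of i] assms by (auto simp: arcs_def)
  have "(\<Sum>k<degree (f i). arc_integrand i \<alpha> m (q, k) s) =
      (\<Sum>x | cpoly (f i) x = \<zeta>. x ^ m / cpoly (f i) x ^ (\<alpha> + 1) * (of_real (width i) * arg_factor i x))"
    unfolding arc_integrand_def by (rule sum.reindex_bij_betw[OF bij])
  also have "\<dots> = (\<Sum>x | cpoly (f i) x = \<zeta>. \<i> * of_real (width i) / \<zeta> ^ \<alpha> * (x ^ m / cpoly (pderiv (f i)) x))"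
    using \<zeta>0 by (intro sum.cong refl) (simp add: arg_factor_def)
  also have "\<dots> = \<i> * of_real (width i) / \<zeta> ^ \<alpha> * (\<Sum>x | cpoly (f i) x = \<zeta>. x ^ m / cpoly (pderiv (f i)) x)"
    by (simp only: sum_distrib_left)
  also have "\<dots> = (\<Sum>b\<le>m. univ_residue (f i) (Suc b) m * (\<i> * of_real (width i) * (\<zeta> ^ b / \<zeta> ^ \<alpha>)))"
  proof -
    have fs: "(\<Sum>x | cpoly (f i) x = \<zeta>. x ^ m / cpoly (pderiv (f i)) x) = (\<Sum>b\<le>m. \<zeta> ^ b * univ_residue (f i) (Suc b) m)"
      by (rule fibre_sum_eq_residues[OF degree]) (rule nc)
    show ?thesis by (subst fs) (simp add: sum_distrib_left mult_ac)
  qed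
  finally show ?thesis .
qed

lemma arc_integral_sum:
  "(\<Sum>a\<in>pieces i. integral {0..1} (arc_integrand i \<alpha> m a)) = 2 * of_real pi * \<i> * univ_residue (f i) (Suc \<alpha>) m"
proof -
  let ?\<zeta> = "\<lambda>q s. of_real (\<epsilon> i) * cis (angle (N i) q s) :: complex"
  let ?c = "\<lambda>b q s. \<i> * of_real (width i) * (?\<zeta> q s ^ b / ?\<zeta> q s ^ \<alpha>)"
  have int: "arc_integrand i \<alpha> m a integrable_on {0..1}" if "a \<in> pieces i" for a
    by (rule integrable_continuous_interval[OF continuous_on_arc_integrand[OF that]])
  have c_int: "?c b q integrable_on {0..1}" for b q
    unfolding angle_def using pos[of i] by (intro integrable_continuous_interval continuous_intros) auto
  have "(\<Sum>a\<in>pieces i. integral {0..1} (arc_integrand i \<alpha> m a)) =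
      (\<Sum>q<N i. \<Sum>k<degree (f i). integral {0..1} (arc_integrand i \<alpha> m (q, k)))"
    unfolding pieces_def by (simp add: sum.cartesian_product)
  also have "\<dots> = (\<Sum>q<N i. integral {0..1} (\<lambda>s. \<Sum>k<degree (f i). arc_integrand i \<alpha> m (q, k) s))"
    by (intro sum.cong refl integral_sum [symmetric] int) (auto simp: pieces_def)
  also have "\<dots> = (\<Sum>q<N i. integral {0..1} (\<lambda>s. \<Sum>b\<le>m. univ_residue (f i) (Suc b) m * ?c b q s))"
    by (intro sum.cong refl integral_cong arc_integrand_fibre) auto
  also have "\<dots> = (\<Sum>q<N i. \<Sum>b\<le>m. univ_residue (f i) (Suc b) m * integral {0..1} (?c b q))"
    by (subst integral_sum) (auto intro!: integrable_on_mult_right c_int simp del: times_divide_eq_right)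
  also have "\<dots> = (\<Sum>b\<le>m. univ_residue (f i) (Suc b) m * (\<Sum>q<N i. integral {0..1} (?c b q)))"
    by (subst sum.swap) (simp only: sum_distrib_left)
  also have "\<dots> = (\<Sum>b\<le>m. univ_residue (f i) (Suc b) m * (if b = \<alpha> then 2 * of_real pi * \<i> else 0))"
    unfolding width_def using circle_power_integral[OF pos, of "N i" i _ \<alpha>] N_ge_2[of i] by simp
  also have "\<dots> = (if \<alpha> \<le> m then 2 * of_real pi * \<i> * univ_residue (f i) (Suc \<alpha>) m else 0)"
    by (simp add: if_distrib[of "\<lambda>x. _ * x"] cong: if_cong)
  also have "\<dots> = 2 * of_real pi * \<i> * univ_residue (f i) (Suc \<alpha>) m"
    using univ_residue_eq_0[OF degree] by simp
  finally show ?thesis .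
qed

end

text \<open>
  The value of the global residue: the residue of each monomial is a product of residues at infinity.
\<close>

definition residue_sum :: "('n::finite) mpoly \<Rightarrow> ('n \<Rightarrow> int poly) \<Rightarrow> ('n \<Rightarrow> nat) \<Rightarrow> complex" where
  "residue_sum g f \<alpha> = (\<Sum>m\<in>Poly_Mapping.keys g. of_int (Poly_Mapping.lookup g m) *
     (\<Prod>i\<in>UNIV. univ_residue (f i) (Suc (\<alpha> i)) (Poly_Mapping.lookup m i)))"

context level_arcs
begin

text \<open>
  The integrand is a sum of products of functions of one coordinate, and the cells form a product set.
  Thus for each monomial the sum over the cells of the integrals is a product over the coordinates.
\<close>

lemma chart_density_integral_sum:
  fixes g :: "'n mpoly" and \<alpha> :: "'n \<Rightarrow> nat"
  defines "F \<equiv> \<lambda>x. mpoly_eval g x / (\<Prod>i\<in>UNIV. cpoly (f i) (x $ i) ^ (\<alpha> i + 1))"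
  shows "continuous_on torus F"
    and "(\<Sum>\<kappa>\<in>cells. integral (cbox 0 1) (chart_density F \<kappa>)) = (2 * of_real pi * \<i>) ^ CARD('n) * residue_sum g f \<alpha>"
proof -
  have "cpoly (f i) (x $ i) \<noteq> 0" if "x \<in> torus" for x i
    using that pos[of i] unfolding torus_def by (metis (mono_tags, lifting) mem_Collect_eq norm_zero less_irrefl)
  then show "continuous_on torus F"
    unfolding F_def mpoly_eval_def by (intro continuous_intros) auto
  let ?K = "Poly_Mapping.keys g" and ?g = "\<lambda>m. of_int (Poly_Mapping.lookup g m) :: complex"
  let ?h = "\<lambda>\<kappa> m i. arc_integrand i (\<alpha> i) (Poly_Mapping.lookup m i) (\<kappa> i)"
  have dens: "chart_density F \<kappa> s = (\<Sum>m\<in>?K. ?g m * (\<Prod>i\<in>UNIV. ?h \<kappa> m i (s $ i)))" for \<kappa> s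
    unfolding chart_density_def F_def mpoly_eval_def sum_divide_distrib sum_distrib_right
    by (intro sum.cong refl) (simp add: arc_integrand_def chart_def prod.distrib prod_dividef)
  have h_cont: "continuous_on {0..1} (?h \<kappa> m i)" if "\<kappa> \<in> cells" for \<kappa> m i
    by (rule continuous_on_arc_integrand[OF cells_pieces[OF that]])
  have int: "integral (cbox 0 1) (chart_density F \<kappa>) = (\<Sum>m\<in>?K. ?g m * (\<Prod>i\<in>UNIV. integral {0..1} (?h \<kappa> m i)))"
    if \<kappa>: "\<kappa> \<in> cells" for \<kappa>
  proof -
    have "(\<lambda>s :: real ^ 'n. \<Prod>i\<in>UNIV. ?h \<kappa> m i (s $ i)) integrable_on cbox 0 1" for m
    proof (intro integrable_continuous continuous_on_prod)
      show "continuous_on (cbox 0 1) (\<lambda>s :: real ^ 'n. ?h \<kappa> m i (s $ i))" for i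
        by (rule continuous_on_compose2[OF h_cont[OF \<kappa>]]) (auto simp: mem_box_cart intro: continuous_intros)
    qed
    then have "integral (cbox 0 1) (chart_density F \<kappa>) = (\<Sum>m\<in>?K. ?g m * integral (cbox 0 1) (\<lambda>s :: real ^ 'n. \<Prod>i\<in>UNIV. ?h \<kappa> m i (s $ i)))"
      unfolding dens by (subst integral_sum) (auto intro!: integrable_on_mult_right)
    then show ?thesis by (simp only: integral_cbox_prod[OF h_cont[OF \<kappa>]])
  qed
  have "(\<Sum>\<kappa>\<in>cells. integral (cbox 0 1) (chart_density F \<kappa>)) =
      (\<Sum>\<kappa>\<in>cells. \<Sum>m\<in>?K. ?g m * (\<Prod>i\<in>UNIV. integral {0..1} (?h \<kappa> m i)))"
    by (intro sum.cong refl int)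
  also have "\<dots> = (\<Sum>m\<in>?K. ?g m * (\<Sum>\<kappa>\<in>cells. \<Prod>i\<in>UNIV. integral {0..1} (?h \<kappa> m i)))"
    by (subst sum.swap) (simp only: sum_distrib_left)
  also have "\<dots> = (\<Sum>m\<in>?K. ?g m * (\<Prod>i\<in>UNIV. \<Sum>a\<in>pieces i. integral {0..1} (arc_integrand i (\<alpha> i) (Poly_Mapping.lookup m i) a)))"
    unfolding cells_def by (subst prod_sum_PiE) (auto simp: pieces_def)
  also have "\<dots> = (\<Sum>m\<in>?K. ?g m * ((2 * of_real pi * \<i>) ^ CARD('n) * (\<Prod>i\<in>UNIV. univ_residue (f i) (Suc (\<alpha> i)) (Poly_Mapping.lookup m i))))"
  proof -
    have "(\<Prod>i\<in>UNIV. C * r i) = C ^ CARD('n) * (\<Prod>i\<in>UNIV. r i)" for C :: complex and r :: "'n \<Rightarrow> complex"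
      by (simp add: prod.distrib)
    then show ?thesis by (simp only: arc_integral_sum)
  qed
  also have "\<dots> = (2 * of_real pi * \<i>) ^ CARD('n) * residue_sum g f \<alpha>"
    unfolding residue_sum_def sum_distrib_left by (intro sum.cong refl) (simp only: mult_ac)
  finally show "(\<Sum>\<kappa>\<in>cells. integral (cbox 0 1) (chart_density F \<kappa>)) = (2 * of_real pi * \<i>) ^ CARD('n) * residue_sum g f \<alpha>" .
qed

lemma has_cycle_integral_torus:
  "has_cycle_integral (\<lambda>x. mpoly_eval g x / (\<Prod>i\<in>UNIV. cpoly (f i) (x $ i) ^ (\<alpha> i + 1)))
    f torus ((2 * of_real pi * \<i>) ^ CARD('n) * residue_sum g f \<alpha>)"
  unfolding has_cycle_integral_def
proof (intro conjI allI impI)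
  show "\<exists>\<Phi>. oriented_param f torus \<Phi>" using oriented_param_charts by blast
  fix \<Phi> assume "oriented_param f torus \<Phi>"
  from oriented_param_integral[OF this chart_density_integral_sum(1)] chart_density_integral_sum(2)
  show "(\<Sum>\<phi>\<in>\<Phi>. cube_integral (\<lambda>x. mpoly_eval g x / (\<Prod>i\<in>UNIV. cpoly (f i) (x $ i) ^ (\<alpha> i + 1))) \<phi>) =
      (2 * of_real pi * \<i>) ^ CARD('n) * residue_sum g f \<alpha>" by simp
qed

end

lemma finite_common_zeros:
  fixes f :: "'n::finite \<Rightarrow> int poly"
  assumes "\<And>i. degree (f i) > 0"
  shows "finite (common_zeros f)"
proof (rule finite_imageD)
  have "(\<lambda>x i. x $ i) ` common_zeros f \<subseteq> PiE UNIV (\<lambda>i. {x. cpoly (f i) x = 0})"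
    by (auto simp: common_zeros_def)
  moreover have "finite (PiE UNIV (\<lambda>i. {x. cpoly (f i) x = 0}))"
    using finite_fibre assms by (intro finite_PiE) auto
  ultimately show "finite ((\<lambda>x i. x $ i) ` common_zeros f)" by (rule finite_subset)
  show "inj_on (\<lambda>x i. x $ i) (common_zeros f)" by (auto simp: inj_on_def vec_eq_iff fun_eq_iff)
qed

lemma small_values_in_ball:
  fixes f :: "'n::finite \<Rightarrow> int poly"
  assumes deg: "\<And>i. degree (f i) > 0" and R: "common_zeros f \<subseteq> ball 0 R"
  shows "\<exists>\<delta>>0. \<forall>x. (\<forall>i. norm (cpoly (f i) (x $ i)) < \<delta>) \<longrightarrow> x \<in> ball 0 R"
proof -
  obtain e where e: "e > 0" "(\<Union>w\<in>common_zeros f. ball w e) \<subseteq> ball 0 R"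
    using compact_subset_open_imp_ball_epsilon_subset[OF finite_imp_compact[OF finite_common_zeros[OF deg]] open_ball R]
    by blast
  \<comment> \<open>The norm of a vector is at most the sum of the norms of its \<open>n\<close> coordinates.\<close>
  define \<eta> where "\<eta> = e / real CARD('n)"
  have \<eta>: "\<eta> > 0" using e by (simp add: \<eta>_def)
  obtain \<delta> where \<delta>: "\<And>i. \<delta> i > 0"
    "\<And>i x. norm (cpoly (f i) x) < \<delta> i \<Longrightarrow> \<exists>w. cpoly (f i) w = 0 \<and> norm (x - w) < \<eta>"
    using small_value_near_root[OF deg \<eta>] by metis
  show ?thesis
  proof (intro exI[of _ "Min (range \<delta>)"] conjI allI impI)
    show "Min (range \<delta>) > 0" using \<delta>(1) by simp
    fix x assume x: "\<forall>i. norm (cpoly (f i) (x $ i)) < Min (range \<delta>)"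
    have "norm (cpoly (f i) (x $ i)) < \<delta> i" for i
    proof -
      have "Min (range \<delta>) \<le> \<delta> i" by (intro Min_le) auto
      with x[rule_format, of i] show ?thesis by (rule order.strict_trans2)
    qed
    then have "\<exists>w. cpoly (f i) w = 0 \<and> norm (x $ i - w) < \<eta>" for i by (rule \<delta>(2))
    then have "\<exists>w. \<forall>i. cpoly (f i) (w i) = 0 \<and> norm (x $ i - w i) < \<eta>" by (rule choice[OF allI])
    then obtain w where w: "\<And>i. cpoly (f i) (w i) = 0" "\<And>i. norm (x $ i - w i) < \<eta>" by blast
    let ?w = "\<chi> i. w i"
    have "norm (x - ?w) \<le> (\<Sum>i\<in>UNIV. norm (x $ i - w i))"
      unfolding norm_vec_def using L2_set_le_sum[of UNIV "\<lambda>i. norm ((x - ?w) $ i)"] by simp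
    also have "\<dots> < (\<Sum>i\<in>(UNIV :: 'n set). \<eta>)"
      using w(2) by (intro sum_strict_mono) auto
    also have "\<dots> = e" by (simp add: \<eta>_def)
    finally have "x \<in> ball ?w e" by (simp add: dist_norm norm_minus_commute)
    moreover have "?w \<in> common_zeros f" using w(1) by (simp add: common_zeros_def)
    ultimately show "x \<in> ball 0 R" using e(2) by blast
  qed
qed

lemma has_cycle_integral_small:
  fixes f :: "'n::finite \<Rightarrow> int poly"
  assumes deg: "\<And>i. degree (f i) > 0" and R: "common_zeros f \<subseteq> ball 0 R"
  shows "\<exists>\<delta>>0. \<forall>\<epsilon>. (\<forall>i. 0 < \<epsilon> i \<and> \<epsilon> i < \<delta>) \<longrightarrow>
    has_cycle_integral (\<lambda>x. mpoly_eval g x / (\<Prod>i\<in>UNIV. cpoly (f i) (x $ i) ^ (\<alpha> i + 1)))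
      f (residue_cycle f R \<epsilon>) ((2 * of_real pi * \<i>) ^ CARD('n) * residue_sum g f \<alpha>)"
proof -
  obtain \<delta>0 where \<delta>0: "\<delta>0 > 0" "\<And>x. (\<forall>i. norm (cpoly (f i) (x $ i)) < \<delta>0) \<Longrightarrow> x \<in> ball 0 R"
    using small_values_in_ball[OF deg R] by blast
  obtain \<delta>1 where \<delta>1: "\<And>i. \<delta>1 i > 0"
    "\<And>i x. 0 < norm (cpoly (f i) x) \<and> norm (cpoly (f i) x) < \<delta>1 i \<Longrightarrow> cpoly (pderiv (f i)) x \<noteq> 0"
    using small_value_noncritical[OF deg] by metis
  show ?thesis
  proof (intro exI[of _ "min \<delta>0 (Min (range \<delta>1))"] conjI allI impI)
    show "min \<delta>0 (Min (range \<delta>1)) > 0" using \<delta>0(1) \<delta>1(1) by simp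
    fix \<epsilon> :: "'n \<Rightarrow> real" assume \<epsilon>: "\<forall>i. 0 < \<epsilon> i \<and> \<epsilon> i < min \<delta>0 (Min (range \<delta>1))"
    have pos: "\<epsilon> i > 0" and small: "\<epsilon> i < \<delta>0" "\<epsilon> i < \<delta>1 i" for i
    proof -
      have "Min (range \<delta>1) \<le> \<delta>1 i" by (intro Min_le) auto
      then show "\<epsilon> i > 0" "\<epsilon> i < \<delta>0" "\<epsilon> i < \<delta>1 i" using \<epsilon>[rule_format, of i] by auto
    qed
    have nc: "cpoly (pderiv (f i)) x \<noteq> 0" if "norm (cpoly (f i) x) = \<epsilon> i" for i x
      using \<delta>1(2)[of i x] that pos[of i] small(2)[of i] by simp
    have "\<exists>N z. arcs (f i) (\<epsilon> i) N z" for i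
      by (rule exists_arcs[OF deg pos nc])
    then obtain N z where "\<And>i. arcs (f i) (\<epsilon> i) (N i) (z i)" by metis
    then interpret level_arcs f \<epsilon> N z
      by unfold_locales (use deg pos nc in auto)
    have "residue_cycle f R \<epsilon> = torus"
      using \<delta>0(2) small(1) by (auto simp: residue_cycle_def torus_def simp del: mem_ball_0)
    then show "has_cycle_integral (\<lambda>x. mpoly_eval g x / (\<Prod>i\<in>UNIV. cpoly (f i) (x $ i) ^ (\<alpha> i + 1)))
        f (residue_cycle f R \<epsilon>) ((2 * of_real pi * \<i>) ^ CARD('n) * residue_sum g f \<alpha>)"
      using has_cycle_integral_torus by simp
  qed
qed

lemma has_cycle_integral_unique:
  "has_cycle_integral F f \<Gamma> c \<Longrightarrow> has_cycle_integral F f \<Gamma> c' \<Longrightarrow> c = c'"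
  unfolding has_cycle_integral_def by blast

text \<open>
  The value is attained for every admissible radius. It is the only one with this property, since
  already a single ball and a single \<open>\<epsilon>\<close> determine it.
\<close>

theorem global_residue_eq:
  fixes f :: "'n::finite \<Rightarrow> int poly"
  assumes deg: "\<And>i. degree (f i) > 0"
  shows "global_residue g f \<alpha> = residue_sum g f \<alpha>"
  unfolding global_residue_def
proof (rule the_equality)
  let ?F = "\<lambda>x. mpoly_eval g x / (\<Prod>i\<in>UNIV. cpoly (f i) (x $ i) ^ (\<alpha> i + 1))"
  let ?I = "(2 * of_real pi * \<i>) ^ CARD('n) :: complex"
  show "\<forall>R. common_zeros f \<subseteq> ball 0 R \<longrightarrow> (\<exists>\<delta>>0. \<forall>\<epsilon>. (\<forall>i. 0 < \<epsilon> i \<and> \<epsilon> i < \<delta>) \<longrightarrow>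
      has_cycle_integral ?F f (residue_cycle f R \<epsilon>) (?I * residue_sum g f \<alpha>))"
    by (intro allI impI, rule has_cycle_integral_small[OF deg])
  fix c
  assume c: "\<forall>R. common_zeros f \<subseteq> ball 0 R \<longrightarrow> (\<exists>\<delta>>0. \<forall>\<epsilon>. (\<forall>i. 0 < \<epsilon> i \<and> \<epsilon> i < \<delta>) \<longrightarrow>
      has_cycle_integral ?F f (residue_cycle f R \<epsilon>) (?I * c))"
  obtain R where R: "common_zeros f \<subseteq> ball 0 R"
    using bounded_subset_ballD[OF finite_imp_bounded[OF finite_common_zeros[of f, OF deg]], where x = 0] by blast
  obtain \<delta> where \<delta>: "\<delta> > 0" "\<forall>\<epsilon>. (\<forall>i. 0 < \<epsilon> i \<and> \<epsilon> i < \<delta>) \<longrightarrow>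
      has_cycle_integral ?F f (residue_cycle f R \<epsilon>) (?I * c)"
    using c[THEN spec, THEN mp, OF R] by (elim exE conjE) (rule that)
  obtain \<delta>' where \<delta>': "\<delta>' > 0" "\<forall>\<epsilon>. (\<forall>i. 0 < \<epsilon> i \<and> \<epsilon> i < \<delta>') \<longrightarrow>
      has_cycle_integral ?F f (residue_cycle f R \<epsilon>) (?I * residue_sum g f \<alpha>)"
    using has_cycle_integral_small[OF deg R, of g \<alpha>] by (elim exE conjE) (rule that)
  define \<epsilon> :: "'n \<Rightarrow> real" where "\<epsilon> i = min \<delta> \<delta>' / 2" for i
  have "\<forall>i. 0 < \<epsilon> i \<and> \<epsilon> i < \<delta>" "\<forall>i. 0 < \<epsilon> i \<and> \<epsilon> i < \<delta>'"
    using \<delta>(1) \<delta>'(1) by (auto simp: \<epsilon>_def min_def)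
  then have "?I * c = ?I * residue_sum g f \<alpha>"
    by (intro has_cycle_integral_unique[OF \<delta>(2)[THEN spec, THEN mp] \<delta>'(2)[THEN spec, THEN mp]])
  then show "c = residue_sum g f \<alpha>" by simp
qed

section \<open>Integrality and height\<close>

lemma abs_coeff_le_Max:
  fixes p :: "int poly"
  assumes "p \<noteq> 0"
  shows "\<bar>coeff p i\<bar> \<le> Max (abs ` set (coeffs p))"
proof (cases "coeff p i = 0")
  case True
  have "lead_coeff p \<in> set (coeffs p)" using assms by (simp add: coeff_in_coeffs)
  then have "\<bar>lead_coeff p\<bar> \<le> Max (abs ` set (coeffs p))" by (intro Max_ge) auto
  then show ?thesis using True by simp
next
  case False
  then have "coeff p i \<in> set (coeffs p)" by (metis assms coeff_in_coeffs le_degree)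
  then show ?thesis by (intro Max_ge) auto
qed

lemma univ_residue_scaled:
  assumes d: "degree p > 0" and b: "b * degree p \<le> m + 1" and K: "m + 1 - b * degree p \<le> K"
  shows "of_int (lead_coeff p) powi (int K + int b) * univ_residue p b m =
    of_int (inf_coeff p b (m + 1 - b * degree p) * lead_coeff p ^ (K - (m + 1 - b * degree p)))"
proof -
  define k where "k = m + 1 - b * degree p"
  define c :: complex where "c = of_int (lead_coeff p)"
  have c: "c \<noteq> 0" using d by (auto simp: c_def)
  have "c powi (int K + int b) = c ^ (K + b)"
    by (simp flip: of_nat_add add: power_int_of_nat)
  also have "K + b = (k + b) + (K - k)" using K by (simp add: k_def)
  finally have "c powi (int K + int b) = c ^ (k + b) * c ^ (K - k)" by (simp only: power_add)
  moreover have "univ_residue p b m = of_int (inf_coeff p b k) / c ^ (k + b)"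
    using b by (simp add: univ_residue_def k_def c_def)
  ultimately have "c powi (int K + int b) * univ_residue p b m = of_int (inf_coeff p b k) * c ^ (K - k)"
    using c by simp
  then show ?thesis by (simp add: c_def k_def)
qed

text \<open>
  The contribution of one monomial. It is nonzero only if all \<open>k\<^sub>i = m\<^sub>i + 1 - (\<alpha>\<^sub>i + 1) d\<^sub>i\<close> are
  nonnegative. Then each \<open>k\<^sub>i\<close> is at most \<open>\<Sum> k\<^sub>i \<le> K\<close>, so the exponent \<open>K + \<alpha>\<^sub>i + 1\<close> suffices to clear the
  denominator; the remaining factor \<open>c\<^sub>i\<^bsup>K-k\<^sub>i\<^esup>\<close> is at most \<open>H\<^sub>i\<^bsup>K-k\<^sub>i\<^esup>\<close>, which makes the powers of \<open>H\<^sub>i\<close> add up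
  to \<open>K\<close>, and \<open>\<Sum> (k\<^sub>i + \<alpha>\<^sub>i d\<^sub>i) = |m| - |d| + n\<close> is the exponent of two.
\<close>

lemma monomial_residue:
  fixes f :: "'n::finite \<Rightarrow> int poly" and \<alpha> m :: "'n \<Rightarrow> nat"
  assumes deg: "\<And>i. degree (f i) > 0" and H: "\<And>i j. \<bar>coeff (f i) j\<bar> \<le> H i"
    and e: "(\<Sum>i\<in>UNIV. m i) \<le> e"
  defines "r \<equiv> \<lambda>i. univ_residue (f i) (Suc (\<alpha> i)) (m i)"
    and "K \<equiv> int e + int CARD('n) - (\<Sum>i\<in>UNIV. (int (\<alpha> i) + 1) * int (degree (f i)))"
    and "L \<equiv> int e + int CARD('n) - (\<Sum>i\<in>UNIV. int (degree (f i)))"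
  shows "K < 0 \<Longrightarrow> (\<Prod>i\<in>UNIV. r i) = 0"
    and "K \<ge> 0 \<Longrightarrow> \<exists>T. (\<Prod>i\<in>UNIV. of_int (lead_coeff (f i)) powi (K + (int (\<alpha> i) + 1)) * r i) = of_int T \<and>
      \<bar>T\<bar> \<le> (\<Prod>i\<in>UNIV. H i) ^ nat K * 2 ^ nat L"
proof -
  let ?ok = "\<forall>i. Suc (\<alpha> i) * degree (f i) \<le> m i + 1"
  define k where "k i = m i + 1 - Suc (\<alpha> i) * degree (f i)" for i
  have zero: "(\<Prod>i\<in>UNIV. h i * r i) = 0" if "\<not> ?ok" for h :: "'n \<Rightarrow> complex"
  proof -
    from that obtain i where "\<not> Suc (\<alpha> i) * degree (f i) \<le> m i + 1" by blast
    then have "r i = 0" by (simp add: r_def univ_residue_def)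
    then show ?thesis by (intro prod_zero) auto
  qed
  have k_int: "int (k i) = int (m i) + 1 - (int (\<alpha> i) + 1) * int (degree (f i))" if ?ok for i
  proof -
    have "int (k i) = int (m i + 1) - int (Suc (\<alpha> i) * degree (f i))"
      unfolding k_def using that by (intro of_nat_diff) blast
    then show ?thesis by (simp add: algebra_simps)
  qed
  have m_e: "(\<Sum>i\<in>UNIV. int (m i)) \<le> int e" using e by (simp flip: of_nat_sum)
  have k_sum: "(\<Sum>i\<in>UNIV. int (k i)) \<le> K" if ?ok
  proof -
    have "(\<Sum>i\<in>UNIV. int (k i)) = (\<Sum>i\<in>UNIV. int (m i)) + int CARD('n) - (\<Sum>i\<in>UNIV. (int (\<alpha> i) + 1) * int (degree (f i)))"
      by (simp add: k_int[OF that] sum.distrib sum_subtractf)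
    then show ?thesis using m_e by (simp add: K_def)
  qed
  show "(\<Prod>i\<in>UNIV. r i) = 0" if "K < 0"
  proof -
    have "\<not> ?ok"
    proof
      assume ?ok
      from k_sum[OF this] have "(\<Sum>i\<in>UNIV. int (k i)) < 0" using that by linarith
      moreover have "(\<Sum>i\<in>UNIV. int (k i)) \<ge> 0" by (intro sum_nonneg) auto
      ultimately show False by simp
    qed
    from zero[OF this, of "\<lambda>_. 1"] show ?thesis by simp
  qed
  assume K0: "K \<ge> 0"
  show "\<exists>T. (\<Prod>i\<in>UNIV. of_int (lead_coeff (f i)) powi (K + (int (\<alpha> i) + 1)) * r i) = of_int T \<and>
      \<bar>T\<bar> \<le> (\<Prod>i\<in>UNIV. H i) ^ nat K * 2 ^ nat L"
  proof (cases ?ok)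
    case False
    have "0 \<le> H i" for i using H[of i 0] by linarith
    then show ?thesis using zero[OF False] by (intro exI[of _ 0]) (auto intro!: mult_nonneg_nonneg zero_le_power prod_nonneg)
  next
    case ok: True
    have H0: "0 \<le> H i" for i using H[of i 0] by linarith
    have kK: "k i \<le> nat K" for i
    proof -
      have "int (k i) \<le> (\<Sum>i\<in>UNIV. int (k i))" by (rule member_le_sum) auto
      then show ?thesis using k_sum[OF ok] by linarith
    qed
    define T where "T = (\<Prod>i\<in>UNIV. inf_coeff (f i) (Suc (\<alpha> i)) (k i) * lead_coeff (f i) ^ (nat K - k i))"
    have "(\<Prod>i\<in>UNIV. of_int (lead_coeff (f i)) powi (K + (int (\<alpha> i) + 1)) * r i) = of_int T"
      unfolding T_def of_int_prod
    proof (intro prod.cong refl)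
      fix i
      have E: "K + (int (\<alpha> i) + 1) = int (nat K) + int (Suc (\<alpha> i))" using K0 by simp
      show "of_int (lead_coeff (f i)) powi (K + (int (\<alpha> i) + 1)) * r i =
          of_int (inf_coeff (f i) (Suc (\<alpha> i)) (k i) * lead_coeff (f i) ^ (nat K - k i))"
        unfolding E r_def k_def by (rule univ_residue_scaled[OF deg ok[rule_format] kK[of i, unfolded k_def]])
    qed
    moreover have "\<bar>T\<bar> \<le> (\<Prod>i\<in>UNIV. H i) ^ nat K * 2 ^ nat L"
    proof -
      have "\<bar>T\<bar> \<le> (\<Prod>i\<in>UNIV. (H i ^ k i * 2 ^ (k i + \<alpha> i * degree (f i))) * H i ^ (nat K - k i))"
        unfolding T_def abs_prod abs_mult power_abs
        by (intro prod_mono conjI mult_mono power_mono inf_coeff_bound H) (use H0 in auto)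
      also have "\<dots> = (\<Prod>i\<in>UNIV. H i ^ nat K * 2 ^ (k i + \<alpha> i * degree (f i)))"
      proof (intro prod.cong refl)
        fix i
        have "H i ^ nat K = H i ^ k i * H i ^ (nat K - k i)" using kK[of i] by (simp flip: power_add)
        then show "(H i ^ k i * 2 ^ (k i + \<alpha> i * degree (f i))) * H i ^ (nat K - k i) =
            H i ^ nat K * 2 ^ (k i + \<alpha> i * degree (f i))" by (simp only: mult_ac)
      qed
      also have "\<dots> = (\<Prod>i\<in>UNIV. H i) ^ nat K * 2 ^ (\<Sum>i\<in>UNIV. k i + \<alpha> i * degree (f i))"
        by (simp only: prod.distrib prod_power_distrib power_sum)
      also have "\<dots> \<le> (\<Prod>i\<in>UNIV. H i) ^ nat K * 2 ^ nat L"
      proof (intro mult_left_mono power_increasing)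
        have "int (\<Sum>i\<in>UNIV. k i + \<alpha> i * degree (f i)) = (\<Sum>i\<in>UNIV. int (m i) + 1 - int (degree (f i)))"
          unfolding of_nat_sum by (intro sum.cong refl) (simp add: k_int[OF ok] algebra_simps)
        also have "\<dots> \<le> L" using m_e by (simp add: sum.distrib sum_subtractf L_def)
        finally show "(\<Sum>i\<in>UNIV. k i + \<alpha> i * degree (f i)) \<le> nat L" by linarith
      qed (auto intro!: zero_le_power prod_nonneg H0)
      finally show ?thesis .
    qed
    ultimately show ?thesis by blast
  qed
qed

theorem theorem4p4:
  fixes f :: "'n::finite \<Rightarrow> int poly" and g :: "'n mpoly" and \<alpha> :: "'n \<Rightarrow> nat"
    and d \<alpha>1 :: "'n \<Rightarrow> int" and e n :: int and A Res :: complex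
  assumes f: "\<And>i. degree (f i) > 0"
    and g: "g \<noteq> 0"
  defines "n \<equiv> int CARD('n)"
    and "d \<equiv> (\<lambda>i. int (degree (f i)))"
    and "e \<equiv> int (mpoly_degree g)"
    and "\<alpha>1 \<equiv> (\<lambda>i. int (\<alpha> i) + 1)"
    and "Res \<equiv> global_residue g f \<alpha>"
    and "A \<equiv> (\<Prod>i\<in>UNIV. of_int (lead_coeff (f i)) powi
                 (e + n - scalar_prod \<alpha>1 (\<lambda>j. d j - std_basis i j)))"
  shows "A * Res \<in> \<int> \<and>
    elog (norm (A * Res)) \<le>
      ereal (height1 g
        + of_int (e + n - scalar_prod \<alpha>1 d) * (\<Sum>i\<in>UNIV. height (f i))
        + of_int (e - (\<Sum>i\<in>UNIV. d i) + n) * ln 2) \<and>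
    (e < scalar_prod \<alpha>1 d - n \<longrightarrow> Res = 0)"
proof -
  define K where "K = e + n - scalar_prod \<alpha>1 d"
  define L where "L = e - (\<Sum>i\<in>UNIV. d i) + n"
  define H where "H i = Max (abs ` set (coeffs (f i)))" for i
  let ?keys = "Poly_Mapping.keys g" and ?g = "Poly_Mapping.lookup g"
  let ?r = "\<lambda>m i. univ_residue (f i) (Suc (\<alpha> i)) (Poly_Mapping.lookup m i)"
  have f0: "f i \<noteq> 0" for i using f[of i] by auto
  have coeff_H: "\<bar>coeff (f i) j\<bar> \<le> H i" for i j
    unfolding H_def by (rule abs_coeff_le_Max[OF f0])
  have H1: "H i \<ge> 1" for i
  proof -
    have "lead_coeff (f i) \<noteq> 0" using f0 by simp
    then show ?thesis using coeff_H[of i "degree (f i)"] by linarith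
  qed
  have K_eq: "K = int (mpoly_degree g) + int CARD('n) - (\<Sum>i\<in>UNIV. (int (\<alpha> i) + 1) * int (degree (f i)))"
    by (simp add: K_def e_def n_def scalar_prod_def \<alpha>1_def d_def)
  have L_eq: "L = int (mpoly_degree g) + int CARD('n) - (\<Sum>i\<in>UNIV. int (degree (f i)))"
    by (simp add: L_def e_def n_def d_def)
  have m_le: "(\<Sum>i\<in>UNIV. Poly_Mapping.lookup m i) \<le> mpoly_degree g" if "m \<in> ?keys" for m
    unfolding mpoly_degree_def using that by (intro Max_ge) auto
  note mono = monomial_residue[of f H _ "mpoly_degree g", OF f coeff_H m_le, where \<alpha> = \<alpha>, folded K_eq L_eq]
  have Res: "Res = (\<Sum>m\<in>?keys. of_int (?g m) * (\<Prod>i\<in>UNIV. ?r m i))"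
    unfolding Res_def global_residue_eq[of f, OF f] residue_sum_def ..
  have zero: "Res = 0" if "K < 0"
    unfolding Res using mono(1)[OF _ that] by (intro sum.neutral) auto
  have exponent: "e + n - scalar_prod \<alpha>1 (\<lambda>j. d j - std_basis i j) = K + (int (\<alpha> i) + 1)" for i
  proof -
    have "scalar_prod \<alpha>1 (\<lambda>j. d j - std_basis i j) = scalar_prod \<alpha>1 d - (\<Sum>j\<in>UNIV. \<alpha>1 j * std_basis i j)"
      by (simp add: scalar_prod_def right_diff_distrib sum_subtractf)
    also have "(\<Sum>j\<in>UNIV. \<alpha>1 j * std_basis i j) = \<alpha>1 i"
      by (simp add: std_basis_def if_distrib cong: if_cong)
    finally show ?thesis by (simp add: K_def \<alpha>1_def)
  qed
  show ?thesis
  proof (cases "K < 0")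
    case True
    then show ?thesis by (simp add: zero elog_def)
  next
    case False
    then have K0: "0 \<le> K" by simp
    have "\<forall>m\<in>?keys. \<exists>T. (\<Prod>i\<in>UNIV. of_int (lead_coeff (f i)) powi (K + (int (\<alpha> i) + 1)) * ?r m i) = of_int T \<and>
        \<bar>T\<bar> \<le> (\<Prod>i\<in>UNIV. H i) ^ nat K * 2 ^ nat L"
      by (intro ballI mono(2) K0)
    from bchoice[OF this] obtain T where T: "\<And>m. m \<in> ?keys \<Longrightarrow>
        (\<Prod>i\<in>UNIV. of_int (lead_coeff (f i)) powi (K + (int (\<alpha> i) + 1)) * ?r m i) = of_int (T m)"
      and T_le: "\<And>m. m \<in> ?keys \<Longrightarrow> \<bar>T m\<bar> \<le> (\<Prod>i\<in>UNIV. H i) ^ nat K * 2 ^ nat L"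
      by blast
    define S where "S = (\<Sum>m\<in>?keys. ?g m * T m)"
    have AR: "A * Res = of_int S"
    proof -
      have "A * Res = (\<Sum>m\<in>?keys. of_int (?g m) * (\<Prod>i\<in>UNIV. of_int (lead_coeff (f i)) powi (K + (int (\<alpha> i) + 1)) * ?r m i))"
        unfolding A_def exponent Res sum_distrib_left prod.distrib by (intro sum.cong refl) (simp only: mult_ac)
      then show ?thesis by (simp add: S_def T)
    qed
    let ?G = "\<Sum>m\<in>?keys. \<bar>?g m\<bar>"
    have S_le: "\<bar>S\<bar> \<le> ?G * ((\<Prod>i\<in>UNIV. H i) ^ nat K * 2 ^ nat L)"
    proof -
      have "\<bar>S\<bar> \<le> (\<Sum>m\<in>?keys. \<bar>?g m\<bar> * \<bar>T m\<bar>)" unfolding S_def abs_mult [symmetric] by (rule sum_abs)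
      also have "\<dots> \<le> (\<Sum>m\<in>?keys. \<bar>?g m\<bar> * ((\<Prod>i\<in>UNIV. H i) ^ nat K * 2 ^ nat L))"
        by (intro sum_mono mult_left_mono T_le) auto
      finally show ?thesis by (simp only: sum_distrib_right)
    qed
    have L0: "L \<ge> 0"
    proof -
      have "(\<Sum>i\<in>UNIV. d i) \<le> scalar_prod \<alpha>1 d"
        unfolding scalar_prod_def \<alpha>1_def d_def by (intro sum_mono) (simp add: algebra_simps)
      then show ?thesis using False by (simp add: K_def L_def)
    qed
    have G0: "?G > 0"
    proof -
      obtain m where "m \<in> ?keys" using g by (metis all_not_in_conv keys_eq_empty)
      then have "0 < \<bar>?g m\<bar>" "\<bar>?g m\<bar> \<le> ?G"
        by (auto simp: in_keys_iff intro!: member_le_sum)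
      then show ?thesis by linarith
    qed
    have PH: "(\<Prod>i\<in>UNIV. real_of_int (H i)) > 0"
      using H1 by (intro prod_pos) (auto intro: less_le_trans[OF zero_less_one])
    have "elog (norm (A * Res)) \<le> ereal (height1 g + of_int K * (\<Sum>i\<in>UNIV. height (f i)) + of_int L * ln 2)"
    proof (cases "S = 0")
      case True
      then show ?thesis by (simp add: AR elog_def)
    next
      case S0: False
      have "real_of_int \<bar>S\<bar> \<le> of_int (?G * ((\<Prod>i\<in>UNIV. H i) ^ nat K * 2 ^ nat L))"
        using S_le by (simp only: of_int_le_iff)
      then have "ln (real_of_int \<bar>S\<bar>) \<le> ln (of_int ?G * ((\<Prod>i\<in>UNIV. of_int (H i)) ^ nat K * 2 ^ nat L))"
        using S0 by (intro ln_mono) (auto simp: of_int_prod)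
      also have "\<dots> = ln (of_int ?G) + (real (nat K) * ln (\<Prod>i\<in>UNIV. of_int (H i)) + real (nat L) * ln 2)"
      proof -
        have ln_split: "ln (x * (y ^ a * 2 ^ b)) = ln x + (real a * ln y + real b * ln 2)"
          if "x > 0" "y > 0" for x y :: real and a b :: nat
          using that by (simp add: ln_mult ln_realpow)
        have "real_of_int ?G > 0" using G0 by (simp only: of_int_0_less_iff)
        from ln_split[OF this PH] show ?thesis .
      qed
      also have "ln (\<Prod>i\<in>UNIV. real_of_int (H i)) = (\<Sum>i\<in>UNIV. height (f i))"
        unfolding height_def H_def [symmetric]
      proof (rule ln_prod)
        fix i
        show "real_of_int (H i) \<noteq> 0" using H1[of i] by linarith
      qed simp
      finally have "ln (real_of_int \<bar>S\<bar>) \<le> height1 g + of_int K * (\<Sum>i\<in>UNIV. height (f i)) + of_int L * ln 2"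
        using False L0 by (simp add: height1_def del: of_int_sum)
      then show ?thesis using S0 by (simp add: AR elog_def)
    qed
    then show ?thesis using False unfolding K_def [symmetric] L_def [symmetric]
      by (simp add: AR) (simp add: K_def)
  qed
qed

end
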